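(* Let $W$ be a finite Coxeter group, $M=M(W)$ its biHecke monoid and $\mathbb{K}$ a field. For each $w\in W$, the translation module $T_w$ is an indecomposable $M$-module, and it is a quotient of the indecomposable projective module $P_w$ of $M$.
   Context: $W$ is a finite Coxeter group with simple reflections $(s_i)_{i\in I}$, identity $1$, length $\ell$; $D_R(w)=\{i:\ell(ws_i)<\ell(w)\}$. Right (resp. left) weak order: $u\le_R v$ (resp. $u\le_L v$) if some reduced word of $u$ is a left factor/prefix (resp. right factor/suffix) of a reduced word of $v$; $[1,w]_R=\{u:u\le_R w\}$. The biHecke monoid $M(W)$ is the monoid of functions $W\to W$, acting on the right, generated by $\pi_i,\overline\pi_i$ ($i\in I$), where $w.\pi_i=w$ if $i\in D_R(w)$ and $ws_i$ otherwise; $w.\overline\pi_i=ws_i$ if $i\in D_R(w)$ and $w$ otherwise. Modules are right $\mathbb{K}[M]$-modules. $T_w$ has $\mathbb{K}$-basis $[1,w]_R$ and $M$-action: $u.\pi_i=u$ if $i\in D_R(u)$, $us_i$ if $i\notin D_R(u)$ and $us_i\in[1,w]_R$, $0$ otherwise; $u.\overline\pi_i=us_i$ if $i\in D_R(u)$ and $us_i\in[1,w]_R$, $u$ if $i\notin D_R(u)$ and $us_i\in[1,w]_R$, $0$ otherwise. For $J\subseteq I$, $W_J=\langle s_j:j\in J\rangle$ and ${}^{J}w$ is the minimal length element of $W_Jw$. $J$ is a left block of $w$ if $wW_K=W_Jw$ for some $K\subseteq I$; it is reduced if $J'\subsetneq J$ implies ${}^{J'}w>_L{}^{J}w$. Let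 $\overleftarrow{s}_i$ be the linear operator on $T_w$ with $\overleftarrow{s}_i.u=s_iu$ if $s_iu\in[1,w]_R$ and $-u$ otherwise, and $P^{(w)}_J=\{v\in T_w:\overleftarrow{s}_i.v=-v\ \forall i\in J\}$. The simple $M$-module $S_w$ is $T_w/\sum_J P^{(w)}_J$, the sum over nonempty reduced left blocks $J$ of $w$; $(S_w)_{w\in W}$ is a complete family of simple $M$-modules, and $P_w$ is the projective cover of $S_w$.
   Formalization: In the definition of S_w, the operator for i in J sends u = xm (x in W_J, m = ^J u) to x s_i m instead of s_i u, if that lies in [1,w]_R; the literal operator fails to give a submodule, e.g. for w = s_1 s_2 in S_3. *)

theory Defs
  imports "HOL-Algebra.Algebra" "HOL-Library.Sublist"
begin

section \<open>Right modules over a ring\<close>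

text \<open>
  The library's locale for modules needs a commutative ring and left scalars.  Here the record
  type \<^type>\<open>module\<close> is reused for right modules over an arbitrary ring: the term
  \<open>a \<odot> v\<close> stands for the right action \<open>v . a\<close>, so the associativity law below reads
  \<open>v . (a b) = (v . a) . b\<close>.  The multiplicative fields of the record are irrelevant.
\<close>

locale right_module = R?: ring R + V?: abelian_group V 
  for R :: "('r, 'x) ring_scheme" (structure) and V :: "('r, 'v, 'y) module_scheme" (structure) +
  assumes smult_closed:
      "\<lbrakk>a \<in> carrier R; v \<in> carrier V\<rbrakk> \<Longrightarrow> a \<odot>\<^bsub>V\<^esub> v \<in> carrier V"
    and smult_l_distr:
      "\<lbrakk>a \<in> carrier R; b \<in> carrier R; v \<in> carrier V\<rbrakk> \<Longrightarrow>
        (a \<oplus> b) \<odot>\<^bsub>V\<^esub> v = (a \<odot>\<^bsub>V\<^esub> v) \<oplus>\<^bsub>V\<^esub> (b \<odot>\<^bsub>V\<^esub> v)"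
    and smult_r_distr:
      "\<lbrakk>a \<in> carrier R; v \<in> carrier V; v' \<in> carrier V\<rbrakk> \<Longrightarrow>
        a \<odot>\<^bsub>V\<^esub> (v \<oplus>\<^bsub>V\<^esub> v') = (a \<odot>\<^bsub>V\<^esub> v) \<oplus>\<^bsub>V\<^esub> (a \<odot>\<^bsub>V\<^esub> v')"
    and smult_assoc_right:
      "\<lbrakk>a \<in> carrier R; b \<in> carrier R; v \<in> carrier V\<rbrakk> \<Longrightarrow>
        (a \<otimes> b) \<odot>\<^bsub>V\<^esub> v = b \<odot>\<^bsub>V\<^esub> (a \<odot>\<^bsub>V\<^esub> v)"
    and smult_one:
      "v \<in> carrier V \<Longrightarrow> \<one> \<odot>\<^bsub>V\<^esub> v = v"

definition mod_hom ::
  "('r, 'x) ring_scheme \<Rightarrow> ('r, 'v, 'y) module_scheme \<Rightarrow> ('r, 'u, 'z) module_scheme \<Rightarrow> ('v \<Rightarrow> 'u) set"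
  where
  "mod_hom R V U = {h \<in> carrier V \<rightarrow> carrier U.
     (\<forall>x\<in>carrier V. \<forall>y\<in>carrier V. h (x \<oplus>\<^bsub>V\<^esub> y) = h x \<oplus>\<^bsub>U\<^esub> h y) \<and>
     (\<forall>a\<in>carrier R. \<forall>x\<in>carrier V. h (a \<odot>\<^bsub>V\<^esub> x) = a \<odot>\<^bsub>U\<^esub> h x)}"

definition mod_isomorphic ::
  "('r, 'x) ring_scheme \<Rightarrow> ('r, 'v, 'y) module_scheme \<Rightarrow> ('r, 'u, 'z) module_scheme \<Rightarrow> bool" where
  "mod_isomorphic R V U \<longleftrightarrow> (\<exists>h\<in>mod_hom R V U. bij_betw h (carrier V) (carrier U))"

definition quotient_module ::
  "('r, 'v, 'y) module_scheme \<Rightarrow> 'v set \<Rightarrow> ('r, 'v set) module" where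
  "quotient_module V N =
     \<lparr>carrier = a_rcosets\<^bsub>V\<^esub> N, monoid.mult = undefined, one = undefined,
      ring.zero = N, add = set_add V,
      smult = (\<lambda>a C. \<Union>x\<in>C. N +>\<^bsub>V\<^esub> (a \<odot>\<^bsub>V\<^esub> x))\<rparr>"

definition is_quotient_of ::
  "('r, 'x) ring_scheme \<Rightarrow> ('r, 'u, 'z) module_scheme \<Rightarrow> ('r, 'v, 'y) module_scheme \<Rightarrow> bool" where
  "is_quotient_of R U V \<longleftrightarrow>
     (\<exists>N. submodule N R V \<and> mod_isomorphic R (quotient_module V N) U)"

definition indecomposable_module ::
  "('r, 'x) ring_scheme \<Rightarrow> ('r, 'v, 'y) module_scheme \<Rightarrow> bool" where
  "indecomposable_module R V \<longleftrightarrow> right_module R V \<and> carrier V \<noteq> {\<zero>\<^bsub>V\<^esub>} \<and>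
     (\<forall>A B. submodule A R V \<and> submodule B R V \<and>
            A <+>\<^bsub>V\<^esub> B = carrier V \<and> A \<inter> B = {\<zero>\<^bsub>V\<^esub>} \<longrightarrow>
            A = {\<zero>\<^bsub>V\<^esub>} \<or> B = {\<zero>\<^bsub>V\<^esub>})"

text \<open>
  The lifting property of a projective module.  HOL cannot quantify over the types of the test
  modules, but the types chosen here lose nothing: the free module on the set \<open>carrier P\<close> lives
  in \<open>'v \<Rightarrow> 'r\<close>, so lifting the identity of \<open>P\<close> along the canonical map from it exhibits \<open>P\<close> as a
  direct summand of a free module, whence the lifting property against all modules.
\<close>

definition projective_module ::
  "('r, 'x) ring_scheme \<Rightarrow> ('r, 'v) module \<Rightarrow> bool" where
  "projective_module R P \<longleftrightarrow> right_module R P \<and>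
     (\<forall>(A :: ('r, 'v \<Rightarrow> 'r) module) (B :: ('r, 'v) module) g h.
        right_module R A \<and> right_module R B \<and>
        g \<in> mod_hom R A B \<and> g ` carrier A = carrier B \<and> h \<in> mod_hom R P B \<longrightarrow>
        (\<exists>k\<in>mod_hom R P A. \<forall>x\<in>carrier P. g (k x) = h x))"

definition superfluous ::
  "('r, 'x) ring_scheme \<Rightarrow> ('r, 'v, 'y) module_scheme \<Rightarrow> 'v set \<Rightarrow> bool" where
  "superfluous R V N \<longleftrightarrow> submodule N R V \<and>
     (\<forall>L. submodule L R V \<and> N <+>\<^bsub>V\<^esub> L = carrier V \<longrightarrow> L = carrier V)"

definition projective_cover ::
  "('r, 'x) ring_scheme \<Rightarrow> ('r, 'v) module \<Rightarrow> ('r, 'u, 'z) module_scheme \<Rightarrow> bool" where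
  "projective_cover R P S \<longleftrightarrow> projective_module R P \<and>
     (\<exists>p\<in>mod_hom R P S. p ` carrier P = carrier S \<and>
        superfluous R P {x \<in> carrier P. p x = \<zero>\<^bsub>S\<^esub>})"


section \<open>Monoid algebras\<close>

definition single :: "'x \<Rightarrow> 'k \<Rightarrow> 'x \<Rightarrow> 'k::zero" where
  "single x c = (\<lambda>y. if y = x then c else 0)"

definition monoid_algebra :: "('m, 'x) monoid_scheme \<Rightarrow> ('m \<Rightarrow> 'k::field) ring" where
  "monoid_algebra M =
     \<lparr>carrier = {a. finite {f. a f \<noteq> 0} \<and> {f. a f \<noteq> 0} \<subseteq> carrier M},
      monoid.mult = (\<lambda>a b h. \<Sum>f\<in>{f. a f \<noteq> 0}. \<Sum>g\<in>{g. b g \<noteq> 0}.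
                          if f \<otimes>\<^bsub>M\<^esub> g = h then a f * b g else 0),
      one = single \<one>\<^bsub>M\<^esub> 1,
      ring.zero = (\<lambda>_. 0),
      add = (\<lambda>a b f. a f + b f)\<rparr>"


section \<open>Coxeter groups\<close>

context
  fixes W :: "('a, 'b) monoid_scheme" (structure)
    and I :: "'i set"
    and s :: "'i \<Rightarrow> 'a"
begin

definition word_prod :: "'i list \<Rightarrow> 'a" where
  "word_prod a = foldr (\<lambda>i x. s i \<otimes> x) a \<one>"

text \<open>
  The congruence on words generated by \<open>(s\<^sub>i s\<^sub>j)\<^sup>m = 1\<close> with \<open>m\<close> the order of \<open>s\<^sub>i s\<^sub>j\<close>.  The
  relations for \<open>i = j\<close> (where \<open>m = 1\<close>) make every letter its own inverse, so the quotient monoid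
  is the group with this presentation.
\<close>

inductive coxeter_cong :: "'i list \<Rightarrow> 'i list \<Rightarrow> bool" where
  relation: "\<lbrakk>i \<in> I; j \<in> I\<rbrakk> \<Longrightarrow>
     coxeter_cong (a @ concat (replicate (group.ord W (s i \<otimes> s j)) [i, j]) @ b) (a @ b)"
| refl: "coxeter_cong a a"
| sym: "coxeter_cong a b \<Longrightarrow> coxeter_cong b a"
| trans: "\<lbrakk>coxeter_cong a b; coxeter_cong b c\<rbrakk> \<Longrightarrow> coxeter_cong a c"

text \<open>
  Bourbaki's definition: a generating set of elements of order two such that the relations
  \<open>(s\<^sub>i s\<^sub>j)\<^sup>m = 1\<close>, \<open>m\<close> the order of \<open>s\<^sub>i s\<^sub>j\<close>, form a presentation of \<open>W\<close>.
\<close>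

definition finite_coxeter_system :: bool where
  "finite_coxeter_system \<longleftrightarrow>
     group W \<and> finite (carrier W) \<and>
     s \<in> I \<rightarrow> carrier W \<and> inj_on s I \<and>
     (\<forall>i\<in>I. s i \<noteq> \<one> \<and> s i \<otimes> s i = \<one>) \<and>
     generate W (s ` I) = carrier W \<and>
     (\<forall>a\<in>lists I. \<forall>b\<in>lists I. word_prod a = word_prod b \<longrightarrow> coxeter_cong a b)"

definition len :: "'a \<Rightarrow> nat" where
  "len w = (LEAST n. \<exists>a\<in>lists I. word_prod a = w \<and> length a = n)"

definition reduced_word :: "'i list \<Rightarrow> 'a \<Rightarrow> bool" where
  "reduced_word a w \<longleftrightarrow> a \<in> lists I \<and> word_prod a = w \<and> length a = len w"

definition D_R :: "'a \<Rightarrow> 'i set" where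
  "D_R w = {i \<in> I. len (w \<otimes> s i) < len w}"

definition le_R :: "'a \<Rightarrow> 'a \<Rightarrow> bool" where
  "le_R u v \<longleftrightarrow> (\<exists>a b. reduced_word a u \<and> reduced_word b v \<and> prefix a b)"

definition le_L :: "'a \<Rightarrow> 'a \<Rightarrow> bool" where
  "le_L u v \<longleftrightarrow> (\<exists>a b. reduced_word a u \<and> reduced_word b v \<and> suffix a b)"

definition interval_R :: "'a \<Rightarrow> 'a set" where
  "interval_R w = {u \<in> carrier W. le_R u w}"

definition parabolic :: "'i set \<Rightarrow> 'a set" where
  "parabolic J = generate W (s ` J)"

definition min_rep :: "'i set \<Rightarrow> 'a \<Rightarrow> 'a" where
  "min_rep J w = (THE x. x \<in> parabolic J #> w \<and> (\<forall>y\<in>parabolic J #> w. len x \<le> len y))"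

definition left_block :: "'a \<Rightarrow> 'i set \<Rightarrow> bool" where
  "left_block w J \<longleftrightarrow> J \<subseteq> I \<and> (\<exists>K\<subseteq>I. w <# parabolic K = parabolic J #> w)"

definition reduced_left_block :: "'a \<Rightarrow> 'i set \<Rightarrow> bool" where
  "reduced_left_block w J \<longleftrightarrow> left_block w J \<and>
     (\<forall>J'. J' \<subset> J \<longrightarrow> le_L (min_rep J w) (min_rep J' w) \<and> min_rep J' w \<noteq> min_rep J w)"


section \<open>The biHecke monoid\<close>

definition pi_op :: "'i \<Rightarrow> 'a \<Rightarrow> 'a" where
  "pi_op i = (\<lambda>w\<in>carrier W. if i \<in> D_R w then w else w \<otimes> s i)"

definition pibar_op :: "'i \<Rightarrow> 'a \<Rightarrow> 'a" where
  "pibar_op i = (\<lambda>w\<in>carrier W. if i \<in> D_R w then w \<otimes> s i else w)"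

inductive_set biHecke_set :: "('a \<Rightarrow> 'a) set" where
  one: "(\<lambda>w\<in>carrier W. w) \<in> biHecke_set"
| pi: "\<lbrakk>f \<in> biHecke_set; i \<in> I\<rbrakk> \<Longrightarrow> compose (carrier W) (pi_op i) f \<in> biHecke_set"
| pibar: "\<lbrakk>f \<in> biHecke_set; i \<in> I\<rbrakk> \<Longrightarrow> compose (carrier W) (pibar_op i) f \<in> biHecke_set"

text \<open>Functions act on the right, so in the product \<open>f g\<close> the function \<open>f\<close> is applied first.\<close>

definition biHecke :: "('a \<Rightarrow> 'a) monoid" where
  "biHecke = \<lparr>carrier = biHecke_set,
              monoid.mult = (\<lambda>f g. compose (carrier W) g f),
              one = (\<lambda>w\<in>carrier W. w)\<rparr>"


section \<open>Translation modules and simple modules\<close>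

text \<open>
  Elements of \<open>T\<^sub>w\<close> are functions vanishing outside the interval \<open>[1,w]\<^sub>R\<close>, with basis
  \<open>single u 1\<close> for \<open>u\<close> in that interval.  The predicate says that \<open>T\<close> is a right module over the
  monoid algebra on this vector space in which the generators of the monoid act as prescribed;
  this determines the action on the carrier.
\<close>

definition translation_space :: "'a \<Rightarrow> ('a \<Rightarrow> 'k::field) set" where
  "translation_space w = {v. \<forall>u. u \<notin> interval_R w \<longrightarrow> v u = 0}"

definition translation_module ::
  "'a \<Rightarrow> (('a \<Rightarrow> 'a) \<Rightarrow> 'k::field, 'a \<Rightarrow> 'k) module \<Rightarrow> bool" where
  "translation_module w T \<longleftrightarrow>
     right_module (monoid_algebra biHecke :: (('a \<Rightarrow> 'a) \<Rightarrow> 'k) ring) T \<and>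
     carrier T = translation_space w \<and>
     (\<forall>v\<in>carrier T. \<forall>v'\<in>carrier T. v \<oplus>\<^bsub>T\<^esub> v' = (\<lambda>u. v u + v' u)) \<and>
     (\<forall>c. \<forall>v\<in>carrier T. single \<one>\<^bsub>biHecke\<^esub> c \<odot>\<^bsub>T\<^esub> v = (\<lambda>u. c * v u)) \<and>
     (\<forall>i\<in>I. \<forall>u\<in>interval_R w.
        single (pi_op i) 1 \<odot>\<^bsub>T\<^esub> single u 1 =
          (if i \<in> D_R u then single u 1
           else if u \<otimes> s i \<in> interval_R w then single (u \<otimes> s i) 1
           else (\<lambda>_. 0)) \<and>
        single (pibar_op i) 1 \<odot>\<^bsub>T\<^esub> single u 1 =
          (if i \<in> D_R u \<and> u \<otimes> s i \<in> interval_R w then single (u \<otimes> s i) 1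
           else if i \<notin> D_R u \<and> u \<otimes> s i \<in> interval_R w then single u 1
           else (\<lambda>_. 0)))"

text \<open>
  The left operator of \<open>i \<in> J\<close> on \<open>T\<^sub>w\<close>.  Write \<open>u = x m\<close> with \<open>x\<close> in \<open>W\<^sub>J\<close> and \<open>m\<close> minimal in
  \<open>W\<^sub>J u\<close>; the operator sends \<open>u\<close> to \<open>x s\<^sub>i m\<close> if this lies in \<open>[1,w]\<^sub>R\<close> and to \<open>-u\<close> otherwise.
  The literature has \<open>s\<^sub>i u\<close> in place of \<open>x s\<^sub>i m\<close>.  The two agree when \<open>J\<close> has at most one element,
  and they give the same antisymmetric vectors when \<open>w\<close> is the longest element.  In general,
  though, the literal operator does not give a submodule: let \<open>w = s\<^sub>1 s\<^sub>2\<close> in the symmetric group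
  on three letters and \<open>J = {1,2}\<close>, the only nonempty reduced left block of \<open>w\<close>.  Then
  \<open>[1,w]\<^sub>R = {1, s\<^sub>1, s\<^sub>1 s\<^sub>2}\<close>, the vector \<open>s\<^sub>1 s\<^sub>2\<close> is sent to its negative by both literal
  operators, but its image \<open>s\<^sub>1\<close> under \<open>\<pi>bar\<^sub>2\<close> is not, and the quotient would not be a
  module.  With \<open>x s\<^sub>i m\<close> the antisymmetric vectors for a left block \<open>J\<close> of \<open>w\<close> are spanned by
  the alternating sums of \<open>(-1)\<^sup>l\<^sup>(\<^sup>x\<^sup>) x u\<close> over all \<open>x\<close> in \<open>W\<^sub>J\<close> with \<open>x u\<close> in \<open>[1,w]\<^sub>R\<close>, one for
  each \<open>u\<close> in \<open>[1,m]\<^sub>R\<close>, where \<open>m\<close> is the minimal element of \<open>W\<^sub>J w\<close>.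
\<close>

definition left_refl_basis :: "'a \<Rightarrow> 'i set \<Rightarrow> 'i \<Rightarrow> 'a \<Rightarrow> ('a \<Rightarrow> 'k::field)" where
  "left_refl_basis w J i u =
     (let m = min_rep J u; x = u \<otimes> inv m; u' = x \<otimes> s i \<otimes> m
      in if u' \<in> interval_R w then single u' 1 else single u (- 1))"

definition left_refl :: "'a \<Rightarrow> 'i set \<Rightarrow> 'i \<Rightarrow> ('a \<Rightarrow> 'k::field) \<Rightarrow> ('a \<Rightarrow> 'k)" where
  "left_refl w J i v = (\<lambda>y. \<Sum>u\<in>interval_R w. v u * left_refl_basis w J i u y)"

definition P_sub :: "'a \<Rightarrow> 'i set \<Rightarrow> ('a \<Rightarrow> 'k::field) set" where
  "P_sub w J = {v \<in> translation_space w. \<forall>i\<in>J. left_refl w J i v = (\<lambda>u. - v u)}"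

definition P_sum :: "'a \<Rightarrow> ('a \<Rightarrow> 'k::field) set" where
  "P_sum w = (let \<B> = {J. J \<noteq> {} \<and> reduced_left_block w J} in
     {v. \<exists>p. (\<forall>J\<in>\<B>. p J \<in> P_sub w J) \<and> v = (\<lambda>u. \<Sum>J\<in>\<B>. p J u)})"

definition simple_quotient ::
  "'a \<Rightarrow> (('a \<Rightarrow> 'a) \<Rightarrow> 'k::field, 'a \<Rightarrow> 'k) module \<Rightarrow> (('a \<Rightarrow> 'a) \<Rightarrow> 'k, ('a \<Rightarrow> 'k) set) module" where
  "simple_quotient w T = quotient_module T (P_sum w)"

end

end

theory Submission
  imports Defs
begin

text \<open>
  Let \<open>y = w\<^sub>0 w\<inverse>\<close> with \<open>w\<^sub>0\<close> the longest element of the group.  The interval \<open>[1,w]\<^sub>R\<close>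
  consists of the elements \<open>u\<close> such that the lengths add up in the product \<open>y u\<close>.  An operator
  \<open>\<pi>\<^sub>i\<close> or \<open>\<pi>bar\<^sub>i\<close>, applied to such a product \<open>x u\<close>, gives a product \<open>x' u'\<close> in which the lengths
  add up again, where \<open>u'\<close> is the image of \<open>u\<close> and either \<open>x' = x\<close> or \<open>x'\<close> is shorter
  (\<open>generator_preserves_product\<close>, from the exchange condition).  Since left factors never grow,
  declaring \<open>u\<close> to be sent to zero as soon as \<open>y\<close> is lost gives a matrix representation of the
  whole monoid, and this is the translation module \<open>T\<close> (\<open>translation_module_exists\<close>).  The
  exchange condition itself comes from the presentation of the group through the parity with which
  a reflection occurs in a word.

  The module \<open>T\<close> is local.  From any basis vector the operators \<open>\<pi>bar\<close> lead down to the identity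
  element and the operators \<open>\<pi>\<close> lead up to every other basis vector.  Moreover the product of
  the \<open>\<pi>\<^sub>i\<close> along a reduced word of \<open>w\<close> maps \<open>T\<close> to the line of the basis vector \<open>w\<close>: the image of
  \<open>u = u 1\<close> has the form \<open>u' w\<close> with lengths adding up, so it is too long to be in the interval
  unless it is \<open>w\<close>.  A proper submodule is therefore killed by this product, which does not kill
  \<open>T\<close>, and so the sum of the proper submodules is proper (\<open>submodule_eq_carrier\<close>).

  Next, the antisymmetric vectors of a left block \<open>J\<close> form a submodule.  Write \<open>w = x\<^sub>0 m\<close> with \<open>x\<^sub>0\<close>
  in \<open>W\<^sub>J\<close> and \<open>m\<close> minimal in its coset.  Because \<open>m\<close> conjugates \<open>W\<^sub>J\<close> to a standard parabolic
  subgroup, the interval is a product of an interval of \<open>W\<^sub>J\<close> and the interval below \<open>m\<close>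
  (\<open>intertwines_below_iff\<close>), and by Deodhar's lemma the operators act on the second factor or
  exchange two antisymmetric coordinates (\<open>submodule_P_sub\<close>).  For a nonempty reduced block the
  submodule is proper, and so is the sum \<open>N\<close> over all these blocks.

  The rest holds for every local module \<open>T\<close> with a proper submodule \<open>N\<close>
  (\<open>projective_cover_of_local_quotient\<close>).  The cover \<open>P\<close> of \<open>T/N\<close> lifts to a map from \<open>P\<close> to \<open>T\<close>.
  Its image and \<open>N\<close> span \<open>T\<close>, so it is surjective.  If \<open>P\<close> is the sum of two submodules, then one of
  them maps onto \<open>T\<close>, hence onto \<open>T/N\<close>, and it equals \<open>P\<close> because the kernel of the cover is
  superfluous.
\<close>

section \<open>Length and exchange in a finite Coxeter group\<close>

locale coxeter_system = group W for W :: "('a, 'b) monoid_scheme" (structure) +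
  fixes I :: "'i set" and s :: "'i \<Rightarrow> 'a"
  assumes coxeter: "finite_coxeter_system W I s"
begin

abbreviation word :: "'i list \<Rightarrow> 'a" where "word \<equiv> word_prod W s"
abbreviation length_of :: "'a \<Rightarrow> nat" ("\<ell>") where "length_of \<equiv> len W I s"
abbreviation descents :: "'a \<Rightarrow> 'i set" where "descents \<equiv> D_R W I s"

lemma finite_carrier: "finite (carrier W)"
  using coxeter by (simp add: finite_coxeter_system_def)

lemma s_closed [simp, intro]: "i \<in> I \<Longrightarrow> s i \<in> carrier W"
  using coxeter by (auto simp: finite_coxeter_system_def)

lemma s_square [simp]: "i \<in> I \<Longrightarrow> s i \<otimes> s i = \<one>"
  using coxeter by (auto simp: finite_coxeter_system_def)

lemma s_neq_one: "i \<in> I \<Longrightarrow> s i \<noteq> \<one>"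
  using coxeter by (auto simp: finite_coxeter_system_def)

lemma finite_I: "finite I"
proof -
  have "inj_on s I" "s ` I \<subseteq> carrier W"
    using coxeter by (auto simp: finite_coxeter_system_def)
  then show ?thesis using finite_carrier finite_imageD finite_subset by blast
qed

lemma inv_cancel_left [simp]:
  "x \<in> carrier W \<Longrightarrow> y \<in> carrier W \<Longrightarrow> inv x \<otimes> (x \<otimes> y) = y"
  "x \<in> carrier W \<Longrightarrow> y \<in> carrier W \<Longrightarrow> x \<otimes> (inv x \<otimes> y) = y"
  by (simp_all flip: m_assoc)

lemma s_cancel_left [simp]: "i \<in> I \<Longrightarrow> x \<in> carrier W \<Longrightarrow> s i \<otimes> (s i \<otimes> x) = x"
  by (simp flip: m_assoc)

lemma inv_s [simp]: "i \<in> I \<Longrightarrow> inv (s i) = s i"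
  by (simp add: inv_equality)

lemma word_Nil [simp]: "word [] = \<one>" and word_Cons [simp]: "word (i # a) = s i \<otimes> word a"
  by (simp_all add: word_prod_def)

lemma word_closed [simp, intro]: "a \<in> lists I \<Longrightarrow> word a \<in> carrier W"
  by (induction a) auto

lemma word_append [simp]:
  "a \<in> lists I \<Longrightarrow> b \<in> lists I \<Longrightarrow> word (a @ b) = word a \<otimes> word b"
  by (induction a) (auto simp: m_assoc)

lemma word_rev: "a \<in> lists I \<Longrightarrow> word (rev a) = inv (word a)"
  by (induction a) (auto simp: inv_mult_group in_lists_conv_set)

lemma generate_eq_words:
  assumes "J \<subseteq> I" shows "generate W (s ` J) = word ` lists J"
proof
  show "generate W (s ` J) \<subseteq> word ` lists J"
  proof
    fix x assume "x \<in> generate W (s ` J)"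
    then show "x \<in> word ` lists J"
    proof induction
      case one
      show ?case by (rule image_eqI[of _ _ "[]"]) auto
    next
      case (incl h)
      then obtain j where "j \<in> J" "h = s j" by auto
      then show ?case using assms by (intro image_eqI[of _ _ "[j]"]) auto
    next
      case (inv h)
      then obtain j where "j \<in> J" "h = s j" by auto
      then show ?case using assms by (intro image_eqI[of _ _ "[j]"]) auto
    next
      case (eng h1 h2)
      then obtain a b where "a \<in> lists J" "b \<in> lists J" "h1 = word a" "h2 = word b" by auto
      moreover have "a \<in> lists I" "b \<in> lists I" using calculation assms by auto
      ultimately show ?case by (intro image_eqI[of _ _ "a @ b"]) auto
    qed
  qed
  show "word ` lists J \<subseteq> generate W (s ` J)"
  proof
    fix x assume "x \<in> word ` lists J"
    then obtain a where "a \<in> lists J" "x = word a" by auto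
    then show "x \<in> generate W (s ` J)"
      by (induction a arbitrary: x) (auto intro: generate.intros)
  qed
qed

lemma word_surj: assumes "w \<in> carrier W" shows "\<exists>a\<in>lists I. word a = w"
proof -
  have "generate W (s ` I) = carrier W" using coxeter by (simp add: finite_coxeter_system_def)
  then have "w \<in> word ` lists I" using generate_eq_words[of I] assms by simp
  then show ?thesis by blast
qed

lemma reduced_word_exists:
  assumes "w \<in> carrier W"
  obtains a where "a \<in> lists I" "word a = w" "length a = \<ell> w"
proof -
  obtain a where "a \<in> lists I" "word a = w" using word_surj[OF assms] by auto
  then have "\<exists>n. \<exists>a\<in>lists I. word a = w \<and> length a = n" by blast
  from LeastI_ex[OF this] show ?thesis using that unfolding len_def by blast
qed

lemma len_le: "a \<in> lists I \<Longrightarrow> \<ell> (word a) \<le> length a"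
  unfolding len_def by (rule Least_le) blast

lemma len_mult_le:
  assumes "x \<in> carrier W" "y \<in> carrier W" shows "\<ell> (x \<otimes> y) \<le> \<ell> x + \<ell> y"
proof -
  obtain a where "a \<in> lists I" "word a = x" "length a = \<ell> x"
    using reduced_word_exists[OF assms(1)] .
  moreover obtain b where "b \<in> lists I" "word b = y" "length b = \<ell> y"
    using reduced_word_exists[OF assms(2)] .
  ultimately show ?thesis using len_le[of "a @ b"] by auto
qed

lemma len_one [simp]: "\<ell> \<one> = 0"
  using len_le[of "[]"] by simp

lemma len_eq_0: "x \<in> carrier W \<Longrightarrow> \<ell> x = 0 \<longleftrightarrow> x = \<one>"
  by (metis len_one length_0_conv reduced_word_exists word_Nil)

lemma len_inv [simp]: assumes "x \<in> carrier W" shows "\<ell> (inv x) = \<ell> x"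
proof -
  have "\<ell> (inv y) \<le> \<ell> y" if y: "y \<in> carrier W" for y
  proof -
    obtain a where a: "a \<in> lists I" "word a = y" "length a = \<ell> y"
      using reduced_word_exists[OF y] .
    then have "rev a \<in> lists I" by auto
    from len_le[OF this] show ?thesis using a by (simp add: word_rev)
  qed
  from this[of x] this[of "inv x"] show ?thesis using assms by simp
qed

lemma len_s [simp]: assumes "i \<in> I" shows "\<ell> (s i) = 1"
  using len_le[of "[i]"] len_eq_0[of "s i"] s_neq_one assms by fastforce

text \<open>
  The reflections attached to a word \<open>i\<^sub>1 \<dots> i\<^sub>k\<close> are the elements
  \<open>s\<^sub>1 \<dots> s\<^sub>p \<dots> s\<^sub>1\<close>; deleting the \<open>p\<close>-th letter multiplies the product by this element
  from the left.
\<close>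

fun reflections :: "'i list \<Rightarrow> 'a list" where
  "reflections [] = []"
| "reflections (i # a) = s i # map (\<lambda>t. s i \<otimes> t \<otimes> s i) (reflections a)"

lemma reflections_closed: "a \<in> lists I \<Longrightarrow> set (reflections a) \<subseteq> carrier W"
  by (induction a) auto

lemma reflections_append:
  assumes "a \<in> lists I" "b \<in> lists I"
  shows "reflections (a @ b) =
    reflections a @ map (\<lambda>t. word a \<otimes> t \<otimes> inv (word a)) (reflections b)"
  using assms
proof (induction a)
  case Nil
  have "t \<in> carrier W" if "t \<in> set (reflections b)" for t
    using that Nil reflections_closed[of b] by blast
  then show ?case by (simp add: map_idI)
next
  case (Cons i a)
  have e: "s i \<otimes> (word a \<otimes> t \<otimes> inv (word a)) \<otimes> s i =
      word (i # a) \<otimes> t \<otimes> inv (word (i # a))" if "t \<in> set (reflections b)" for t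
    using that Cons.hyps Cons.prems reflections_closed[of b]
    by (simp add: m_assoc inv_mult_group subset_iff)
  have "reflections ((i # a) @ b) = reflections (i # a) @
      map (\<lambda>t. s i \<otimes> (word a \<otimes> t \<otimes> inv (word a)) \<otimes> s i) (reflections b)"
    by (simp add: Cons.IH[OF Cons.prems] comp_def)
  also have "map (\<lambda>t. s i \<otimes> (word a \<otimes> t \<otimes> inv (word a)) \<otimes> s i) (reflections b) =
      map (\<lambda>t. word (i # a) \<otimes> t \<otimes> inv (word (i # a))) (reflections b)"
    by (rule map_cong[OF HOL.refl]) (rule e)
  finally show ?case .
qed

lemma count_list_conj:
  assumes "set xs \<subseteq> carrier W" "g \<in> carrier W" "t \<in> carrier W"
  shows "count_list (map (\<lambda>t. g \<otimes> t \<otimes> inv g) xs) t = count_list xs (inv g \<otimes> t \<otimes> g)"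
proof -
  have "g \<otimes> x \<otimes> inv g = t \<longleftrightarrow> x = inv g \<otimes> t \<otimes> g" if "x \<in> carrier W" for x
  proof
    assume "g \<otimes> x \<otimes> inv g = t"
    then have "inv g \<otimes> t \<otimes> g = inv g \<otimes> (g \<otimes> x \<otimes> inv g) \<otimes> g" by simp
    also have "\<dots> = x" using that assms by (simp add: m_assoc)
    finally show "x = inv g \<otimes> t \<otimes> g" by simp
  next
    assume "x = inv g \<otimes> t \<otimes> g"
    then show "g \<otimes> x \<otimes> inv g = t" using assms by (simp add: m_assoc)
  qed
  then show ?thesis using assms(1) by (induction xs) auto
qed

lemma count_reflections_append:
  assumes "a \<in> lists I" "b \<in> lists I" "t \<in> carrier W"
  shows "count_list (reflections (a @ b)) t =
    count_list (reflections a) t +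
    count_list (reflections b) (inv (word a) \<otimes> t \<otimes> word a)"
  using assms reflections_closed[of b] by (simp add: reflections_append count_list_conj)

lemma reflections_dihedral:
  assumes "i \<in> I" "j \<in> I"
  shows "reflections (concat (replicate n [i, j])) =
    map (\<lambda>p. (s i \<otimes> s j) [^] p \<otimes> s i) [0..<2 * n]"
proof (induction n)
  case (Suc n)
  define d where "d = s i \<otimes> s j"
  have d: "d \<in> carrier W" using assms d_def by auto
  have e: "d [^] Suc (Suc p) = d \<otimes> (d [^] p \<otimes> d)" for p
    using nat_pow_Suc2[OF d, of "Suc p"] by simp
  have u: "[0..<2 * Suc n] = 0 # 1 # map (\<lambda>p. Suc (Suc p)) [0..<2 * n]"
    by (simp add: upt_conv_Cons map_Suc_upt[symmetric] del: upt_Suc)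
  have "s i \<otimes> (s j \<otimes> (d [^] p \<otimes> s i) \<otimes> s j) \<otimes> s i = d [^] Suc (Suc p) \<otimes> s i" for p
    unfolding e using assms d by (simp add: m_assoc d_def)
  then show ?case
    unfolding u using Suc assms d by (simp add: d_def m_assoc comp_def)
qed simp

lemma coxeter_cong_lists:
  "coxeter_cong W I s a b \<Longrightarrow> a \<in> lists I \<longleftrightarrow> b \<in> lists I"
proof (induction rule: coxeter_cong.induct)
  case (relation i j a b)
  then have "concat (replicate n [i, j]) \<in> lists I" for n by (induction n) auto
  then show ?case by auto
qed auto

lemma word_dihedral:
  "i \<in> I \<Longrightarrow> j \<in> I \<Longrightarrow> word (concat (replicate n [i, j])) = (s i \<otimes> s j) [^] n"
proof (induction n)
  case (Suc n)
  have "(s i \<otimes> s j) [^] Suc n = s i \<otimes> s j \<otimes> (s i \<otimes> s j) [^] n"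
    using Suc.prems by (simp only: nat_pow_Suc2 m_closed s_closed)
  then show ?case using Suc by (simp add: m_assoc del: nat_pow_Suc)
qed simp

text \<open>
  The relation \<open>(s\<^sub>i s\<^sub>j)\<^sup>m = 1\<close> contributes \<open>2 m\<close> reflections in which every reflection
  of the dihedral group occurs twice.  Therefore the parity of the multiplicity of a reflection
  depends only on the group element.  This is the point where the presentation of the group is used.
\<close>

lemma even_count_reflections_cong:
  assumes "coxeter_cong W I s a b" "a \<in> lists I" "t \<in> carrier W"
  shows "even (count_list (reflections a) t + count_list (reflections b) t)"
  using assms
proof (induction rule: coxeter_cong.induct)
  case (relation i j a b)
  define r where "r = concat (replicate (ord (s i \<otimes> s j)) [i, j])"
  have r: "r \<in> lists I" "a \<in> lists I" "b \<in> lists I"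
    using relation by (auto simp: r_def)
  have wr: "word r = \<one>" using relation by (simp add: r_def word_dihedral)
  have even: "even (count_list (reflections r) u)" for u
  proof -
    define n where "n = ord (s i \<otimes> s j)"
    define f where "f = (\<lambda>p::nat. (s i \<otimes> s j) [^] p \<otimes> s i)"
    have "f (p + n) = f p" for p
      using relation pow_ord_eq_1[of "s i \<otimes> s j"]
      by (simp add: f_def n_def flip: nat_pow_mult)
    then have p: "map f [n..<n + n] = map f [0..<n]"
      unfolding map_add_upt[of n n, symmetric] by (simp add: comp_def)
    have "reflections r = map f [0..<n + n]"
      using relation reflections_dihedral[of i j n] by (simp add: r_def n_def f_def mult_2)
    also have "\<dots> = map f [0..<n] @ map f [n..<n + n]"
      by (simp flip: map_append upt_add_eq_append[OF le0])
    finally have "count_list (reflections r) u = 2 * count_list (map f [0..<n]) u"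
      using p by simp
    then show ?thesis by simp
  qed
  show ?case
    unfolding r_def[symmetric] using r relation(4) wr even[of "inv word a \<otimes> t \<otimes> word a"]
    by (simp add: count_reflections_append m_assoc)
next
  case (refl a)
  then show ?case by simp
next
  case (sym a b)
  then show ?case using coxeter_cong_lists by (metis add.commute)
next
  case (trans a b c)
  then show ?case using coxeter_cong_lists[OF trans(1)] by (metis even_add)
qed

lemma even_count_reflections:
  assumes "a \<in> lists I" "b \<in> lists I" "word a = word b" "t \<in> carrier W"
  shows "even (count_list (reflections a) t) \<longleftrightarrow> even (count_list (reflections b) t)"
proof -
  have "coxeter_cong W I s a b"
    using coxeter assms by (auto simp: finite_coxeter_system_def)
  from even_count_reflections_cong[OF this assms(1,4)] show ?thesis by simp
qed

lemma delete_letter: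
  assumes "a \<in> lists I" "t \<in> set (reflections a)"
  shows "\<exists>b j c. a = b @ j # c \<and> t \<otimes> word a = word (b @ c)"
  using assms
proof (induction a arbitrary: t rule: list.induct)
  case (Cons i a)
  have a: "a \<in> lists I" "i \<in> I" using Cons.prems by auto
  show ?case
  proof (cases "t = s i")
    case True
    then have "t \<otimes> word (i # a) = word ([] @ a)" using a by simp
    then show ?thesis by blast
  next
    case False
    then obtain t' where t': "t' \<in> set (reflections a)" "t = s i \<otimes> t' \<otimes> s i"
      using Cons.prems by auto
    obtain b j c where b: "a = b @ j # c" "t' \<otimes> word a = word (b @ c)"
      using Cons.IH[OF a(1) t'(1)] by blast
    have "t' \<in> carrier W" using reflections_closed[OF a(1)] t' by auto
    then have "t \<otimes> word (i # a) = s i \<otimes> (t' \<otimes> word a)"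
      using a t'(2) by (simp add: m_assoc)
    then have "t \<otimes> word (i # a) = word ((i # b) @ c)"
      using b(2) by simp
    moreover have "i # a = (i # b) @ j # c" using b(1) by simp
    ultimately show ?thesis by blast
  qed
qed simp

text \<open>
  If \<open>s\<^sub>i\<close> occurs an odd number of times among the reflections of a word for \<open>w\<close>, then it occurs
  in the list of every word for \<open>w\<close>, and deleting a letter shows that \<open>s\<^sub>i w\<close> is shorter.
  Otherwise the same applies to \<open>s\<^sub>i w\<close>, whose multiplicity of \<open>s\<^sub>i\<close> differs by one.
\<close>

lemma len_s_mult_cases:
  assumes "a \<in> lists I" "i \<in> I"
  shows "if odd (count_list (reflections a) (s i))
         then \<ell> (s i \<otimes> word a) < \<ell> (word a) else \<ell> (word a) < \<ell> (s i \<otimes> word a)"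
proof -
  have shorter: "\<ell> (s i \<otimes> word a) < \<ell> (word a)"
    if a: "a \<in> lists I" and odd: "odd (count_list (reflections a) (s i))" for a
  proof -
    obtain d where d: "d \<in> lists I" "word d = word a" "length d = \<ell> (word a)"
      using reduced_word_exists[OF word_closed[OF a]] .
    have "odd (count_list (reflections d) (s i))"
      using even_count_reflections[OF d(1) a d(2), of "s i"] odd assms(2) by simp
    then have "s i \<in> set (reflections d)"
      using count_notin[of "s i" "reflections d"] by (cases "s i \<in> set (reflections d)") simp_all
    from delete_letter[OF d(1) this] obtain b j c
      where b: "d = b @ j # c" "s i \<otimes> word d = word (b @ c)" by blast
    moreover have "b @ c \<in> lists I" using b d by auto
    ultimately show ?thesis using len_le[of "b @ c"] d by auto
  qed
  have "s i \<otimes> s i \<otimes> s i = s i" using assms by simp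
  then have "odd (count_list (reflections (i # a)) (s i)) \<longleftrightarrow>
      even (count_list (reflections a) (s i))"
    using count_reflections_append[of "[i]" a "s i"] assms by simp
  moreover have "s i \<otimes> word (i # a) = word a" using assms by simp
  ultimately show ?thesis using shorter[of a] shorter[of "i # a"] assms by auto
qed

lemma exchange_left:
  assumes "a \<in> lists I" "i \<in> I" "\<ell> (s i \<otimes> word a) < \<ell> (word a)"
  obtains b j c where "a = b @ j # c" "s i \<otimes> word a = word (b @ c)"
proof -
  have "odd (count_list (reflections a) (s i))"
    using len_s_mult_cases[OF assms(1,2)] assms(3) by (simp split: if_splits)
  then have "s i \<in> set (reflections a)"
    using count_notin[of "s i" "reflections a"] by (cases "s i \<in> set (reflections a)") simp_all
  from delete_letter[OF assms(1) this] that show ?thesis by blast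
qed

lemma len_s_mult:
  assumes "x \<in> carrier W" "i \<in> I"
  shows "\<ell> (s i \<otimes> x) = \<ell> x + 1 \<or> \<ell> (s i \<otimes> x) + 1 = \<ell> x"
proof -
  obtain a where "a \<in> lists I" "word a = x" using word_surj[OF assms(1)] by blast
  then have "\<ell> (s i \<otimes> x) \<noteq> \<ell> x" using len_s_mult_cases[of a i] assms by (auto split: if_splits)
  moreover have "\<ell> (s i \<otimes> x) \<le> 1 + \<ell> x" using len_mult_le[of "s i" x] assms by simp
  moreover have "\<ell> x \<le> 1 + \<ell> (s i \<otimes> x)" using len_mult_le[of "s i" "s i \<otimes> x"] assms by simp
  ultimately show ?thesis by linarith
qed

lemma len_mult_s:
  assumes "x \<in> carrier W" "i \<in> I"
  shows "\<ell> (x \<otimes> s i) = \<ell> x + 1 \<or> \<ell> (x \<otimes> s i) + 1 = \<ell> x"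
proof -
  have "\<ell> (x \<otimes> s i) = \<ell> (s i \<otimes> inv x)"
    using assms len_inv[of "x \<otimes> s i"] by (simp add: inv_mult_group)
  then show ?thesis using len_s_mult[of "inv x" i] assms by simp
qed

lemma descents_iff: "i \<in> descents x \<longleftrightarrow> i \<in> I \<and> \<ell> (x \<otimes> s i) < \<ell> x"
  by (auto simp: D_R_def)

lemma descent_len: "x \<in> carrier W \<Longrightarrow> i \<in> descents x \<Longrightarrow> \<ell> (x \<otimes> s i) + 1 = \<ell> x"
  using len_mult_s[of x i] by (auto simp: descents_iff)

lemma ascent_len: "x \<in> carrier W \<Longrightarrow> i \<in> I \<Longrightarrow> i \<notin> descents x \<Longrightarrow> \<ell> (x \<otimes> s i) = \<ell> x + 1"
  using len_mult_s[of x i] by (auto simp: descents_iff)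

lemma mult_s_cancel [simp]: "x \<in> carrier W \<Longrightarrow> i \<in> I \<Longrightarrow> x \<otimes> s i \<otimes> s i = x"
  by (simp add: m_assoc)

lemma descents_mult_s:
  "x \<in> carrier W \<Longrightarrow> i \<in> I \<Longrightarrow> i \<in> descents (x \<otimes> s i) \<longleftrightarrow> i \<notin> descents x"
  using len_mult_s[of x i] by (auto simp: descents_iff)

text \<open>
  Exchange in a product of two words: the deleted letter lies in one of them, and the second
  word cancels if the letter is in the first one.
\<close>

lemma exchange_left_append:
  assumes a: "a \<in> lists I" and b: "b \<in> lists I" and i: "i \<in> I"
    and less: "\<ell> (s i \<otimes> (word a \<otimes> word b)) < \<ell> (word a \<otimes> word b)"
  obtains (first) c k d where "a = c @ k # d" "s i \<otimes> word a = word (c @ d)"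
  | (second) c k d where "b = c @ k # d" "s i \<otimes> (word a \<otimes> word b) = word a \<otimes> word (c @ d)"
proof -
  note ab = word_append[OF a b]
  obtain c k d where c: "a @ b = c @ k # d" "s i \<otimes> (word a \<otimes> word b) = word (c @ d)"
    using exchange_left[of "a @ b" i] a b i less unfolding ab by auto
  consider e where "a = c @ k # e" "d = e @ b" | e where "c = a @ e" "b = e @ k # d"
    using c(1) by (auto simp: append_eq_append_conv2 append_eq_Cons_conv Cons_eq_append_conv)
  then show ?thesis
  proof cases
    case 1
    have ce: "c @ e \<in> lists I" using 1 a by auto
    have "s i \<otimes> word a \<otimes> word b = word (c @ e) \<otimes> word b"
      using c(2) 1(2) word_append[OF ce b] m_assoc[OF s_closed[OF i] word_closed[OF a] word_closed[OF b]]
      by (simp only: append_assoc)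
    then have "s i \<otimes> word a = word (c @ e)"
      using r_cancel[of "s i \<otimes> word a" "word b" "word (c @ e)"] i word_closed[OF a] word_closed[OF b]
        word_closed[OF ce] by (simp only: m_closed s_closed)
    then show ?thesis using first 1(1) by blast
  next
    case 2
    have ed: "e @ d \<in> lists I" using 2 b by auto
    have "s i \<otimes> (word a \<otimes> word b) = word a \<otimes> word (e @ d)"
      using c(2) 2(1) word_append[OF a ed] by (simp only: append_assoc)
    then show ?thesis using second 2(2) by blast
  qed
qed

text \<open>
  Apply the exchange to the inverse \<open>u\<inverse> x\<inverse>\<close>.  The deleted letter is not in \<open>u\<inverse>\<close>, since \<open>u s\<^sub>i\<close>
  would be shorter than \<open>u\<close>.
\<close>

lemma exchange_product_right:
  assumes x: "x \<in> carrier W" and u: "u \<in> carrier W" and i: "i \<in> I"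
    and less: "\<ell> (x \<otimes> u \<otimes> s i) < \<ell> (x \<otimes> u)" and asc: "i \<notin> descents u"
  obtains x' where "x' \<in> carrier W" "\<ell> x' < \<ell> x" "x \<otimes> u \<otimes> s i = x' \<otimes> u"
proof -
  obtain a where a: "a \<in> lists I" "word a = inv u" "length a = \<ell> (inv u)"
    using reduced_word_exists[OF inv_closed[OF u]] .
  obtain b where b: "b \<in> lists I" "word b = inv x" "length b = \<ell> (inv x)"
    using reduced_word_exists[OF inv_closed[OF x]] .
  have e: "s i \<otimes> (word a \<otimes> word b) = inv (x \<otimes> u \<otimes> s i)" "word a \<otimes> word b = inv (x \<otimes> u)"
    using a b x u i by (simp_all add: inv_mult_group m_assoc)
  have "\<ell> (s i \<otimes> (word a \<otimes> word b)) < \<ell> (word a \<otimes> word b)"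
    unfolding e(1) unfolding e(2) using less x u i by simp
  with a(1) b(1) i show ?thesis
  proof (cases rule: exchange_left_append)
    case (first c k d)
    have "c @ d \<in> lists I" using first(1) a by auto
    then have "\<ell> (s i \<otimes> word a) < \<ell> u"
      using len_le[of "c @ d"] first a u by (simp del: word_append)
    moreover have "s i \<otimes> word a = inv (u \<otimes> s i)" using a u i by (simp add: inv_mult_group)
    ultimately show ?thesis using asc u i by (simp add: descents_iff)
  next
    case (second c k d)
    have cd: "c @ d \<in> lists I" using second(1) b by auto
    have "inv (x \<otimes> u \<otimes> s i) = inv u \<otimes> word (c @ d)" using second(2) unfolding e(1) unfolding a(2) .
    then have "inv (inv (x \<otimes> u \<otimes> s i)) = inv (inv u \<otimes> word (c @ d))" by (simp only:)
    then have "x \<otimes> u \<otimes> s i = inv (word (c @ d)) \<otimes> u"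
      using x u i word_closed[OF cd] by (simp add: inv_mult_group del: word_append)
    moreover have "\<ell> (inv (word (c @ d))) < \<ell> x"
      using len_le[OF cd] word_closed[OF cd] second(1) b(3) x by (simp del: word_append)
    ultimately show ?thesis using that word_closed[OF cd] by blast
  qed
qed

definition longest :: 'a where
  "longest = (SOME x. x \<in> carrier W \<and> (\<forall>y\<in>carrier W. \<ell> y \<le> \<ell> x))"

lemma longest_closed [simp, intro]: "longest \<in> carrier W"
  and len_le_longest: "y \<in> carrier W \<Longrightarrow> \<ell> y \<le> \<ell> longest"
proof -
  have ne: "\<ell> ` carrier W \<noteq> {}" "finite (\<ell> ` carrier W)" using finite_carrier by auto
  obtain x where "x \<in> carrier W" "\<ell> x = Max (\<ell> ` carrier W)" using Max_in[OF ne(2,1)] by auto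
  then have "\<exists>x. x \<in> carrier W \<and> (\<forall>y\<in>carrier W. \<ell> y \<le> \<ell> x)"
    using ne(2) by (intro exI[of _ x]) auto
  from someI_ex[OF this] show "longest \<in> carrier W" "y \<in> carrier W \<Longrightarrow> \<ell> y \<le> \<ell> longest"
    by (auto simp: longest_def)
qed

text \<open>
  The induction adds letters to the right factor \<open>u\<close> of the longest element: every simple
  reflection shortens the longest element, and the letter deleted by the exchange cannot lie in
  the right factor.
\<close>

lemma len_longest_mult_inv:
  assumes "u \<in> carrier W"
  shows "\<ell> (longest \<otimes> inv u) + \<ell> u = \<ell> longest"
proof -
  have "\<forall>u\<in>carrier W. \<ell> u = n \<longrightarrow> \<ell> (longest \<otimes> inv u) + \<ell> u = \<ell> longest" for n
  proof (induction n)
    case 0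
    then show ?case by (auto simp: len_eq_0)
  next
    case (Suc n)
    show ?case
    proof (intro ballI impI)
      fix u assume u: "u \<in> carrier W" "\<ell> u = Suc n"
      obtain a where a: "a \<in> lists I" "word a = u" "length a = \<ell> u"
        using reduced_word_exists[OF u(1)] .
      then obtain b i where b: "a = b @ [i]" using u by (cases a rule: rev_cases) auto
      define v where "v = word b"
      have i: "i \<in> I" and v: "v \<in> carrier W" and uv: "u = v \<otimes> s i"
        using a b by (auto simp: v_def)
      have "\<ell> v \<le> n" using len_le[of b] a b u by (auto simp: v_def)
      moreover have "\<ell> v = Suc (Suc n) \<or> \<ell> v = n" using len_mult_s[OF v i] uv u by auto
      ultimately have lv: "\<ell> v = n" by auto
      have asc: "i \<notin> descents v" using lv u uv by (simp add: descents_iff)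
      have prod: "longest \<otimes> inv v \<otimes> v = longest" using v by (simp add: m_assoc)
      have "\<ell> (longest \<otimes> s i) < \<ell> longest"
        using len_mult_s[of longest i] len_le_longest[of "longest \<otimes> s i"] i by auto
      then obtain x where x: "x \<in> carrier W" "\<ell> x < \<ell> (longest \<otimes> inv v)"
          "longest \<otimes> s i = x \<otimes> v"
        using exchange_product_right[of "longest \<otimes> inv v" v i] prod v i asc
        by (simp only: longest_closed inv_closed m_closed) blast
      have "longest = longest \<otimes> s i \<otimes> s i" using i by simp
      then have "longest = x \<otimes> u" using x v i uv by (simp add: m_assoc)
      then have "longest \<otimes> inv u = x" using x u by (simp add: m_assoc)
      moreover have "\<ell> (longest \<otimes> inv v) + n = \<ell> longest" using Suc v lv by auto
      moreover have "\<ell> longest \<le> \<ell> (longest \<otimes> inv u) + \<ell> u"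
        using len_mult_le[of "longest \<otimes> inv u" u] u by (simp add: m_assoc)
      ultimately show "\<ell> (longest \<otimes> inv u) + \<ell> u = \<ell> longest" using x u by auto
    qed
  qed
  then show ?thesis using assms by blast
qed

section \<open>Weak order and parabolic cosets\<close>

abbreviation below :: "'a \<Rightarrow> 'a set" where "below \<equiv> interval_R W I s"
abbreviation par :: "'i set \<Rightarrow> 'a set" where "par \<equiv> parabolic W s"

lemma len_triangle:
  "u \<in> carrier W \<Longrightarrow> w \<in> carrier W \<Longrightarrow> \<ell> w \<le> \<ell> u + \<ell> (inv u \<otimes> w)"
  using len_mult_le[of u "inv u \<otimes> w"] by simp

lemma le_R_iff:
  assumes "u \<in> carrier W" "w \<in> carrier W"
  shows "le_R W I s u w \<longleftrightarrow> \<ell> u + \<ell> (inv u \<otimes> w) = \<ell> w"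
proof
  assume "le_R W I s u w"
  then obtain a c where a: "reduced_word W I s a u" "reduced_word W I s (a @ c) w"
    by (auto simp: le_R_def prefix_def)
  then have ac: "a \<in> lists I" "c \<in> lists I" by (auto simp: reduced_word_def)
  then have "w = u \<otimes> word c" using a word_append[OF ac] by (simp add: reduced_word_def)
  then have "inv u \<otimes> w = word c" using assms(1) ac by simp
  then show "\<ell> u + \<ell> (inv u \<otimes> w) = \<ell> w"
    using len_le[OF ac(2)] a len_triangle[OF assms] by (simp add: reduced_word_def)
next
  assume l: "\<ell> u + \<ell> (inv u \<otimes> w) = \<ell> w"
  obtain a where a: "a \<in> lists I" "word a = u" "length a = \<ell> u"
    using reduced_word_exists[OF assms(1)] .
  obtain c where c: "c \<in> lists I" "word c = inv u \<otimes> w" "length c = \<ell> (inv u \<otimes> w)"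
    using reduced_word_exists[of "inv u \<otimes> w"] assms by (metis inv_closed m_closed)
  have "reduced_word W I s a u" "reduced_word W I s (a @ c) w"
    using a c l assms word_append[OF a(1) c(1)] by (simp_all add: reduced_word_def)
  then show "le_R W I s u w" unfolding le_R_def by (intro exI[of _ a] exI[of _ "a @ c"]) simp
qed

lemma below_iff:
  "w \<in> carrier W \<Longrightarrow> u \<in> below w \<longleftrightarrow> u \<in> carrier W \<and> \<ell> u + \<ell> (inv u \<otimes> w) = \<ell> w"
  using le_R_iff by (auto simp: interval_R_def)

lemma below_carrier: "u \<in> below w \<Longrightarrow> u \<in> carrier W"
  by (simp add: interval_R_def)

lemma finite_below: "finite (below w)"
  by (rule finite_subset[OF _ finite_carrier]) (auto simp: interval_R_def)

lemma one_below: "w \<in> carrier W \<Longrightarrow> \<one> \<in> below w"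
  and self_below: "w \<in> carrier W \<Longrightarrow> w \<in> below w"
  by (simp_all add: below_iff)

lemma belowI_le:
  assumes "w \<in> carrier W" "u \<in> carrier W" "\<ell> u + \<ell> (inv u \<otimes> w) \<le> \<ell> w"
  shows "u \<in> below w"
  using assms len_triangle[of u w] by (simp add: below_iff)

lemma below_trans:
  assumes "w \<in> carrier W" "v \<in> below w" "u \<in> below v" shows "u \<in> below w"
proof -
  have c: "v \<in> carrier W" "u \<in> carrier W" using assms by (auto dest: below_carrier)
  have "inv u \<otimes> w = (inv u \<otimes> v) \<otimes> (inv v \<otimes> w)" using c assms by (simp add: m_assoc)
  then have "\<ell> (inv u \<otimes> w) \<le> \<ell> (inv u \<otimes> v) + \<ell> (inv v \<otimes> w)"
    using len_mult_le[of "inv u \<otimes> v" "inv v \<otimes> w"] c assms by simp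
  moreover have "\<ell> v + \<ell> (inv v \<otimes> w) = \<ell> w" "\<ell> u + \<ell> (inv u \<otimes> v) = \<ell> v"
    using assms c by (simp_all add: below_iff)
  ultimately show ?thesis using assms c by (intro belowI_le) simp_all
qed

lemma below_prod:
  assumes "u \<in> carrier W" "v \<in> carrier W" "\<ell> (u \<otimes> v) = \<ell> u + \<ell> v"
  shows "u \<in> below (u \<otimes> v)"
  using assms by (simp add: below_iff)

lemma below_descent:
  assumes "u \<in> carrier W" "i \<in> descents u" shows "u \<otimes> s i \<in> below u"
proof -
  have i: "i \<in> I" using assms by (simp add: descents_iff)
  have "u \<otimes> s i \<otimes> s i = u" using assms i by simp
  then show ?thesis
    using below_prod[of "u \<otimes> s i" "s i"] descent_len[OF assms] assms i by simp
qed

lemma below_mult_descent: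
  "w \<in> carrier W \<Longrightarrow> u \<in> below w \<Longrightarrow> i \<in> descents u \<Longrightarrow> u \<otimes> s i \<in> below w"
  using below_trans below_descent below_carrier by metis

text \<open>
  Multiplication by the longest element replaces a length by its complement.  This turns weak
  order into the additivity of lengths in a product, which the operators of the biHecke monoid
  respect.
\<close>

lemma below_iff_longest:
  assumes "w \<in> carrier W" "u \<in> carrier W"
  shows "u \<in> below w \<longleftrightarrow>
    \<ell> (longest \<otimes> inv w \<otimes> u) = \<ell> (longest \<otimes> inv w) + \<ell> u"
proof -
  have "longest \<otimes> inv w \<otimes> u = longest \<otimes> inv (inv u \<otimes> w)"
    using assms by (simp add: m_assoc inv_mult_group)
  then have "\<ell> (longest \<otimes> inv w \<otimes> u) + \<ell> (inv u \<otimes> w) = \<ell> longest"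
    using len_longest_mult_inv[of "inv u \<otimes> w"] assms by simp
  moreover have "\<ell> (longest \<otimes> inv w) + \<ell> w = \<ell> longest"
    using len_longest_mult_inv assms by simp
  ultimately show ?thesis using assms by (auto simp: below_iff)
qed

definition coset_minimal :: "'i set \<Rightarrow> 'a \<Rightarrow> bool" where
  "coset_minimal J m \<longleftrightarrow> m \<in> carrier W \<and> (\<forall>x\<in>par J. \<ell> m \<le> \<ell> (x \<otimes> m))"

lemma coset_minimal_carrier: "coset_minimal J m \<Longrightarrow> m \<in> carrier W"
  by (simp add: coset_minimal_def)

lemma coset_minimal_le: "coset_minimal J m \<Longrightarrow> x \<in> par J \<Longrightarrow> \<ell> m \<le> \<ell> (x \<otimes> m)"
  by (simp add: coset_minimal_def)

lemma parabolic_words: "J \<subseteq> I \<Longrightarrow> par J = word ` lists J"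
  by (simp add: parabolic_def generate_eq_words)

lemma parabolic_subgroup: "J \<subseteq> I \<Longrightarrow> subgroup (par J) W"
  unfolding parabolic_def by (rule generate_is_subgroup) auto

lemma parabolic_carrier: "J \<subseteq> I \<Longrightarrow> x \<in> par J \<Longrightarrow> x \<in> carrier W"
  and parabolic_mult: "J \<subseteq> I \<Longrightarrow> x \<in> par J \<Longrightarrow> y \<in> par J \<Longrightarrow>
    x \<otimes> y \<in> par J"
  and parabolic_inv: "J \<subseteq> I \<Longrightarrow> x \<in> par J \<Longrightarrow> inv x \<in> par J"
  using parabolic_subgroup by (auto dest: subgroup.mem_carrier intro: subgroup.m_closed subgroup.m_inv_closed)

lemma parabolic_one: "\<one> \<in> par J"
  and parabolic_s: "j \<in> J \<Longrightarrow> s j \<in> par J"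
  by (auto simp: parabolic_def intro: generate.intros)

text \<open>
  The deletion argument for a word \<open>a\<close> in \<open>J\<close>, carried out in the product with a minimal element
  \<open>m\<close>: a letter deleted from \<open>m\<close> would give a shorter element of its coset.  Taking reduced words
  inside \<open>J\<close> along makes the case of a deleted letter in \<open>a\<close> work.
\<close>

lemma coset_minimal_mult_word:
  assumes J: "J \<subseteq> I" and m: "coset_minimal J m" and "a \<in> lists J"
  shows "(\<exists>b\<in>lists J. word b = word a \<and> length b = \<ell> (word a)) \<and>
    \<ell> (word a \<otimes> m) = \<ell> (word a) + \<ell> m"
  using assms(3)
proof (induction a rule: list.induct)
  case Nil
  then show ?case using coset_minimal_carrier[OF m] by (auto intro: bexI[of _ "[]"])
next
  case (Cons j a)
  have mc: "m \<in> carrier W" by (rule coset_minimal_carrier[OF m])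
  have j: "j \<in> J" "j \<in> I" and a: "a \<in> lists J" using Cons.prems J by auto
  obtain b where b: "b \<in> lists J" "word b = word a" "length b = \<ell> (word a)"
      and add: "\<ell> (word a \<otimes> m) = \<ell> (word a) + \<ell> m"
    using Cons.IH[OF a] by blast
  define x where "x = word a"
  have sub: "c \<in> lists J \<Longrightarrow> c \<in> lists I" for c using J by (auto simp: in_lists_conv_set)
  have x: "x \<in> carrier W" "x \<in> par J"
    using a sub[OF a] parabolic_words[OF J] by (auto simp: x_def)
  have assoc: "s j \<otimes> x \<otimes> m = s j \<otimes> (x \<otimes> m)" using x j mc by (simp add: m_assoc)
  show ?case
  proof (cases "\<ell> (s j \<otimes> x) < \<ell> x")
    case True
    then have "\<ell> (s j \<otimes> word b) < \<ell> (word b)" using b by (simp add: x_def)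
    from exchange_left[OF sub[OF b(1)] j(2) this] obtain c k d
      where c: "b = c @ k # d" "s j \<otimes> word b = word (c @ d)" .
    have cd: "c @ d \<in> lists J" using c b by auto
    have w: "word (c @ d) = s j \<otimes> x" using c b by (simp only: x_def)
    have l: "\<ell> (s j \<otimes> x) + 1 = \<ell> x" using True len_s_mult[OF x(1) j(2)] by linarith
    then have "length (c @ d) = \<ell> (s j \<otimes> x)" using c b by (simp add: x_def)
    moreover have "\<ell> (s j \<otimes> x \<otimes> m) = \<ell> (s j \<otimes> x) + \<ell> m"
      using len_mult_le[of "s j \<otimes> x" m] len_s_mult[of "x \<otimes> m" j] add l x j mc assoc
      by (auto simp: x_def)
    ultimately show ?thesis
      using cd w bexI[of "\<lambda>b. word b = s j \<otimes> x \<and> length b = \<ell> (s j \<otimes> x)" "c @ d" "lists J"]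
      by (simp add: x_def del: word_append)
  next
    case False
    then have l: "\<ell> (s j \<otimes> x) = \<ell> x + 1" using len_s_mult[OF x(1) j(2)] by linarith
    have "j # b \<in> lists J" "word (j # b) = s j \<otimes> x" "length (j # b) = \<ell> (s j \<otimes> x)"
      using b j l by (simp_all add: x_def)
    moreover have "\<not> \<ell> (s j \<otimes> (x \<otimes> m)) < \<ell> (x \<otimes> m)"
    proof
      assume less: "\<ell> (s j \<otimes> (x \<otimes> m)) < \<ell> (x \<otimes> m)"
      obtain e where e: "e \<in> lists I" "word e = m" "length e = \<ell> m"
        using reduced_word_exists[OF mc] .
      have be: "word b \<otimes> word e = x \<otimes> m" using b e by (simp add: x_def)
      show False
      proof (cases rule: exchange_left_append[OF sub[OF b(1)] e(1) j(2),
          unfolded be, OF less, case_names first second])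
        case (first c k d)
        have cd: "c @ d \<in> lists I" using first(1) sub[OF b(1)] by auto
        have "s j \<otimes> x = word (c @ d)" using first(2) b(2) by (simp only: x_def)
        then show False using len_le[OF cd] first(1) b l by (simp add: x_def del: word_append)
      next
        case (second c k d)
        have cd: "c @ d \<in> lists I" using second(1) e by auto
        have "inv x \<otimes> (s j \<otimes> (x \<otimes> m)) = word (c @ d)"
          using second(2) b(2) x word_closed[OF cd] by (simp add: x_def del: word_append)
        moreover have "inv x \<otimes> (s j \<otimes> (x \<otimes> m)) = (inv x \<otimes> (s j \<otimes> x)) \<otimes> m"
          using x j mc by (simp add: m_assoc)
        moreover have "inv x \<otimes> (s j \<otimes> x) \<in> par J"
          using x j J by (intro parabolic_mult parabolic_inv parabolic_s) auto
        ultimately have "\<ell> m \<le> \<ell> (word (c @ d))" using coset_minimal_le[OF m] by metis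
        then show False using len_le[OF cd] second(1) e(3) by simp
      qed
    qed
    then have "\<ell> (s j \<otimes> (x \<otimes> m)) = \<ell> (s j \<otimes> x) + \<ell> m"
      using len_s_mult[of "x \<otimes> m" j] add l x j mc by (auto simp: x_def)
    ultimately show ?thesis
      using assoc bexI[of "\<lambda>b. word b = s j \<otimes> x \<and> length b = \<ell> (s j \<otimes> x)" "j # b" "lists J"]
      by (simp add: x_def)
  qed
qed

lemma coset_minimal_len:
  assumes "J \<subseteq> I" "coset_minimal J m" "x \<in> par J"
  shows "\<ell> (x \<otimes> m) = \<ell> x + \<ell> m"
  using assms coset_minimal_mult_word parabolic_words by auto

lemma coset_minimal_one: "coset_minimal J \<one>"
  by (simp add: coset_minimal_def)

lemma parabolic_reduced_word:
  assumes "J \<subseteq> I" "x \<in> par J"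
  obtains a where "a \<in> lists J" "word a = x" "length a = \<ell> x"
proof -
  obtain b where "b \<in> lists J" "x = word b" using assms parabolic_words by auto
  then have "\<exists>a\<in>lists J. word a = x \<and> length a = \<ell> x"
    using coset_minimal_mult_word[OF assms(1) coset_minimal_one, of b] by simp
  then show ?thesis using that by blast
qed

lemma coset_minimal_exists:
  assumes "J \<subseteq> I" "u \<in> carrier W"
  obtains x m where "x \<in> par J" "coset_minimal J m" "u = x \<otimes> m"
proof -
  obtain y where y: "y \<in> par J"
      "\<forall>z. z \<in> par J \<longrightarrow> \<ell> (y \<otimes> u) \<le> \<ell> (z \<otimes> u)"
    using ex_has_least_nat[of "\<lambda>y. y \<in> par J" \<one> "\<lambda>y. \<ell> (y \<otimes> u)"]
      parabolic_one by blast
  have yc: "y \<in> carrier W" using y parabolic_carrier assms by simp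
  have "coset_minimal J (y \<otimes> u)"
    unfolding coset_minimal_def
  proof (intro conjI ballI)
    fix x assume x: "x \<in> par J"
    have "x \<otimes> (y \<otimes> u) = (x \<otimes> y) \<otimes> u"
      using x yc assms parabolic_carrier[OF assms(1) x] by (simp add: m_assoc)
    then show "\<ell> (y \<otimes> u) \<le> \<ell> (x \<otimes> (y \<otimes> u))"
      using y x assms parabolic_mult by simp
  qed (use yc assms in simp)
  moreover have "u = inv y \<otimes> (y \<otimes> u)" using yc assms by simp
  ultimately show ?thesis using that parabolic_inv[OF assms(1) y(1)] by blast
qed

lemma coset_minimal_unique:
  assumes J: "J \<subseteq> I" and "coset_minimal J m" "coset_minimal J m'"
    and x: "x \<in> par J" and e: "m' = x \<otimes> m"
  shows "x = \<one>"
proof -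
  have xc: "x \<in> carrier W" using x J parabolic_carrier by simp
  have mc: "m \<in> carrier W" using assms coset_minimal_carrier by simp
  have "m = inv x \<otimes> m'" using e xc mc by simp
  then have "\<ell> m' \<le> \<ell> m" "\<ell> m' = \<ell> x + \<ell> m"
    using coset_minimal_le[OF assms(3) parabolic_inv[OF J x]] coset_minimal_len[OF J assms(2) x] e
    by simp_all
  then show ?thesis using len_eq_0[OF xc] by simp
qed

lemma min_rep_eq:
  assumes J: "J \<subseteq> I" and m: "coset_minimal J m" and x: "x \<in> par J"
  shows "min_rep W I s J (x \<otimes> m) = m"
proof -
  have mc: "m \<in> carrier W" using m coset_minimal_carrier by simp
  have xc: "x \<in> carrier W" using x J parabolic_carrier by simp
  have coset: "par J #> (x \<otimes> m) = (\<lambda>y. y \<otimes> m) ` par J"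
  proof -
    have "par J #> x = par J"
      using coset_join2[OF xc parabolic_subgroup[OF J] x] .
    then have "par J #> (x \<otimes> m) = par J #> m"
      using coset_mult_assoc[of "par J" x m] parabolic_carrier[OF J] xc mc by auto
    then show ?thesis by (auto simp: r_coset_def)
  qed
  show ?thesis
    unfolding min_rep_def coset
  proof (rule the_equality)
    show "m \<in> (\<lambda>y. y \<otimes> m) ` par J \<and>
        (\<forall>y\<in>(\<lambda>y. y \<otimes> m) ` par J. \<ell> m \<le> \<ell> y)"
      using coset_minimal_le[OF m] parabolic_one mc by (auto intro: image_eqI[of _ _ \<one>])
  next
    fix z assume z: "z \<in> (\<lambda>y. y \<otimes> m) ` par J \<and>
        (\<forall>y\<in>(\<lambda>y. y \<otimes> m) ` par J. \<ell> z \<le> \<ell> y)"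
    then obtain y where y: "y \<in> par J" "z = y \<otimes> m" by auto
    have "m = \<one> \<otimes> m" using mc by simp
    then have "\<ell> z \<le> \<ell> m" using z parabolic_one by blast
    then have "\<ell> y = 0" using coset_minimal_len[OF J m y(1)] y by simp
    then show "z = m" using y len_eq_0 parabolic_carrier[OF J y(1)] mc by simp
  qed
qed

text \<open>
  Write \<open>m = x n\<close> with \<open>n\<close> minimal.  If \<open>x \<noteq> 1\<close>, then the first letter of a reduced word of \<open>x\<close> in
  \<open>J\<close> shortens \<open>m\<close> from the left.
\<close>

lemma coset_minimalI:
  assumes J: "J \<subseteq> I" and m: "m \<in> carrier W"
    and asc: "\<And>j. j \<in> J \<Longrightarrow> \<ell> m < \<ell> (s j \<otimes> m)"
  shows "coset_minimal J m"
proof -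
  obtain x n where x: "x \<in> par J" "coset_minimal J n" "m = x \<otimes> n"
    using coset_minimal_exists[OF J m] .
  have nc: "n \<in> carrier W" using x coset_minimal_carrier by simp
  have xc: "x \<in> carrier W" using x J parabolic_carrier by simp
  obtain a where a: "a \<in> lists J" "word a = x" "length a = \<ell> x"
    using parabolic_reduced_word[OF J x(1)] .
  show ?thesis
  proof (cases a)
    case Nil
    then have "x = \<one>" using a by simp
    then show ?thesis using x nc by simp
  next
    case (Cons j b)
    then have j: "j \<in> J" "j \<in> I" and b: "b \<in> lists J" "b \<in> lists I" using a J by auto
    have sx: "s j \<otimes> x = word b" using a(2)[symmetric] Cons j(2) word_closed[OF b(2)] by simp
    then have less: "\<ell> (s j \<otimes> x) < \<ell> x" using len_le[OF b(2)] a Cons by simp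
    have "s j \<otimes> m = (s j \<otimes> x) \<otimes> n" using x(3) xc nc j by (simp add: m_assoc)
    then have "\<ell> (s j \<otimes> m) = \<ell> (s j \<otimes> x) + \<ell> n"
      using coset_minimal_len[OF J x(2), of "s j \<otimes> x"] parabolic_mult[OF J parabolic_s[OF j(1)] x(1)]
      by simp
    then have "\<ell> (s j \<otimes> m) < \<ell> m" using less coset_minimal_len[OF J x(2,1)] x(3) by simp
    then show ?thesis using asc[OF j(1)] by simp
  qed
qed

text \<open>
  Deodhar's lemma.  If a letter \<open>j\<close> of \<open>J\<close> shortens \<open>m s\<^sub>k\<close> from the left, then the exchange can
  delete only the last letter \<open>k\<close>, because \<open>j\<close> does not shorten \<open>m\<close>.
\<close>

lemma coset_minimal_mult_s:
  assumes J: "J \<subseteq> I" and m: "coset_minimal J m" and k: "k \<in> I"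
  shows "coset_minimal J (m \<otimes> s k) \<or> (\<exists>j\<in>J. m \<otimes> s k = s j \<otimes> m)"
proof (rule ccontr)
  assume contra: "\<not> ?thesis"
  have mc: "m \<in> carrier W" using m coset_minimal_carrier by simp
  obtain j where j: "j \<in> J" "\<not> \<ell> (m \<otimes> s k) < \<ell> (s j \<otimes> (m \<otimes> s k))"
    using coset_minimalI[OF J, of "m \<otimes> s k"] contra mc k by blast
  have jI: "j \<in> I" using j J by auto
  have l: "\<ell> (s j \<otimes> m) = \<ell> m + 1"
    using coset_minimal_len[OF J m parabolic_s[OF j(1)]] jI by simp
  have less: "\<ell> (s j \<otimes> (m \<otimes> s k)) + 1 = \<ell> (m \<otimes> s k)"
    using len_s_mult[of "m \<otimes> s k" j] j mc k jI by auto
  have "\<ell> (s j \<otimes> m) \<le> \<ell> (s j \<otimes> (m \<otimes> s k)) + 1"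
    using len_mult_s[of "s j \<otimes> m" k] mc k jI by (auto simp: m_assoc)
  then have mk: "\<ell> (m \<otimes> s k) = \<ell> m + 1" using len_mult_s[OF mc k] l less by auto
  obtain a where a: "a \<in> lists I" "word a = m" "length a = \<ell> m"
    using reduced_word_exists[OF mc] .
  have ak: "word a \<otimes> word [k] = m \<otimes> s k" "[k] \<in> lists I" using a k by simp_all
  have less': "\<ell> (s j \<otimes> (m \<otimes> s k)) < \<ell> (m \<otimes> s k)" using less by simp
  show False
  proof (cases rule: exchange_left_append[OF a(1) ak(2) jI,
      unfolded ak(1), OF less', case_names first second])
    case (first c p d)
    have "c @ d \<in> lists I" using first(1) a by auto
    then show False using len_le[of "c @ d"] first l a by (simp del: word_append)
  next
    case (second c p d)
    then have "s j \<otimes> (m \<otimes> s k) = m" using a mc by (simp add: Cons_eq_append_conv)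
    then have "m \<otimes> s k = s j \<otimes> m" using mc k jI s_cancel_left[of j "m \<otimes> s k"] by simp
    then show False using contra j by blast
  qed
qed

lemma coset_minimal_prefix:
  assumes J: "J \<subseteq> I" and m: "coset_minimal J m" and u: "u \<in> below m"
  shows "coset_minimal J u"
proof (rule coset_minimalI[OF J below_carrier[OF u]])
  fix j assume j: "j \<in> J"
  have jI: "j \<in> I" using j J by auto
  have c: "m \<in> carrier W" "u \<in> carrier W" using m u coset_minimal_carrier below_carrier by auto
  have "\<ell> (s j \<otimes> m) = \<ell> m + 1"
    using coset_minimal_len[OF J m parabolic_s[OF j]] jI by simp
  moreover have "s j \<otimes> m = (s j \<otimes> u) \<otimes> (inv u \<otimes> m)" using c jI by (simp add: m_assoc)
  ultimately have "\<ell> m + 1 \<le> \<ell> (s j \<otimes> u) + \<ell> (inv u \<otimes> m)"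
    using len_mult_le[of "s j \<otimes> u" "inv u \<otimes> m"] c jI by simp
  then show "\<ell> u < \<ell> (s j \<otimes> u)" using u c by (simp add: below_iff)
qed

section \<open>Intervals below an element with a left block\<close>

lemma exists_descent:
  assumes "u \<in> carrier W" "u \<noteq> \<one>"
  obtains i where "i \<in> descents u"
proof -
  obtain a where a: "a \<in> lists I" "word a = u" "length a = \<ell> u"
    using reduced_word_exists[OF assms(1)] .
  then obtain b i where b: "a = b @ [i]" using assms by (cases a rule: rev_cases) auto
  have bi: "b \<in> lists I" "i \<in> I" using a b by auto
  have "u = word b \<otimes> s i" using a b bi word_append[OF bi(1), of "[i]"] by simp
  then have "u \<otimes> s i = word b" using bi by simp
  then have "\<ell> (u \<otimes> s i) < \<ell> u" using len_le[OF bi(1)] a b by simp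
  then show ?thesis using that bi by (simp add: descents_iff)
qed

text \<open>
  A left block \<open>J\<close> of \<open>w\<close> gives a minimal coset representative \<open>m\<close> of \<open>W\<^sub>J w\<close> such that
  conjugation with \<open>m\<close> identifies \<open>W\<^sub>J\<close> with another parabolic subgroup \<open>W\<^sub>K\<close>.
\<close>

definition intertwines :: "'i set \<Rightarrow> 'i set \<Rightarrow> 'a \<Rightarrow> bool" where
  "intertwines J K m \<longleftrightarrow> J \<subseteq> I \<and> K \<subseteq> I \<and> coset_minimal J m \<and> coset_minimal K (inv m) \<and>
     (\<forall>y\<in>par J. \<exists>z\<in>par K. y \<otimes> m = m \<otimes> z) \<and>
     (\<forall>z\<in>par K. \<exists>y\<in>par J. m \<otimes> z = y \<otimes> m)"

lemma left_block_intertwines: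
  assumes w: "w \<in> carrier W" and block: "left_block W I s w J"
  obtains x m K where "x \<in> par J" "w = x \<otimes> m" "intertwines J K m"
proof -
  obtain K where J: "J \<subseteq> I" and K: "K \<subseteq> I"
      and e: "(w <# par K) = (par J #> w)"
    using block by (auto simp: left_block_def)
  obtain x m where x: "x \<in> par J" and m: "coset_minimal J m" and wx: "w = x \<otimes> m"
    using coset_minimal_exists[OF J w] .
  have mc: "m \<in> carrier W" using m coset_minimal_carrier by simp
  have xc: "x \<in> carrier W" using x J parabolic_carrier by simp
  have to_right: "\<exists>z\<in>par K. y \<otimes> w = w \<otimes> z" if "y \<in> par J" for y
  proof -
    have "y \<otimes> w \<in> par J #> w" using that by (auto simp: r_coset_def)
    then show ?thesis using e by (auto simp: l_coset_def)
  qed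
  have to_left: "\<exists>y\<in>par J. w \<otimes> z = y \<otimes> w" if "z \<in> par K" for z
  proof -
    have "w \<otimes> z \<in> w <# par K" using that by (auto simp: l_coset_def)
    then show ?thesis using e by (auto simp: r_coset_def)
  qed
  obtain k where k: "k \<in> par K" "inv x \<otimes> w = w \<otimes> k"
    using to_right[OF parabolic_inv[OF J x]] by blast
  have kc: "k \<in> carrier W" using k K parabolic_carrier by simp
  have mk: "m = w \<otimes> k" using k wx xc mc by simp
  have right: "\<exists>z\<in>par K. y \<otimes> m = m \<otimes> z" if y: "y \<in> par J" for y
  proof -
    have yc: "y \<in> carrier W" using y J parabolic_carrier by simp
    obtain z where z: "z \<in> par K" "y \<otimes> w = w \<otimes> z" using to_right[OF y] by blast
    have zc: "z \<in> carrier W" using z K parabolic_carrier by simp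
    have "y \<otimes> m = (y \<otimes> w) \<otimes> k" using mk yc w kc by (simp add: m_assoc)
    also have "\<dots> = (w \<otimes> k) \<otimes> (inv k \<otimes> (z \<otimes> k))" using z zc kc w by (simp add: m_assoc)
    also have "\<dots> = m \<otimes> (inv k \<otimes> (z \<otimes> k))" by (simp flip: mk)
    finally show ?thesis
      using z(1) k(1) parabolic_mult[OF K] parabolic_inv[OF K] by blast
  qed
  have left: "\<exists>y\<in>par J. m \<otimes> z = y \<otimes> m" if z: "z \<in> par K" for z
  proof -
    have zc: "z \<in> carrier W" using z K parabolic_carrier by simp
    obtain y where y: "y \<in> par J" "w \<otimes> (k \<otimes> z) = y \<otimes> w"
      using to_left[OF parabolic_mult[OF K k(1) z]] by blast
    have yc: "y \<in> carrier W" using y J parabolic_carrier by simp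
    have "m \<otimes> z = w \<otimes> (k \<otimes> z)" using mk w kc zc by (simp add: m_assoc)
    also have "\<dots> = (y \<otimes> x) \<otimes> m" unfolding y(2) using wx yc xc mc by (simp add: m_assoc)
    finally show ?thesis using parabolic_mult[OF J y(1) x] by blast
  qed
  have "coset_minimal K (inv m)"
    unfolding coset_minimal_def
  proof (intro conjI ballI)
    fix z assume z: "z \<in> par K"
    have zc: "z \<in> carrier W" using z K parabolic_carrier by simp
    obtain y where y: "y \<in> par J" "m \<otimes> inv z = y \<otimes> m"
      using left[OF parabolic_inv[OF K z]] by blast
    have "\<ell> (z \<otimes> inv m) = \<ell> (inv (m \<otimes> inv z))" using zc mc by (simp add: inv_mult_group)
    also have "\<dots> = \<ell> (m \<otimes> inv z)" using zc mc by (intro len_inv) simp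
    also have "\<dots> = \<ell> (y \<otimes> m)" by (simp add: y)
    finally show "\<ell> (inv m) \<le> \<ell> (z \<otimes> inv m)" using coset_minimal_le[OF m y(1)] mc by simp
  qed (use mc in simp)
  then have "intertwines J K m" using J K m right left by (simp add: intertwines_def)
  then show ?thesis using that x wx by blast
qed

lemma intertwines_len_right:
  assumes "intertwines J K m" "z \<in> par K"
  shows "\<ell> (m \<otimes> z) = \<ell> m + \<ell> z"
proof -
  have K: "K \<subseteq> I" "coset_minimal K (inv m)" "m \<in> carrier W"
    using assms coset_minimal_carrier by (auto simp: intertwines_def)
  have zc: "z \<in> carrier W" using assms K parabolic_carrier by simp
  have "\<ell> (m \<otimes> z) = \<ell> (inv (m \<otimes> z))" using K zc by simp
  also have "\<dots> = \<ell> (inv z \<otimes> inv m)" using K zc by (simp add: inv_mult_group)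
  also have "\<dots> = \<ell> (inv z) + \<ell> (inv m)"
    using coset_minimal_len[OF K(1,2) parabolic_inv[OF K(1) assms(2)]] .
  finally show ?thesis using K zc by simp
qed

text \<open>
  The induction removes the last letter \<open>i\<close> of \<open>u = v s\<^sub>i\<close>.  With \<open>y m = m z\<close>, the element
  \<open>s\<^sub>i\<close> is a left descent of \<open>v\<inverse> m z\<close>.  If the exchange deletes a letter of \<open>v\<inverse> m\<close>, then \<open>u\<close> is
  below \<open>m\<close>.  If it deletes a letter of \<open>z\<close>, then \<open>u\<close> and \<open>v\<close> are different minimal elements of
  one coset of \<open>W\<^sub>J\<close>.
\<close>

lemma intertwines_minimal_below:
  assumes int: "intertwines J K m" and y: "y \<in> par J"
    and "coset_minimal J u" "u \<in> below (y \<otimes> m)"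
  shows "u \<in> below m"
  using assms(3,4)
proof (induction "\<ell> u" arbitrary: u rule: less_induct)
  case less
  have J: "J \<subseteq> I" and K: "K \<subseteq> I" and m: "coset_minimal J m"
    using int by (auto simp: intertwines_def)
  have mc: "m \<in> carrier W" using m coset_minimal_carrier by simp
  have yc: "y \<in> carrier W" using y J parabolic_carrier by simp
  have uc: "u \<in> carrier W" using less.prems coset_minimal_carrier by simp
  have ymc: "y \<otimes> m \<in> carrier W" using yc mc by simp
  show ?case
  proof (cases "u = \<one>")
    case True
    then show ?thesis using one_below[OF mc] by simp
  next
    case False
    then obtain i where i: "i \<in> descents u" using exists_descent[OF uc] by blast
    have iI: "i \<in> I" using i by (simp add: descents_iff)
    define v where "v = u \<otimes> s i"
    have vc: "v \<in> carrier W" and uv: "u = v \<otimes> s i" using uc iI by (simp_all add: v_def)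
    have lu: "\<ell> u = \<ell> v + 1" using descent_len[OF uc i] by (simp add: v_def)
    have vu: "v \<in> below u" using below_descent[OF uc i] by (simp add: v_def)
    have vmin: "coset_minimal J v" by (rule coset_minimal_prefix[OF J less.prems(1) vu])
    have vy: "v \<in> below (y \<otimes> m)" by (rule below_trans[OF ymc less.prems(2) vu])
    have vm: "v \<in> below m" by (rule less.hyps[OF _ vmin vy]) (simp add: lu)
    define n where "n = inv v \<otimes> m"
    have nc: "n \<in> carrier W" using vc mc by (simp add: n_def)
    have ln: "\<ell> v + \<ell> n = \<ell> m" using vm mc by (simp add: below_iff n_def)
    obtain z where z: "z \<in> par K" "y \<otimes> m = m \<otimes> z"
      using int y by (auto simp: intertwines_def)
    have zc: "z \<in> carrier W" using z K parabolic_carrier by simp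
    have nz: "n \<otimes> z = inv v \<otimes> (y \<otimes> m)" using z vc mc zc by (simp add: n_def m_assoc)
    have si: "s i \<otimes> (n \<otimes> z) = inv u \<otimes> (y \<otimes> m)"
      unfolding nz uv using vc iI ymc by (simp add: inv_mult_group m_assoc)
    have desc: "\<ell> (s i \<otimes> (n \<otimes> z)) < \<ell> (n \<otimes> z)"
    proof -
      have "\<ell> (inv u \<otimes> (y \<otimes> m)) < \<ell> (inv v \<otimes> (y \<otimes> m))"
        using less.prems(2) vy lu ymc by (simp add: below_iff)
      then show ?thesis by (simp only: si[symmetric] nz[symmetric])
    qed
    have sn: "inv u \<otimes> m = s i \<otimes> n"
      unfolding uv n_def using vc iI mc by (simp add: inv_mult_group m_assoc)
    obtain a where a: "a \<in> lists I" "word a = n" "length a = \<ell> n"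
      using reduced_word_exists[OF nc] .
    obtain c where c: "c \<in> lists K" "word c = z" "length c = \<ell> z"
      using parabolic_reduced_word[OF K z(1)] .
    have cI: "c \<in> lists I" using c K by (auto simp: in_lists_conv_set)
    have ac: "word a \<otimes> word c = n \<otimes> z" using a c by simp
    show ?thesis
    proof (cases rule: exchange_left_append[OF a(1) cI iI,
        unfolded ac, OF desc, case_names first second])
      case (first b k d)
      have bd: "b @ d \<in> lists I" using first(1) a by auto
      have "\<ell> (inv u \<otimes> m) < \<ell> n"
        using len_le[OF bd] first a sn by (simp del: word_append)
      then show ?thesis using ln lu mc uc by (intro belowI_le) simp_all
    next
      case (second f k d)
      have fd: "f @ d \<in> lists K" "f @ d \<in> lists I" using second(1) c cI by auto
      have fdK: "word (f @ d) \<in> par K" using fd parabolic_words[OF K] by blast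
      have wfd: "word (f @ d) \<in> carrier W" by (rule word_closed[OF fd(2)])
      define t where "t = word (f @ d) \<otimes> inv z"
      have t: "t \<in> par K"
        unfolding t_def by (intro parabolic_mult parabolic_inv K fdK z)
      have tc: "t \<in> carrier W" using t K parabolic_carrier by simp
      have "s i \<otimes> (n \<otimes> z) = n \<otimes> word (f @ d)" using second(2) by (simp only: a(2))
      then have "s i \<otimes> (n \<otimes> z) \<otimes> inv z = n \<otimes> t"
        unfolding t_def using nc wfd zc by (simp add: m_assoc del: word_append)
      then have sin: "s i \<otimes> n = n \<otimes> t" using iI nc zc by (simp add: m_assoc)
      obtain y' where y': "y' \<in> par J" "m \<otimes> t = y' \<otimes> m"
        using int t by (auto simp: intertwines_def)
      have y'c: "y' \<in> carrier W" using y' J parabolic_carrier by simp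
      have "inv u \<otimes> m = inv v \<otimes> y' \<otimes> m"
        using sn sin y'(2) vc mc tc y'c by (simp add: n_def m_assoc)
      then have "inv u = inv v \<otimes> y'"
        using r_cancel[of "inv u" m "inv v \<otimes> y'"] uc vc mc y'c by (simp only: m_closed inv_closed)
      then have "inv (inv u) = inv (inv v \<otimes> y')" by simp
      then have uy: "u = inv y' \<otimes> v" using uc vc y'c by (simp add: inv_mult_group)
      then have "inv y' = \<one>"
        using coset_minimal_unique[OF J vmin less.prems(1) parabolic_inv[OF J y'(1)]] by simp
      then have "u = v" using uy vc by simp
      then show ?thesis using lu by simp
    qed
  qed
qed

text \<open>
  The complement of \<open>x u\<close> in \<open>x\<^sub>0 m\<close> is \<open>u\<inverse> y m\<close> with \<open>y = x\<inverse> x\<^sub>0\<close>.  Moving \<open>y\<close> past \<open>m\<close> does not change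
  its length, so the complement is at most as long as \<open>u\<inverse> m\<close> and \<open>y\<close> together.  Conversely, if
  \<open>x u\<close> is below \<open>x\<^sub>0 m\<close>, then \<open>u\<close> is below \<open>y m\<close>, and \<open>y\<close> can be dropped by the previous lemma.
\<close>

lemma intertwines_below_iff:
  assumes int: "intertwines J K m" and x0: "x0 \<in> par J"
    and x: "x \<in> par J" and u: "coset_minimal J u"
  shows "x \<otimes> u \<in> below (x0 \<otimes> m) \<longleftrightarrow> x \<in> below x0 \<and> u \<in> below m"
proof -
  have J: "J \<subseteq> I" and K: "K \<subseteq> I" and m: "coset_minimal J m"
    using int by (auto simp: intertwines_def)
  have mc: "m \<in> carrier W" using m coset_minimal_carrier by simp
  have uc: "u \<in> carrier W" using u coset_minimal_carrier by simp
  have xc: "x \<in> carrier W" "x0 \<in> carrier W" using x x0 J parabolic_carrier by simp_all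
  define y where "y = inv x \<otimes> x0"
  have y: "y \<in> par J"
    unfolding y_def by (intro parabolic_mult parabolic_inv J x x0)
  have yc: "y \<in> carrier W" using y J parabolic_carrier by simp
  have lxu: "\<ell> (x \<otimes> u) = \<ell> x + \<ell> u" by (rule coset_minimal_len[OF J u x])
  have lw: "\<ell> (x0 \<otimes> m) = \<ell> x0 + \<ell> m" by (rule coset_minimal_len[OF J m x0])
  have ly: "\<ell> (y \<otimes> m) = \<ell> y + \<ell> m" by (rule coset_minimal_len[OF J m y])
  have wc: "x0 \<otimes> m \<in> carrier W" using xc mc by simp
  have xy: "inv x \<otimes> (x0 \<otimes> m) = y \<otimes> m" using xc mc by (simp add: y_def m_assoc)
  have rest: "inv (x \<otimes> u) \<otimes> (x0 \<otimes> m) = inv u \<otimes> (y \<otimes> m)"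
    using xc uc mc by (simp add: y_def m_assoc inv_mult_group)
  show ?thesis
  proof
    assume b: "x \<otimes> u \<in> below (x0 \<otimes> m)"
    then have l: "\<ell> x + \<ell> u + \<ell> (inv u \<otimes> (y \<otimes> m)) = \<ell> (x0 \<otimes> m)"
      using wc rest lxu by (simp add: below_iff)
    have "x \<in> below (x0 \<otimes> m)"
      by (rule below_trans[OF wc b below_prod[OF xc(1) uc lxu]])
    then have lx: "\<ell> x + \<ell> (y \<otimes> m) = \<ell> (x0 \<otimes> m)" using wc xy by (simp add: below_iff)
    then have "x \<in> below x0" using lw ly xc by (simp add: below_iff y_def)
    moreover have "u \<in> below (y \<otimes> m)" using l lx uc yc mc by (simp add: below_iff)
    then have "u \<in> below m" by (rule intertwines_minimal_below[OF int y u])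
    ultimately show "x \<in> below x0 \<and> u \<in> below m" by simp
  next
    assume b: "x \<in> below x0 \<and> u \<in> below m"
    obtain z where z: "z \<in> par K" "y \<otimes> m = m \<otimes> z"
      using int y by (auto simp: intertwines_def)
    have zc: "z \<in> carrier W" using z K parabolic_carrier by simp
    have lz: "\<ell> z = \<ell> y" using intertwines_len_right[OF int z(1)] z(2) ly by simp
    have "inv u \<otimes> (y \<otimes> m) = (inv u \<otimes> m) \<otimes> z" using z uc mc zc by (simp add: m_assoc)
    then have "\<ell> (inv u \<otimes> (y \<otimes> m)) \<le> \<ell> (inv u \<otimes> m) + \<ell> y"
      using len_mult_le[of "inv u \<otimes> m" z] lz uc mc zc by simp
    moreover have "\<ell> u + \<ell> (inv u \<otimes> m) = \<ell> m" "\<ell> x + \<ell> y = \<ell> x0"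
      using b mc xc by (simp_all add: below_iff y_def)
    ultimately show "x \<otimes> u \<in> below (x0 \<otimes> m)"
      using wc xc uc by (intro belowI_le) (simp_all add: rest lxu lw)
  qed
qed

section \<open>The biHecke monoid and length-additive products\<close>

abbreviation up :: "'i \<Rightarrow> 'a \<Rightarrow> 'a" where "up \<equiv> pi_op W I s"
abbreviation down :: "'i \<Rightarrow> 'a \<Rightarrow> 'a" where "down \<equiv> pibar_op W I s"
abbreviation hecke :: "('a \<Rightarrow> 'a) monoid" where "hecke \<equiv> biHecke W I s"
abbreviation M_set :: "('a \<Rightarrow> 'a) set" where "M_set \<equiv> biHecke_set W I s"

lemma up_apply: "u \<in> carrier W \<Longrightarrow> up i u = (if i \<in> descents u then u else u \<otimes> s i)"
  and down_apply: "u \<in> carrier W \<Longrightarrow> down i u = (if i \<in> descents u then u \<otimes> s i else u)"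
  by (simp_all add: pi_op_def pibar_op_def)

lemma up_closed: "i \<in> I \<Longrightarrow> up i \<in> carrier W \<rightarrow>\<^sub>E carrier W"
  and down_closed: "i \<in> I \<Longrightarrow> down i \<in> carrier W \<rightarrow>\<^sub>E carrier W"
  by (auto simp: pi_op_def pibar_op_def)

text \<open>
  The operators preserve products without loss of length, and they can only shorten the left
  factor.  The descents of \<open>u\<close> are descents of \<open>x u\<close>.  Therefore the left factor changes only for
  a descent of \<open>x u\<close> that is not a descent of \<open>u\<close>, and then the exchange takes place in \<open>x\<close>.
\<close>

lemma generator_preserves_product:
  assumes x: "x \<in> carrier W" and u: "u \<in> carrier W" and i: "i \<in> I"
    and l: "\<ell> (x \<otimes> u) = \<ell> x + \<ell> u" and f: "f = up i \<or> f = down i"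
  shows "\<exists>x'\<in>carrier W. f (x \<otimes> u) = x' \<otimes> f u \<and> \<ell> (x' \<otimes> f u) = \<ell> x' + \<ell> (f u) \<and>
    (x' = x \<or> \<ell> x' < \<ell> x)"
proof -
  have xu: "x \<otimes> u \<in> carrier W" using x u by simp
  have assoc: "x \<otimes> u \<otimes> s i = x \<otimes> (u \<otimes> s i)" using x u i by (simp add: m_assoc)
  consider "i \<in> descents u" | "i \<notin> descents u" "i \<notin> descents (x \<otimes> u)"
    | "i \<notin> descents u" "i \<in> descents (x \<otimes> u)" by blast
  then show ?thesis
  proof cases
    case 1
    have lu: "\<ell> (u \<otimes> s i) + 1 = \<ell> u" by (rule descent_len[OF u 1])
    then have d: "i \<in> descents (x \<otimes> u)"
      using len_mult_le[of x "u \<otimes> s i"] l x u i by (simp add: descents_iff m_assoc)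
    have "\<ell> (x \<otimes> (u \<otimes> s i)) + 1 = \<ell> (x \<otimes> u)" using descent_len[OF xu d] assoc by simp
    then have "\<ell> (x \<otimes> (u \<otimes> s i)) = \<ell> x + \<ell> (u \<otimes> s i)" using l lu by simp
    then show ?thesis using f 1 d u xu l assoc x
      by (intro bexI[of _ x]) (auto simp: up_apply down_apply)
  next
    case 2
    have "\<ell> (u \<otimes> s i) = \<ell> u + 1" "\<ell> (x \<otimes> u \<otimes> s i) = \<ell> (x \<otimes> u) + 1"
      using ascent_len 2 u xu i by simp_all
    then have "\<ell> (x \<otimes> (u \<otimes> s i)) = \<ell> x + \<ell> (u \<otimes> s i)" using l assoc by simp
    then show ?thesis using f 2 u xu l assoc x
      by (intro bexI[of _ x]) (auto simp: up_apply down_apply)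
  next
    case 3
    have lu: "\<ell> (u \<otimes> s i) = \<ell> u + 1" using ascent_len 3 u i by simp
    have lxu: "\<ell> (x \<otimes> u \<otimes> s i) + 1 = \<ell> (x \<otimes> u)" by (rule descent_len[OF xu 3(2)])
    then have "\<ell> (x \<otimes> u \<otimes> s i) < \<ell> (x \<otimes> u)" by simp
    from exchange_product_right[OF x u i this 3(1)] obtain x'
      where x': "x' \<in> carrier W" "\<ell> x' < \<ell> x" "x \<otimes> u \<otimes> s i = x' \<otimes> u" .
    have e: "x \<otimes> u = x' \<otimes> (u \<otimes> s i)"
    proof -
      have "x \<otimes> u = x \<otimes> u \<otimes> s i \<otimes> s i" using xu i by simp
      then show ?thesis using x' u i by (simp add: m_assoc)
    qed
    have "\<ell> (x' \<otimes> u) = \<ell> x' + \<ell> u"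
      using len_mult_le[OF x'(1) u] lxu l x' by simp
    moreover have "\<ell> (x' \<otimes> (u \<otimes> s i)) = \<ell> x' + \<ell> (u \<otimes> s i)"
      using len_mult_le[of x' "u \<otimes> s i"] e l lu x' u i by simp
    ultimately show ?thesis using f 3 u xu e x'
      by (intro bexI[of _ x']) (auto simp: up_apply down_apply)
  qed
qed

lemma M_set_induct [consumes 1, case_names one generator]:
  assumes "f \<in> M_set" "P (\<lambda>w\<in>carrier W. w)"
    and "\<And>f g i. f \<in> M_set \<Longrightarrow> P f \<Longrightarrow> i \<in> I \<Longrightarrow> g = up i \<or> g = down i \<Longrightarrow>
      P (compose (carrier W) g f)"
  shows "P f"
  using assms(1) by (induction rule: biHecke_set.induct) (simp_all only: assms(2,3) simp_thms)

lemma M_set_generator: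
  "f \<in> M_set \<Longrightarrow> i \<in> I \<Longrightarrow> g = up i \<or> g = down i \<Longrightarrow> compose (carrier W) g f \<in> M_set"
  using biHecke_set.pi biHecke_set.pibar by metis

lemma M_set_closed: "f \<in> M_set \<Longrightarrow> f \<in> carrier W \<rightarrow>\<^sub>E carrier W"
proof (induction rule: M_set_induct)
  case (generator f g i)
  then have "g \<in> carrier W \<rightarrow>\<^sub>E carrier W" using up_closed[of i] down_closed[of i] by blast
  then show ?case using generator by (auto simp: compose_eq PiE_iff)
qed auto

lemma M_set_apply: "f \<in> M_set \<Longrightarrow> u \<in> carrier W \<Longrightarrow> f u \<in> carrier W"
  using M_set_closed by blast

lemma M_set_preserves_product:
  assumes f: "f \<in> M_set" and x: "x \<in> carrier W" and u: "u \<in> carrier W"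
    and l: "\<ell> (x \<otimes> u) = \<ell> x + \<ell> u"
  shows "\<exists>x'\<in>carrier W. f (x \<otimes> u) = x' \<otimes> f u \<and> \<ell> (x' \<otimes> f u) = \<ell> x' + \<ell> (f u) \<and>
    (x' = x \<or> \<ell> x' < \<ell> x)"
  using f
proof (induction rule: M_set_induct)
  case one
  then show ?case using x u l by (intro bexI[of _ x]) auto
next
  case (generator f g i)
  then obtain y where y: "y \<in> carrier W" "f (x \<otimes> u) = y \<otimes> f u"
      "\<ell> (y \<otimes> f u) = \<ell> y + \<ell> (f u)" "y = x \<or> \<ell> y < \<ell> x" by blast
  obtain z where z: "z \<in> carrier W" "g (y \<otimes> f u) = z \<otimes> g (f u)"
      "\<ell> (z \<otimes> g (f u)) = \<ell> z + \<ell> (g (f u))" "z = y \<or> \<ell> z < \<ell> y"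
    using generator_preserves_product[OF y(1) M_set_apply[OF generator.hyps(1) u]
      generator.hyps(2) y(3) generator.hyps(3)]
    by blast
  show ?case using y z x u by (intro bexI[of _ z]) (auto simp: compose_eq)
qed

lemma finite_M_set: "finite M_set"
proof (rule finite_subset)
  show "M_set \<subseteq> carrier W \<rightarrow>\<^sub>E carrier W" using M_set_closed by blast
  show "finite (carrier W \<rightarrow>\<^sub>E carrier W)" using finite_carrier by (intro finite_PiE) auto
qed

lemma M_set_compose:
  assumes "g \<in> M_set" "f \<in> M_set" shows "compose (carrier W) g f \<in> M_set"
proof -
  have f: "f \<in> carrier W \<rightarrow>\<^sub>E carrier W" using assms M_set_closed by blast
  from assms(1) show ?thesis
  proof (induction rule: M_set_induct)
    case one
    have "compose (carrier W) (\<lambda>w\<in>carrier W. w) f = f"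
      using f by (intro Id_compose) (auto simp: PiE_iff)
    then show ?case using assms(2) by (simp only:)
  next
    case (generator g h i)
    have "compose (carrier W) (compose (carrier W) h g) f =
        compose (carrier W) h (compose (carrier W) g f)"
      using f compose_assoc[of f "carrier W" "carrier W" h g] by (auto simp: PiE_iff)
    then show ?case using M_set_generator[OF generator.IH generator.hyps(2,3)] by (simp only:)
  qed
qed

lemma monoid_biHecke: "monoid hecke"
proof (rule monoidI)
  fix f g h
  assume "f \<in> carrier hecke" "g \<in> carrier hecke" "h \<in> carrier hecke"
  then have f: "f \<in> carrier W \<rightarrow>\<^sub>E carrier W" "g \<in> carrier W \<rightarrow>\<^sub>E carrier W"
    using M_set_closed by (auto simp: biHecke_def)
  show "f \<otimes>\<^bsub>hecke\<^esub> g \<otimes>\<^bsub>hecke\<^esub> h =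
      f \<otimes>\<^bsub>hecke\<^esub> (g \<otimes>\<^bsub>hecke\<^esub> h)"
    using f compose_assoc[of f "carrier W" "carrier W" h g] by (auto simp: biHecke_def)
next
  fix f assume "f \<in> carrier hecke"
  then have f: "f \<in> carrier W \<rightarrow>\<^sub>E carrier W" using M_set_closed by (auto simp: biHecke_def)
  show "\<one>\<^bsub>hecke\<^esub> \<otimes>\<^bsub>hecke\<^esub> f = f"
    using f by (auto simp: biHecke_def PiE_iff intro!: compose_Id)
  show "f \<otimes>\<^bsub>hecke\<^esub> \<one>\<^bsub>hecke\<^esub> = f"
    using f by (auto simp: biHecke_def PiE_iff intro!: Id_compose)
qed (auto simp: biHecke_def M_set_compose biHecke_set.one)

lemma up_in_M_set: "i \<in> I \<Longrightarrow> up i \<in> M_set"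
  using biHecke_set.pi[OF biHecke_set.one[of W I s], of i] up_closed[of i] compose_Id[of "up i" "carrier W" "carrier W"]
  by (metis PiE_iff Pi_I')

lemma down_in_M_set: "i \<in> I \<Longrightarrow> down i \<in> M_set"
  using biHecke_set.pibar[OF biHecke_set.one[of W I s], of i] down_closed[of i] compose_Id[of "down i" "carrier W" "carrier W"]
  by (metis PiE_iff Pi_I')

end

section \<open>Algebras of finite monoids and matrix representations\<close>

locale finite_monoid = monoid M for M :: "('m, 'x) monoid_scheme" (structure) +
  assumes finite_monoid_carrier: "finite (carrier M)"
begin

abbreviation KM :: "('m \<Rightarrow> 'k::field) ring" where "KM \<equiv> monoid_algebra M"

lemma monoid_algebra_carrier:
  "a \<in> carrier KM \<longleftrightarrow> (\<forall>f. f \<notin> carrier M \<longrightarrow> a f = 0)"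
  using finite_monoid_carrier by (auto simp: monoid_algebra_def intro: finite_subset)

lemma monoid_algebra_mult:
  fixes a b :: "'m \<Rightarrow> 'k::field"
  assumes "a \<in> carrier KM" "b \<in> carrier KM"
  shows "(a \<otimes>\<^bsub>KM\<^esub> b) h =
    (\<Sum>f\<in>carrier M. \<Sum>g\<in>carrier M. if f \<otimes> g = h then a f * b g else 0)"
proof -
  have "(a \<otimes>\<^bsub>KM\<^esub> b) h =
      (\<Sum>f\<in>{f. a f \<noteq> 0}. \<Sum>g\<in>{g. b g \<noteq> 0}. if f \<otimes> g = h then a f * b g else 0)"
    by (simp add: monoid_algebra_def)
  also have "\<dots> = (\<Sum>f\<in>{f. a f \<noteq> 0}. \<Sum>g\<in>carrier M. if f \<otimes> g = h then a f * b g else 0)"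
    using assms finite_monoid_carrier
    by (intro sum.cong sum.mono_neutral_left HOL.refl) (auto simp: monoid_algebra_carrier)
  also have "\<dots> = (\<Sum>f\<in>carrier M. \<Sum>g\<in>carrier M. if f \<otimes> g = h then a f * b g else 0)"
    using assms finite_monoid_carrier
    by (intro sum.mono_neutral_left)
      (auto simp: monoid_algebra_carrier intro!: sum.neutral split: if_splits)
  finally show ?thesis .
qed

text \<open>
  The form in which products enter: linear extensions \<open>F\<close> of maps on the monoid.  It reduces the
  associativity of the algebra and of its modules to rearrangements of sums.
\<close>

lemma sum_monoid_algebra_mult:
  fixes a b F :: "'m \<Rightarrow> 'k::field"
  assumes "a \<in> carrier KM" "b \<in> carrier KM"
  shows "(\<Sum>h\<in>carrier M. (a \<otimes>\<^bsub>KM\<^esub> b) h * F h) =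
    (\<Sum>f\<in>carrier M. \<Sum>g\<in>carrier M. a f * b g * F (f \<otimes> g))"
proof -
  have "(\<Sum>h\<in>carrier M. (a \<otimes>\<^bsub>KM\<^esub> b) h * F h) =
      (\<Sum>h\<in>carrier M. \<Sum>f\<in>carrier M. \<Sum>g\<in>carrier M.
        if f \<otimes> g = h then a f * b g * F h else 0)"
    unfolding monoid_algebra_mult[OF assms] sum_distrib_right by (intro sum.cong) auto
  also have "\<dots> = (\<Sum>f\<in>carrier M. \<Sum>g\<in>carrier M. \<Sum>h\<in>carrier M.
        if f \<otimes> g = h then a f * b g * F h else 0)"
    by (subst sum.swap, rule sum.cong[OF HOL.refl], rule sum.swap)
  also have "\<dots> = (\<Sum>f\<in>carrier M. \<Sum>g\<in>carrier M. a f * b g * F (f \<otimes> g))"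
    using finite_monoid_carrier by (intro sum.cong HOL.refl) simp
  finally show ?thesis .
qed

lemma monoid_algebra_mult_closed:
  fixes a b :: "'m \<Rightarrow> 'k::field"
  assumes "a \<in> carrier KM" "b \<in> carrier KM"
  shows "a \<otimes>\<^bsub>KM\<^esub> b \<in> carrier KM"
  unfolding monoid_algebra_carrier monoid_algebra_mult[OF assms]
  by (auto intro!: sum.neutral)

lemma single_in_monoid_algebra: "f \<in> carrier M \<Longrightarrow> single f c \<in> carrier KM"
  by (auto simp: monoid_algebra_carrier single_def)

lemma monoid_algebra_one: "\<one>\<^bsub>KM\<^esub> = single \<one> 1"
  and monoid_algebra_zero: "\<zero>\<^bsub>KM\<^esub> = (\<lambda>_. 0)"
  and monoid_algebra_add: "a \<oplus>\<^bsub>KM\<^esub> b = (\<lambda>f. a f + b f)"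
  by (simp_all add: monoid_algebra_def)

lemma single_mult_single:
  assumes "f \<in> carrier M" "g \<in> carrier M"
  shows "single f c \<otimes>\<^bsub>KM\<^esub> single g d = single (f \<otimes> g) (c * d)"
proof
  fix h
  have "(single f c \<otimes>\<^bsub>KM\<^esub> single g d) h = (\<Sum>f'\<in>carrier M. \<Sum>g'\<in>carrier M.
      if f' \<otimes> g' = h then single f c f' * single g d g' else 0)"
    using assms by (intro monoid_algebra_mult single_in_monoid_algebra)
  also have "\<dots> = (\<Sum>f'\<in>carrier M. \<Sum>g'\<in>carrier M. if g' = g then
      (if f' = f then (if f \<otimes> g = h then c * d else 0) else 0) else 0)"
    by (intro sum.cong) (auto simp: single_def)
  also have "\<dots> = single (f \<otimes> g) (c * d) h"
    using assms finite_monoid_carrier by (simp add: single_def)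
  finally show "(single f c \<otimes>\<^bsub>KM\<^esub> single g d) h = single (f \<otimes> g) (c * d) h" .
qed

lemma ring_monoid_algebra: "ring (KM :: ('m \<Rightarrow> 'k::field) ring)"
proof (rule ringI)
  let ?A = "KM :: ('m \<Rightarrow> 'k) ring"
  show "abelian_group ?A"
  proof (rule abelian_groupI)
    fix x assume "x \<in> carrier ?A"
    then show "\<exists>y\<in>carrier ?A. y \<oplus>\<^bsub>?A\<^esub> x = \<zero>\<^bsub>?A\<^esub>"
      by (intro bexI[of _ "\<lambda>f. - x f"])
        (auto simp: monoid_algebra_add monoid_algebra_zero monoid_algebra_carrier)
  qed (auto simp: monoid_algebra_add monoid_algebra_zero monoid_algebra_carrier algebra_simps)
  show "monoid ?A"
  proof (rule monoidI)
    fix x y z assume x: "x \<in> carrier ?A" and y: "y \<in> carrier ?A" and z: "z \<in> carrier ?A"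
    show "x \<otimes>\<^bsub>?A\<^esub> y \<otimes>\<^bsub>?A\<^esub> z = x \<otimes>\<^bsub>?A\<^esub> (y \<otimes>\<^bsub>?A\<^esub> z)"
    proof
      fix k
      have "(x \<otimes>\<^bsub>?A\<^esub> y \<otimes>\<^bsub>?A\<^esub> z) k = (\<Sum>h\<in>carrier M. (x \<otimes>\<^bsub>?A\<^esub> y) h *
          (\<Sum>g\<in>carrier M. if h \<otimes> g = k then z g else 0))"
        unfolding monoid_algebra_mult[OF monoid_algebra_mult_closed[OF x y] z] sum_distrib_left
        by (intro sum.cong) auto
      also have "\<dots> = (\<Sum>f\<in>carrier M. \<Sum>f'\<in>carrier M. \<Sum>g\<in>carrier M.
          if f \<otimes> (f' \<otimes> g) = k then x f * (y f' * z g) else 0)"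
        unfolding sum_monoid_algebra_mult[OF x y] unfolding sum_distrib_left
        by (intro sum.cong HOL.refl) (auto simp: m_assoc)
      also have "\<dots> = (\<Sum>f\<in>carrier M. \<Sum>h\<in>carrier M. (y \<otimes>\<^bsub>?A\<^esub> z) h *
          (if f \<otimes> h = k then x f else 0))"
        unfolding sum_monoid_algebra_mult[OF y z] by (intro sum.cong HOL.refl) auto
      also have "\<dots> = (x \<otimes>\<^bsub>?A\<^esub> (y \<otimes>\<^bsub>?A\<^esub> z)) k"
        unfolding monoid_algebra_mult[OF x monoid_algebra_mult_closed[OF y z]]
        by (intro sum.cong HOL.refl) auto
      finally show "(x \<otimes>\<^bsub>?A\<^esub> y \<otimes>\<^bsub>?A\<^esub> z) k = (x \<otimes>\<^bsub>?A\<^esub> (y \<otimes>\<^bsub>?A\<^esub> z)) k" .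
    qed
  next
    fix x assume x: "x \<in> carrier ?A"
    have one: "single \<one> 1 \<in> carrier ?A" by (simp add: single_in_monoid_algebra)
    show "\<one>\<^bsub>?A\<^esub> \<otimes>\<^bsub>?A\<^esub> x = x"
    proof
      fix h
      have "(single \<one> 1 \<otimes>\<^bsub>?A\<^esub> x) h =
          (\<Sum>f\<in>carrier M. \<Sum>g\<in>carrier M. if f = \<one> then (if g = h then x g else 0) else 0)"
        unfolding monoid_algebra_mult[OF one x] by (intro sum.cong HOL.refl) (auto simp: single_def)
      also have "\<dots> = x h"
        using finite_monoid_carrier x by (simp add: monoid_algebra_carrier sum.swap[of _ "carrier M"])
      finally show "(\<one>\<^bsub>?A\<^esub> \<otimes>\<^bsub>?A\<^esub> x) h = x h" by (simp add: monoid_algebra_one)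
    qed
    show "x \<otimes>\<^bsub>?A\<^esub> \<one>\<^bsub>?A\<^esub> = x"
    proof
      fix h
      have "(x \<otimes>\<^bsub>?A\<^esub> single \<one> 1) h =
          (\<Sum>f\<in>carrier M. \<Sum>g\<in>carrier M. if g = \<one> then (if f = h then x f else 0) else 0)"
        unfolding monoid_algebra_mult[OF x one] by (intro sum.cong HOL.refl) (auto simp: single_def)
      also have "\<dots> = x h"
        using finite_monoid_carrier x by (simp add: monoid_algebra_carrier)
      finally show "(x \<otimes>\<^bsub>?A\<^esub> \<one>\<^bsub>?A\<^esub>) h = x h" by (simp add: monoid_algebra_one)
    qed
  qed (auto simp: monoid_algebra_mult_closed monoid_algebra_one single_in_monoid_algebra)
next
  let ?A = "KM :: ('m \<Rightarrow> 'k) ring"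
  fix x y z assume x: "x \<in> carrier ?A" and y: "y \<in> carrier ?A" and z: "z \<in> carrier ?A"
  have xy: "x \<oplus>\<^bsub>?A\<^esub> y \<in> carrier ?A"
    using x y by (simp add: monoid_algebra_carrier monoid_algebra_add)
  show "(x \<oplus>\<^bsub>?A\<^esub> y) \<otimes>\<^bsub>?A\<^esub> z = x \<otimes>\<^bsub>?A\<^esub> z \<oplus>\<^bsub>?A\<^esub> y \<otimes>\<^bsub>?A\<^esub> z"
    unfolding fun_eq_iff monoid_algebra_add monoid_algebra_mult[OF xy[unfolded monoid_algebra_add] z]
      monoid_algebra_mult[OF x z] monoid_algebra_mult[OF y z] sum.distrib[symmetric]
    by (intro allI sum.cong HOL.refl) (auto simp: algebra_simps)
  show "z \<otimes>\<^bsub>?A\<^esub> (x \<oplus>\<^bsub>?A\<^esub> y) = z \<otimes>\<^bsub>?A\<^esub> x \<oplus>\<^bsub>?A\<^esub> z \<otimes>\<^bsub>?A\<^esub> y"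
    unfolding fun_eq_iff monoid_algebra_add monoid_algebra_mult[OF z xy[unfolded monoid_algebra_add]]
      monoid_algebra_mult[OF z x] monoid_algebra_mult[OF z y] sum.distrib[symmetric]
    by (intro allI sum.cong HOL.refl) (auto simp: algebra_simps)
qed

text \<open>
  Row vectors with coordinates in \<open>B\<close>, on which the algebra acts through the linear extension of a
  matrix representation \<open>\<rho>\<close>.
\<close>

definition matrix_module ::
  "'a set \<Rightarrow> ('m \<Rightarrow> 'a \<Rightarrow> 'a \<Rightarrow> 'k) \<Rightarrow> ('m \<Rightarrow> 'k::field, 'a \<Rightarrow> 'k) module" where
  "matrix_module B \<rho> =
     \<lparr>carrier = {v. \<forall>u. u \<notin> B \<longrightarrow> v u = 0}, monoid.mult = undefined, one = undefined,
      ring.zero = (\<lambda>_. 0), add = (\<lambda>v v' u. v u + v' u),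
      smult = (\<lambda>a v z. if z \<in> B then \<Sum>u\<in>B. v u * (\<Sum>f\<in>carrier M. a f * \<rho> f u z) else 0)\<rparr>"

lemma right_module_matrix_module:
  fixes \<rho> :: "'m \<Rightarrow> 'a \<Rightarrow> 'a \<Rightarrow> 'k::field"
  assumes B: "finite B"
    and one: "\<And>u z. u \<in> B \<Longrightarrow> z \<in> B \<Longrightarrow> \<rho> \<one> u z = (if u = z then 1 else 0)"
    and mult: "\<And>f g u z. f \<in> carrier M \<Longrightarrow> g \<in> carrier M \<Longrightarrow> u \<in> B \<Longrightarrow> z \<in> B \<Longrightarrow>
      \<rho> (f \<otimes> g) u z = (\<Sum>t\<in>B. \<rho> f u t * \<rho> g t z)"
  shows "right_module KM (matrix_module B \<rho>)"
proof -
  let ?A = "KM :: ('m \<Rightarrow> 'k) ring" and ?V = "matrix_module B \<rho>"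
  interpret A: ring ?A by (rule ring_monoid_algebra)
  interpret V: abelian_group ?V
  proof (rule abelian_groupI)
    fix x assume "x \<in> carrier ?V"
    then show "\<exists>y\<in>carrier ?V. y \<oplus>\<^bsub>?V\<^esub> x = \<zero>\<^bsub>?V\<^esub>"
      by (intro bexI[of _ "\<lambda>f. - x f"]) (auto simp: matrix_module_def)
  qed (auto simp: matrix_module_def algebra_simps)
  show ?thesis
  proof
    fix a v assume "a \<in> carrier ?A" "v \<in> carrier ?V"
    show "a \<odot>\<^bsub>?V\<^esub> v \<in> carrier ?V" by (simp add: matrix_module_def)
  next
    fix a b v assume "a \<in> carrier ?A" "b \<in> carrier ?A" "v \<in> carrier ?V"
    show "(a \<oplus>\<^bsub>?A\<^esub> b) \<odot>\<^bsub>?V\<^esub> v = a \<odot>\<^bsub>?V\<^esub> v \<oplus>\<^bsub>?V\<^esub> b \<odot>\<^bsub>?V\<^esub> v"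
      by (auto simp: matrix_module_def monoid_algebra_add fun_eq_iff distrib_right distrib_left sum.distrib)
  next
    fix a v v' assume "a \<in> carrier ?A" "v \<in> carrier ?V" "v' \<in> carrier ?V"
    show "a \<odot>\<^bsub>?V\<^esub> (v \<oplus>\<^bsub>?V\<^esub> v') = a \<odot>\<^bsub>?V\<^esub> v \<oplus>\<^bsub>?V\<^esub> a \<odot>\<^bsub>?V\<^esub> v'"
      by (auto simp: matrix_module_def fun_eq_iff distrib_right sum.distrib)
  next
    fix v assume v: "v \<in> carrier ?V"
    have "(\<Sum>f\<in>carrier M. single \<one> 1 f * \<rho> f u z) = (if u = z then 1 else 0)"
      if "u \<in> B" "z \<in> B" for u z
    proof -
      have "(\<Sum>f\<in>carrier M. single \<one> 1 f * \<rho> f u z) = (\<Sum>f\<in>carrier M. if f = \<one> then \<rho> \<one> u z else 0)"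
        by (intro sum.cong) (auto simp: single_def)
      then show ?thesis using finite_monoid_carrier one that by simp
    qed
    then have "(\<Sum>u\<in>B. v u * (\<Sum>f\<in>carrier M. single \<one> 1 f * \<rho> f u z)) =
        (\<Sum>u\<in>B. if u = z then v u else 0)" if "z \<in> B" for z
      using that by (intro sum.cong) simp_all
    then have "(\<Sum>u\<in>B. v u * (\<Sum>f\<in>carrier M. single \<one> 1 f * \<rho> f u z)) = v z" if "z \<in> B" for z
      using B that by simp
    then show "\<one>\<^bsub>?A\<^esub> \<odot>\<^bsub>?V\<^esub> v = v"
      using v by (auto simp: matrix_module_def monoid_algebra_one fun_eq_iff)
  next
    fix a b v assume a: "a \<in> carrier ?A" and b: "b \<in> carrier ?A" and v: "v \<in> carrier ?V"
    have *: "(\<Sum>h\<in>carrier M. (a \<otimes>\<^bsub>?A\<^esub> b) h * \<rho> h u z) =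
        (\<Sum>t\<in>B. (\<Sum>f\<in>carrier M. a f * \<rho> f u t) * (\<Sum>g\<in>carrier M. b g * \<rho> g t z))"
      if "u \<in> B" "z \<in> B" for u z
    proof -
      have "(\<Sum>h\<in>carrier M. (a \<otimes>\<^bsub>?A\<^esub> b) h * \<rho> h u z) =
          (\<Sum>f\<in>carrier M. \<Sum>g\<in>carrier M. \<Sum>t\<in>B. (a f * \<rho> f u t) * (b g * \<rho> g t z))"
        unfolding sum_monoid_algebra_mult[OF a b]
        by (intro sum.cong HOL.refl) (simp add: mult that sum_distrib_left algebra_simps)
      also have "\<dots> = (\<Sum>f\<in>carrier M. \<Sum>t\<in>B. \<Sum>g\<in>carrier M. (a f * \<rho> f u t) * (b g * \<rho> g t z))"
        by (intro sum.cong HOL.refl, subst sum.swap) simp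
      also have "\<dots> = (\<Sum>t\<in>B. \<Sum>f\<in>carrier M. \<Sum>g\<in>carrier M. (a f * \<rho> f u t) * (b g * \<rho> g t z))"
        by (subst sum.swap) simp
      finally show ?thesis by (simp add: sum_product)
    qed
    have "((a \<otimes>\<^bsub>?A\<^esub> b) \<odot>\<^bsub>?V\<^esub> v) z = (b \<odot>\<^bsub>?V\<^esub> (a \<odot>\<^bsub>?V\<^esub> v)) z" if z: "z \<in> B" for z
    proof -
      have "((a \<otimes>\<^bsub>?A\<^esub> b) \<odot>\<^bsub>?V\<^esub> v) z = (\<Sum>u\<in>B. \<Sum>t\<in>B. v u *
          ((\<Sum>f\<in>carrier M. a f * \<rho> f u t) * (\<Sum>g\<in>carrier M. b g * \<rho> g t z)))"
        using z by (simp add: matrix_module_def * sum_distrib_left)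
      also have "\<dots> = (\<Sum>t\<in>B. \<Sum>u\<in>B. v u *
          ((\<Sum>f\<in>carrier M. a f * \<rho> f u t) * (\<Sum>g\<in>carrier M. b g * \<rho> g t z)))"
        by (rule sum.swap)
      also have "\<dots> = (b \<odot>\<^bsub>?V\<^esub> (a \<odot>\<^bsub>?V\<^esub> v)) z"
        using z by (simp add: matrix_module_def sum_distrib_right mult.assoc)
      finally show ?thesis .
    qed
    moreover have "((a \<otimes>\<^bsub>?A\<^esub> b) \<odot>\<^bsub>?V\<^esub> v) z = (b \<odot>\<^bsub>?V\<^esub> (a \<odot>\<^bsub>?V\<^esub> v)) z" if "z \<notin> B" for z
      using that by (simp add: matrix_module_def)
    ultimately show "(a \<otimes>\<^bsub>?A\<^esub> b) \<odot>\<^bsub>?V\<^esub> v = b \<odot>\<^bsub>?V\<^esub> (a \<odot>\<^bsub>?V\<^esub> v)" by blast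
  qed
qed

end

section \<open>Quotients and homomorphisms of right modules\<close>

lemma mod_hom_closed: "h \<in> mod_hom R V U \<Longrightarrow> x \<in> carrier V \<Longrightarrow> h x \<in> carrier U"
  and mod_hom_add: "h \<in> mod_hom R V U \<Longrightarrow> x \<in> carrier V \<Longrightarrow> y \<in> carrier V \<Longrightarrow>
    h (x \<oplus>\<^bsub>V\<^esub> y) = h x \<oplus>\<^bsub>U\<^esub> h y"
  and mod_hom_smult: "h \<in> mod_hom R V U \<Longrightarrow> a \<in> carrier R \<Longrightarrow> x \<in> carrier V \<Longrightarrow>
    h (a \<odot>\<^bsub>V\<^esub> x) = a \<odot>\<^bsub>U\<^esub> h x"
  by (auto simp: mod_hom_def)

context right_module
begin

abbreviation (input) vector_zero ("\<zero>\<^sub>V") where "\<zero>\<^sub>V \<equiv> \<zero>\<^bsub>V\<^esub>"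
abbreviation (input) vector_add (infixl "\<oplus>\<^sub>V" 65) where "x \<oplus>\<^sub>V y \<equiv> x \<oplus>\<^bsub>V\<^esub> y"
abbreviation (input) vector_minus ("\<ominus>\<^sub>V _" [81] 80) where "\<ominus>\<^sub>V x \<equiv> \<ominus>\<^bsub>V\<^esub> x"
abbreviation (input) vector_smult (infixl "\<odot>\<^sub>V" 70) where "a \<odot>\<^sub>V x \<equiv> a \<odot>\<^bsub>V\<^esub> x"
abbreviation (input) vector_coset (infixl "+>\<^sub>V" 60) where "N +>\<^sub>V x \<equiv> N +>\<^bsub>V\<^esub> x"

lemma smult_zero: assumes "a \<in> carrier R" shows "a \<odot>\<^sub>V \<zero>\<^sub>V = \<zero>\<^sub>V"
proof -
  have "a \<odot>\<^sub>V \<zero>\<^sub>V \<oplus>\<^sub>V a \<odot>\<^sub>V \<zero>\<^sub>V = a \<odot>\<^sub>V \<zero>\<^sub>V"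
    using smult_r_distr[OF assms, of "\<zero>\<^sub>V" "\<zero>\<^sub>V"] by simp
  then show ?thesis using smult_closed[OF assms, of "\<zero>\<^sub>V"] V.add.r_cancel_one' by fastforce
qed

lemma zero_smult: assumes "v \<in> carrier V" shows "\<zero> \<odot>\<^sub>V v = \<zero>\<^sub>V"
proof -
  have "\<zero> \<odot>\<^sub>V v \<oplus>\<^sub>V \<zero> \<odot>\<^sub>V v = \<zero> \<odot>\<^sub>V v"
    using smult_l_distr[of "\<zero>" "\<zero>" v] assms by simp
  then show ?thesis using smult_closed[of "\<zero>" v] assms V.add.r_cancel_one' by fastforce
qed

lemma minus_one_smult: assumes "v \<in> carrier V" shows "(\<ominus> \<one>) \<odot>\<^sub>V v = \<ominus>\<^sub>V v"
proof -
  have "(\<ominus> \<one>) \<odot>\<^sub>V v \<oplus>\<^sub>V v = (\<ominus> \<one> \<oplus> \<one>) \<odot>\<^sub>V v"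
    using smult_l_distr[of "\<ominus> \<one>" "\<one>" v] smult_one[OF assms] assms by simp
  also have "\<dots> = \<zero>\<^sub>V" using zero_smult[OF assms] by (simp add: R.l_neg)
  finally show ?thesis
    using V.minus_equality[of "(\<ominus> \<one>) \<odot>\<^sub>V v" v] smult_closed[of "\<ominus> \<one>" v] assms by simp
qed

lemma submoduleI:
  assumes "H \<subseteq> carrier V" "\<zero>\<^sub>V \<in> H"
    and "\<And>x y. x \<in> H \<Longrightarrow> y \<in> H \<Longrightarrow> x \<oplus>\<^sub>V y \<in> H"
    and "\<And>a x. a \<in> carrier R \<Longrightarrow> x \<in> H \<Longrightarrow> a \<odot>\<^sub>V x \<in> H"
  shows "submodule H R V"
proof (intro submodule.intro subgroup.intro)
  fix x assume "x \<in> H"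
  then show "inv\<^bsub>add_monoid V\<^esub> x \<in> H"
    using assms(4)[of "\<ominus> \<one>" x] minus_one_smult[of x] assms(1) by (auto simp: a_inv_def)
qed (use assms in \<open>auto simp: submodule_axioms_def\<close>)

lemma submodule_carrier: "submodule H R V \<Longrightarrow> x \<in> H \<Longrightarrow> x \<in> carrier V"
  using subgroup.subset[OF submodule.axioms(1)] by fastforce

lemma submodule_zero: "submodule H R V \<Longrightarrow> \<zero>\<^sub>V \<in> H"
  using subgroup.one_closed[OF submodule.axioms(1)] by fastforce

lemma submodule_add: "submodule H R V \<Longrightarrow> x \<in> H \<Longrightarrow> y \<in> H \<Longrightarrow> x \<oplus>\<^sub>V y \<in> H"
  using subgroup.m_closed[OF submodule.axioms(1)] by fastforce

lemma submodule_smult: "submodule H R V \<Longrightarrow> a \<in> carrier R \<Longrightarrow> x \<in> H \<Longrightarrow> a \<odot>\<^sub>V x \<in> H"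
  by (rule submodule.smult_closed)

lemma submodule_abelian_subgroup: "submodule H R V \<Longrightarrow> abelian_subgroup H V"
  by (intro abelian_subgroupI3 additive_subgroupI submodule.axioms(1) V.abelian_group_axioms)

lemma coset_eq_iff:
  assumes N: "submodule N R V" and x: "x \<in> carrier V" and y: "y \<in> carrier V"
  shows "N +>\<^sub>V x = N +>\<^sub>V y \<longleftrightarrow> x \<oplus>\<^sub>V \<ominus>\<^sub>V y \<in> N"
proof -
  interpret N: abelian_subgroup N V by (rule submodule_abelian_subgroup[OF N])
  have sub: "N \<subseteq> carrier V" by (rule N.a_subset)
  show ?thesis
  proof
    assume "N +>\<^sub>V x = N +>\<^sub>V y"
    then have "x \<in> N +>\<^sub>V y" using N.a_rcos_self[OF x] by simp
    then obtain n where n: "n \<in> N" "x = n \<oplus>\<^sub>V y" by (auto simp: a_r_coset_def')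
    then have "x \<oplus>\<^sub>V \<ominus>\<^sub>V y = n" using y sub by (auto simp: V.a_assoc V.r_neg)
    then show "x \<oplus>\<^sub>V \<ominus>\<^sub>V y \<in> N" using n by simp
  next
    assume n: "x \<oplus>\<^sub>V \<ominus>\<^sub>V y \<in> N"
    have "x = (x \<oplus>\<^sub>V \<ominus>\<^sub>V y) \<oplus>\<^sub>V y" using x y by (simp add: V.a_assoc V.l_neg)
    then have "x \<in> N +>\<^sub>V y" using n by (auto simp: a_r_coset_def')
    then show "N +>\<^sub>V x = N +>\<^sub>V y"
      using V.a_repr_independence[OF _ y, of x N] submodule.axioms(1)[OF N] by simp
  qed
qed

lemma coset_eq_submodule_iff:
  assumes N: "submodule N R V" and x: "x \<in> carrier V"
  shows "N +>\<^sub>V x = N \<longleftrightarrow> x \<in> N"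
proof -
  interpret N: abelian_subgroup N V by (rule submodule_abelian_subgroup[OF N])
  have "N +>\<^sub>V \<zero>\<^sub>V = N" using N.a_subset by (simp add: V.a_coset_add_zero)
  moreover have "\<ominus>\<^sub>V \<zero>\<^sub>V = \<zero>\<^sub>V"
    using V.minus_equality[of "\<zero>\<^sub>V" "\<zero>\<^sub>V"] by simp
  then have "x \<oplus>\<^sub>V \<ominus>\<^sub>V \<zero>\<^sub>V = x" by (simp only: V.r_zero[OF x])
  ultimately show ?thesis using coset_eq_iff[OF N x, of "\<zero>\<^sub>V"] by simp
qed

lemma quotient_carrier: "carrier (quotient_module V N) = (\<lambda>x. N +>\<^sub>V x) ` carrier V"
  by (auto simp: quotient_module_def A_RCOSETS_def')

lemma quotient_add:
  assumes N: "submodule N R V" and "x \<in> carrier V" "y \<in> carrier V"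
  shows "(N +>\<^sub>V x) \<oplus>\<^bsub>quotient_module V N\<^esub> (N +>\<^sub>V y) = N +>\<^sub>V (x \<oplus>\<^sub>V y)"
proof -
  interpret N: abelian_subgroup N V by (rule submodule_abelian_subgroup[OF N])
  show ?thesis using N.a_rcos_sum[OF assms(2,3)] by (simp add: quotient_module_def)
qed

lemma quotient_smult:
  assumes N: "submodule N R V" and a: "a \<in> carrier R" and x: "x \<in> carrier V"
  shows "a \<odot>\<^bsub>quotient_module V N\<^esub> (N +>\<^sub>V x) = N +>\<^sub>V (a \<odot>\<^sub>V x)"
proof -
  interpret N: abelian_subgroup N V by (rule submodule_abelian_subgroup[OF N])
  have "N +>\<^sub>V (a \<odot>\<^sub>V y) = N +>\<^sub>V (a \<odot>\<^sub>V x)" if y: "y \<in> N +>\<^sub>V x" for y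
  proof -
    obtain n where n: "n \<in> N" "y = n \<oplus>\<^sub>V x" using y by (auto simp: a_r_coset_def')
    have nc: "n \<in> carrier V" using n N.a_subset by auto
    have c: "a \<odot>\<^sub>V n \<in> carrier V" "a \<odot>\<^sub>V x \<in> carrier V" "a \<odot>\<^sub>V y \<in> carrier V"
      using smult_closed[OF a] nc x n by auto
    have "a \<odot>\<^sub>V y \<oplus>\<^sub>V \<ominus>\<^sub>V (a \<odot>\<^sub>V x) = a \<odot>\<^sub>V n"
      using smult_r_distr[OF a nc x] n c by (simp add: V.a_assoc V.r_neg)
    then show ?thesis using coset_eq_iff[OF N c(3,2)] submodule_smult[OF N a n(1)] by simp
  qed
  moreover have "x \<in> N +>\<^sub>V x" by (rule N.a_rcos_self[OF x])
  ultimately have "(\<Union>y\<in>N +>\<^sub>V x. N +>\<^sub>V (a \<odot>\<^sub>V y)) = N +>\<^sub>V (a \<odot>\<^sub>V x)"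
    by (intro UN_constant_eq) blast+
  then show ?thesis by (simp add: quotient_module_def)
qed

lemma right_module_quotient:
  assumes N: "submodule N R V"
  shows "right_module R (quotient_module V N)"
proof -
  let ?Q = "quotient_module V N"
  have rep: "\<exists>x\<in>carrier V. C = N +>\<^sub>V x" if "C \<in> carrier ?Q" for C
    using that by (auto simp: quotient_carrier)
  have mem: "N +>\<^sub>V x \<in> carrier ?Q" if "x \<in> carrier V" for x
    using that by (auto simp: quotient_carrier)
  have zero: "\<zero>\<^bsub>?Q\<^esub> = N +>\<^sub>V \<zero>\<^sub>V"
    using coset_eq_submodule_iff[OF N, of "\<zero>\<^sub>V"] submodule_zero[OF N]
    by (simp add: quotient_module_def)
  interpret Q: abelian_group ?Q
  proof (rule abelian_groupI)
    show "\<zero>\<^bsub>?Q\<^esub> \<in> carrier ?Q" unfolding zero by (rule mem) simp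
  next
    fix C D assume "C \<in> carrier ?Q" "D \<in> carrier ?Q"
    then obtain x y where "x \<in> carrier V" "C = N +>\<^sub>V x" "y \<in> carrier V" "D = N +>\<^sub>V y"
      using rep by meson
    then show "C \<oplus>\<^bsub>?Q\<^esub> D \<in> carrier ?Q" "C \<oplus>\<^bsub>?Q\<^esub> D = D \<oplus>\<^bsub>?Q\<^esub> C"
      using mem by (simp_all add: quotient_add[OF N] V.a_comm)
  next
    fix C D E assume "C \<in> carrier ?Q" "D \<in> carrier ?Q" "E \<in> carrier ?Q"
    then obtain x y z where "x \<in> carrier V" "C = N +>\<^sub>V x" "y \<in> carrier V" "D = N +>\<^sub>V y"
        "z \<in> carrier V" "E = N +>\<^sub>V z"
      using rep by meson
    then show "C \<oplus>\<^bsub>?Q\<^esub> D \<oplus>\<^bsub>?Q\<^esub> E = C \<oplus>\<^bsub>?Q\<^esub> (D \<oplus>\<^bsub>?Q\<^esub> E)"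
      by (simp add: quotient_add[OF N] V.a_assoc)
  next
    fix C assume "C \<in> carrier ?Q"
    then obtain x where x: "x \<in> carrier V" "C = N +>\<^sub>V x" using rep by meson
    then show "\<zero>\<^bsub>?Q\<^esub> \<oplus>\<^bsub>?Q\<^esub> C = C" unfolding zero by (simp add: quotient_add[OF N])
    show "\<exists>D\<in>carrier ?Q. D \<oplus>\<^bsub>?Q\<^esub> C = \<zero>\<^bsub>?Q\<^esub>"
      using x mem[of "\<ominus>\<^sub>V x"] unfolding zero
      by (intro bexI[of _ "N +>\<^sub>V (\<ominus>\<^sub>V x)"]) (simp_all add: quotient_add[OF N] V.l_neg)
  qed
  show ?thesis
  proof
    fix a C assume a: "a \<in> carrier R" and "C \<in> carrier ?Q"
    then obtain x where x: "x \<in> carrier V" "C = N +>\<^sub>V x" using rep by meson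
    then show "a \<odot>\<^bsub>?Q\<^esub> C \<in> carrier ?Q"
      using mem smult_closed a by (simp add: quotient_smult[OF N])
  next
    fix a b C assume a: "a \<in> carrier R" "b \<in> carrier R" and "C \<in> carrier ?Q"
    then obtain x where x: "x \<in> carrier V" "C = N +>\<^sub>V x" using rep by meson
    then show "(a \<oplus> b) \<odot>\<^bsub>?Q\<^esub> C = a \<odot>\<^bsub>?Q\<^esub> C \<oplus>\<^bsub>?Q\<^esub> b \<odot>\<^bsub>?Q\<^esub> C"
      "(a \<otimes> b) \<odot>\<^bsub>?Q\<^esub> C = b \<odot>\<^bsub>?Q\<^esub> (a \<odot>\<^bsub>?Q\<^esub> C)"
      using smult_closed a
      by (simp_all add: quotient_smult[OF N] quotient_add[OF N] smult_l_distr smult_assoc_right)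
  next
    fix a C D assume a: "a \<in> carrier R" and "C \<in> carrier ?Q" "D \<in> carrier ?Q"
    then obtain x y where "x \<in> carrier V" "C = N +>\<^sub>V x" "y \<in> carrier V" "D = N +>\<^sub>V y"
      using rep by meson
    then show "a \<odot>\<^bsub>?Q\<^esub> (C \<oplus>\<^bsub>?Q\<^esub> D) = a \<odot>\<^bsub>?Q\<^esub> C \<oplus>\<^bsub>?Q\<^esub> a \<odot>\<^bsub>?Q\<^esub> D"
      using smult_closed a
      by (simp add: quotient_smult[OF N] quotient_add[OF N] smult_r_distr)
  next
    fix C assume "C \<in> carrier ?Q"
    then obtain x where x: "x \<in> carrier V" "C = N +>\<^sub>V x" using rep by meson
    then show "\<one> \<odot>\<^bsub>?Q\<^esub> C = C" by (simp add: quotient_smult[OF N] smult_one)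
  qed
qed

lemma coset_map_hom:
  assumes "submodule N R V"
  shows "(\<lambda>x. N +>\<^sub>V x) \<in> mod_hom R V (quotient_module V N)"
  using assms by (auto simp: mod_hom_def quotient_add quotient_smult quotient_carrier)

end

lemma mod_hom_zero:
  assumes "right_module R V" "right_module R U" "h \<in> mod_hom R V U"
  shows "h \<zero>\<^bsub>V\<^esub> = \<zero>\<^bsub>U\<^esub>"
proof -
  interpret V: right_module R V by fact
  interpret U: right_module R U by fact
  have c: "h \<zero>\<^bsub>V\<^esub> \<in> carrier U" using mod_hom_closed[OF assms(3)] by simp
  have "h \<zero>\<^bsub>V\<^esub> \<oplus>\<^bsub>U\<^esub> h \<zero>\<^bsub>V\<^esub> = h \<zero>\<^bsub>V\<^esub>"
    using mod_hom_add[OF assms(3), of "\<zero>\<^bsub>V\<^esub>" "\<zero>\<^bsub>V\<^esub>"] by simp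
  then show ?thesis using c U.V.add.r_cancel_one' by fastforce
qed

lemma mod_hom_minus:
  assumes "right_module R V" "right_module R U" "h \<in> mod_hom R V U" "x \<in> carrier V"
  shows "h (\<ominus>\<^bsub>V\<^esub> x) = \<ominus>\<^bsub>U\<^esub> h x"
proof -
  interpret V: right_module R V by fact
  interpret U: right_module R U by fact
  have "h (\<ominus>\<^bsub>V\<^esub> x) = h ((\<ominus>\<^bsub>R\<^esub> \<one>\<^bsub>R\<^esub>) \<odot>\<^bsub>V\<^esub> x)" using V.minus_one_smult assms(4) by simp
  also have "\<dots> = (\<ominus>\<^bsub>R\<^esub> \<one>\<^bsub>R\<^esub>) \<odot>\<^bsub>U\<^esub> h x"
    using mod_hom_smult[OF assms(3)] assms(4) by simp
  finally show ?thesis using U.minus_one_smult mod_hom_closed[OF assms(3,4)] by simp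
qed

lemma mod_hom_comp:
  "h \<in> mod_hom R V U \<Longrightarrow> g \<in> mod_hom R U V' \<Longrightarrow> (\<lambda>x. g (h x)) \<in> mod_hom R V V'"
  by (auto simp: mod_hom_def Pi_iff)

lemma submodule_image:
  assumes "right_module R V" "right_module R U" and h: "h \<in> mod_hom R V U"
    and A: "submodule A R V"
  shows "submodule (h ` A) R U"
proof -
  interpret V: right_module R V by fact
  interpret U: right_module R U by fact
  have Ac: "x \<in> A \<Longrightarrow> x \<in> carrier V" for x by (rule V.submodule_carrier[OF A])
  show ?thesis
  proof (rule U.submoduleI)
    show "h ` A \<subseteq> carrier U" using mod_hom_closed[OF h] Ac by auto
    show "\<zero>\<^bsub>U\<^esub> \<in> h ` A"
      using mod_hom_zero[OF assms(1,2) h] V.submodule_zero[OF A] by (metis imageI)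
    show "x \<oplus>\<^bsub>U\<^esub> y \<in> h ` A" if "x \<in> h ` A" "y \<in> h ` A" for x y
      using that V.submodule_add[OF A] mod_hom_add[OF h] Ac by (auto simp: image_iff) metis
    show "a \<odot>\<^bsub>U\<^esub> x \<in> h ` A" if "a \<in> carrier R" "x \<in> h ` A" for a x
      using that V.submodule_smult[OF A] mod_hom_smult[OF h] Ac by (auto simp: image_iff) metis
  qed
qed

lemma submodule_kernel:
  assumes "right_module R V" "right_module R U" and h: "h \<in> mod_hom R V U"
  shows "submodule {x \<in> carrier V. h x = \<zero>\<^bsub>U\<^esub>} R V"
proof -
  interpret V: right_module R V by fact
  interpret U: right_module R U by fact
  show ?thesis
    using mod_hom_zero[OF assms] mod_hom_add[OF h] mod_hom_smult[OF h] V.smult_closed U.smult_zero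
    by (intro V.submoduleI) auto
qed

text \<open>
  First isomorphism theorem: the isomorphism \<open>\<phi>\<close> picks the common value of \<open>h\<close> on a coset of the
  kernel.
\<close>

lemma is_quotient_of_surjective:
  assumes "right_module R V" "right_module R U" and h: "h \<in> mod_hom R V U"
    and surj: "h ` carrier V = carrier U"
  shows "is_quotient_of R U V"
proof -
  interpret V: right_module R V by fact
  interpret U: right_module R U by fact
  define N where "N = {x \<in> carrier V. h x = \<zero>\<^bsub>U\<^esub>}"
  have N: "submodule N R V" unfolding N_def by (rule submodule_kernel[OF assms(1-3)])
  define \<phi> where "\<phi> C = (THE y. \<exists>x\<in>carrier V. C = N +>\<^bsub>V\<^esub> x \<and> y = h x)" for C
  have eq: "N +>\<^bsub>V\<^esub> x = N +>\<^bsub>V\<^esub> y \<longleftrightarrow> h x = h y" if "x \<in> carrier V" "y \<in> carrier V" for x y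
  proof -
    have "N +>\<^bsub>V\<^esub> x = N +>\<^bsub>V\<^esub> y \<longleftrightarrow> h x \<oplus>\<^bsub>U\<^esub> \<ominus>\<^bsub>U\<^esub> h y = \<zero>\<^bsub>U\<^esub>"
      using V.coset_eq_iff[OF N that] that mod_hom_add[OF h] mod_hom_minus[OF assms(1-3)]
      by (simp add: N_def)
    moreover have "u = v" if u: "u \<in> carrier U" "v \<in> carrier U" "u \<oplus>\<^bsub>U\<^esub> \<ominus>\<^bsub>U\<^esub> v = \<zero>\<^bsub>U\<^esub>" for u v
    proof -
      have "u = (u \<oplus>\<^bsub>U\<^esub> \<ominus>\<^bsub>U\<^esub> v) \<oplus>\<^bsub>U\<^esub> v" using u(1,2) by (simp add: U.V.a_assoc U.V.l_neg)
      then show ?thesis using u by simp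
    qed
    ultimately show ?thesis using mod_hom_closed[OF h] that U.V.r_neg by metis
  qed
  have \<phi>: "\<phi> (N +>\<^bsub>V\<^esub> x) = h x" if "x \<in> carrier V" for x
    unfolding \<phi>_def using that eq by (intro the_equality) auto
  have "\<phi> \<in> mod_hom R (quotient_module V N) U"
    using mod_hom_closed[OF h] mod_hom_add[OF h] mod_hom_smult[OF h] V.smult_closed
    by (auto simp: mod_hom_def V.quotient_carrier V.quotient_add[OF N] V.quotient_smult[OF N] \<phi>)
  moreover have "bij_betw \<phi> (carrier (quotient_module V N)) (carrier U)"
    using eq surj by (auto simp: bij_betw_def inj_on_def V.quotient_carrier \<phi> image_image)
  ultimately show ?thesis using N by (auto simp: is_quotient_of_def mod_isomorphic_def)
qed

section \<open>Lifting along arbitrary surjections\<close>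

text \<open>
  The free right module on a set \<open>Y\<close>.  A coefficient \<open>\<phi> x\<close> stands for \<open>x . \<phi> x\<close>, so scalars multiply
  the coefficients from the right.  Elements are families on the whole type, which is the type
  that the definition of projective modules provides for.
\<close>

definition free_module :: "('r, 'x) ring_scheme \<Rightarrow> 'v set \<Rightarrow> ('r, 'v \<Rightarrow> 'r) module" where
  "free_module R Y =
     \<lparr>carrier = {\<phi>. (\<forall>x. \<phi> x \<in> carrier R) \<and> finite {x. \<phi> x \<noteq> \<zero>\<^bsub>R\<^esub>} \<and>
        {x. \<phi> x \<noteq> \<zero>\<^bsub>R\<^esub>} \<subseteq> Y},
      monoid.mult = undefined, one = undefined, ring.zero = (\<lambda>_. \<zero>\<^bsub>R\<^esub>),
      add = (\<lambda>\<phi> \<psi> x. \<phi> x \<oplus>\<^bsub>R\<^esub> \<psi> x), smult = (\<lambda>a \<phi> x. \<phi> x \<otimes>\<^bsub>R\<^esub> a)\<rparr>"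

text \<open>The homomorphism from the free module that extends a map \<open>t\<close> on its basis.\<close>

definition free_eval ::
  "('r, 'x) ring_scheme \<Rightarrow> ('r, 'u, 'y) module_scheme \<Rightarrow> ('v \<Rightarrow> 'u) \<Rightarrow> ('v \<Rightarrow> 'r) \<Rightarrow> 'u" where
  "free_eval R A t \<phi> = finsum A (\<lambda>x. \<phi> x \<odot>\<^bsub>A\<^esub> t x) {x. \<phi> x \<noteq> \<zero>\<^bsub>R\<^esub>}"

lemma free_module_carrierI:
  assumes "\<And>x. \<phi> x \<in> carrier R" "{x. \<phi> x \<noteq> \<zero>\<^bsub>R\<^esub>} \<subseteq> B" "finite B" "B \<subseteq> Y"
  shows "\<phi> \<in> carrier (free_module R Y)"
  using assms(1) finite_subset[OF assms(2,3)] subset_trans[OF assms(2,4)]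
  by (simp add: free_module_def)

lemma free_module_carrierD:
  assumes "\<phi> \<in> carrier (free_module R Y)"
  shows "\<phi> x \<in> carrier R" "finite {x. \<phi> x \<noteq> \<zero>\<^bsub>R\<^esub>}" "{x. \<phi> x \<noteq> \<zero>\<^bsub>R\<^esub>} \<subseteq> Y"
  using assms by (simp_all add: free_module_def)

lemma right_module_free_module:
  assumes "ring R" shows "right_module R (free_module R Y)"
proof -
  interpret R: ring R by fact
  let ?F = "free_module R Y"
  have ops: "\<phi> \<oplus>\<^bsub>?F\<^esub> \<psi> = (\<lambda>x. \<phi> x \<oplus>\<^bsub>R\<^esub> \<psi> x)" "a \<odot>\<^bsub>?F\<^esub> \<phi> = (\<lambda>x. \<phi> x \<otimes>\<^bsub>R\<^esub> a)"
      "\<zero>\<^bsub>?F\<^esub> = (\<lambda>x. \<zero>\<^bsub>R\<^esub>)" for \<phi> \<psi> a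
    by (simp_all add: free_module_def)
  have c: "\<phi> x \<in> carrier R" if "\<phi> \<in> carrier ?F" for \<phi> x
    by (rule free_module_carrierD(1)[OF that])
  interpret F: abelian_group ?F
  proof (rule abelian_groupI)
    fix \<phi> assume f: "\<phi> \<in> carrier ?F"
    have "(\<lambda>x. \<ominus>\<^bsub>R\<^esub> \<phi> x) \<in> carrier ?F"
      using c[OF f] free_module_carrierD(2,3)[OF f]
      by (intro free_module_carrierI[where B = "{x. \<phi> x \<noteq> \<zero>\<^bsub>R\<^esub>}"]) auto
    then show "\<exists>\<psi>\<in>carrier ?F. \<psi> \<oplus>\<^bsub>?F\<^esub> \<phi> = \<zero>\<^bsub>?F\<^esub>"
      using c[OF f] by (intro bexI[of _ "\<lambda>x. \<ominus>\<^bsub>R\<^esub> \<phi> x"]) (simp_all add: ops R.l_neg)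
  next
    fix \<phi> \<psi> assume f: "\<phi> \<in> carrier ?F" and g: "\<psi> \<in> carrier ?F"
    show "\<phi> \<oplus>\<^bsub>?F\<^esub> \<psi> \<in> carrier ?F"
      unfolding ops using c[OF f] c[OF g] free_module_carrierD(2,3)[OF f] free_module_carrierD(2,3)[OF g]
      by (intro free_module_carrierI[where B = "{x. \<phi> x \<noteq> \<zero>\<^bsub>R\<^esub>} \<union> {x. \<psi> x \<noteq> \<zero>\<^bsub>R\<^esub>}"]) auto
    show "\<phi> \<oplus>\<^bsub>?F\<^esub> \<psi> = \<psi> \<oplus>\<^bsub>?F\<^esub> \<phi>"
      unfolding ops using c[OF f] c[OF g] by (simp add: R.a_comm)
  next
    show "\<zero>\<^bsub>?F\<^esub> \<in> carrier ?F" by (simp add: free_module_def)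
  next
    fix \<phi> \<psi> \<chi> assume f: "\<phi> \<in> carrier ?F" "\<psi> \<in> carrier ?F" "\<chi> \<in> carrier ?F"
    show "\<phi> \<oplus>\<^bsub>?F\<^esub> \<psi> \<oplus>\<^bsub>?F\<^esub> \<chi> = \<phi> \<oplus>\<^bsub>?F\<^esub> (\<psi> \<oplus>\<^bsub>?F\<^esub> \<chi>)"
      unfolding ops using f[THEN c] by (simp add: R.a_assoc)
  next
    fix \<phi> assume f: "\<phi> \<in> carrier ?F"
    show "\<zero>\<^bsub>?F\<^esub> \<oplus>\<^bsub>?F\<^esub> \<phi> = \<phi>" unfolding ops using c[OF f] by simp
  qed
  show ?thesis
  proof
    fix a \<phi> assume a: "a \<in> carrier R" and f: "\<phi> \<in> carrier ?F"
    show "a \<odot>\<^bsub>?F\<^esub> \<phi> \<in> carrier ?F"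
      unfolding ops using a c[OF f] free_module_carrierD(2,3)[OF f]
      by (intro free_module_carrierI[where B = "{x. \<phi> x \<noteq> \<zero>\<^bsub>R\<^esub>}"]) auto
  qed (simp_all add: ops c R.l_distr R.r_distr R.m_assoc)
qed

lemma free_eval_eq:
  assumes "right_module R A" and \<phi>: "\<phi> \<in> carrier (free_module R Y)"
    and t: "\<And>x. x \<in> Y \<Longrightarrow> t x \<in> carrier A"
    and B: "finite B" "{x. \<phi> x \<noteq> \<zero>\<^bsub>R\<^esub>} \<subseteq> B" "B \<subseteq> Y"
  shows "free_eval R A t \<phi> = finsum A (\<lambda>x. \<phi> x \<odot>\<^bsub>A\<^esub> t x) B"
proof -
  interpret A: right_module R A by fact
  have "\<phi> x \<in> carrier R" for x using \<phi> by (simp add: free_module_def)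
  then show ?thesis
    unfolding free_eval_def using B t A.smult_closed A.zero_smult
    by (intro A.V.add.finprod_mono_neutral_cong_left) (auto simp: subset_iff)
qed

text \<open>
  Stated for additive maps, because the action of a fixed scalar is in general not a module
  homomorphism over a noncommutative ring.
\<close>

lemma additive_finsum:
  assumes "abelian_group V" "abelian_group U" and h: "h \<in> carrier V \<rightarrow> carrier U"
    and add: "\<And>x y. x \<in> carrier V \<Longrightarrow> y \<in> carrier V \<Longrightarrow> h (x \<oplus>\<^bsub>V\<^esub> y) = h x \<oplus>\<^bsub>U\<^esub> h y"
    and B: "finite B" and f: "\<And>x. x \<in> B \<Longrightarrow> f x \<in> carrier V"
  shows "h (finsum V f B) = finsum U (\<lambda>x. h (f x)) B"
proof -
  interpret V: abelian_group V by fact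
  interpret U: abelian_group U by fact
  have c: "h \<zero>\<^bsub>V\<^esub> \<in> carrier U" using h by auto
  have "h \<zero>\<^bsub>V\<^esub> \<oplus>\<^bsub>U\<^esub> h \<zero>\<^bsub>V\<^esub> = h \<zero>\<^bsub>V\<^esub>" using add[of "\<zero>\<^bsub>V\<^esub>" "\<zero>\<^bsub>V\<^esub>"] by simp
  then have zero: "h \<zero>\<^bsub>V\<^esub> = \<zero>\<^bsub>U\<^esub>" using c U.add.r_cancel_one' by fastforce
  show ?thesis
    using B f
  proof (induction B)
    case (insert x B)
    have "f \<in> B \<rightarrow> carrier V" "f x \<in> carrier V" using insert by auto
    moreover have "(\<lambda>x. h (f x)) \<in> B \<rightarrow> carrier U" "h (f x) \<in> carrier U"
      using insert h by auto
    ultimately show ?case using insert add by simp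
  qed (use zero in simp)
qed

lemma mod_hom_finsum:
  assumes "right_module R V" "right_module R U" and h: "h \<in> mod_hom R V U"
    and "finite B" "\<And>x. x \<in> B \<Longrightarrow> f x \<in> carrier V"
  shows "h (finsum V f B) = finsum U (\<lambda>x. h (f x)) B"
  using assms mod_hom_add[OF h] mod_hom_closed[OF h]
  by (intro additive_finsum) (auto simp: right_module_def)

lemma free_eval_hom:
  assumes "right_module R A" and t: "\<And>x. x \<in> Y \<Longrightarrow> t x \<in> carrier A"
  shows "free_eval R A t \<in> mod_hom R (free_module R Y) A"
proof -
  interpret A: right_module R A by fact
  let ?F = "free_module R Y"
  have summand: "\<phi> x \<odot>\<^bsub>A\<^esub> t x \<in> carrier A" if "\<phi> \<in> carrier ?F" "x \<in> Y" for \<phi> x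
    using A.smult_closed[OF free_module_carrierD(1)[OF that(1)] t[OF that(2)]] .
  have closed: "free_eval R A t \<phi> \<in> carrier A" if "\<phi> \<in> carrier ?F" for \<phi>
    unfolding free_eval_def
    using that summand[OF that] by (intro A.V.finsum_closed) (auto simp: free_module_def subset_iff)
  interpret F: right_module R ?F by (rule right_module_free_module[OF A.R.ring_axioms])
  have add: "free_eval R A t (\<phi> \<oplus>\<^bsub>?F\<^esub> \<psi>) = free_eval R A t \<phi> \<oplus>\<^bsub>A\<^esub> free_eval R A t \<psi>"
    if f: "\<phi> \<in> carrier ?F" and g: "\<psi> \<in> carrier ?F" for \<phi> \<psi>
  proof -
    define B where "B = {x. \<phi> x \<noteq> \<zero>\<^bsub>R\<^esub>} \<union> {x. \<psi> x \<noteq> \<zero>\<^bsub>R\<^esub>}"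
    have B: "finite B" "B \<subseteq> Y" using f g by (auto simp: B_def dest: free_module_carrierD(2,3))
    have sum: "\<phi> \<oplus>\<^bsub>?F\<^esub> \<psi> = (\<lambda>x. \<phi> x \<oplus>\<^bsub>R\<^esub> \<psi> x)" by (simp add: free_module_def)
    have "{x. (\<phi> \<oplus>\<^bsub>?F\<^esub> \<psi>) x \<noteq> \<zero>\<^bsub>R\<^esub>} \<subseteq> B" by (auto simp: B_def sum)
    then have "free_eval R A t (\<phi> \<oplus>\<^bsub>?F\<^esub> \<psi>) = finsum A (\<lambda>x. (\<phi> \<oplus>\<^bsub>?F\<^esub> \<psi>) x \<odot>\<^bsub>A\<^esub> t x) B"
      using f g B t by (intro free_eval_eq[OF assms(1), where Y = Y]) auto
    also have "\<dots> = finsum A (\<lambda>x. \<phi> x \<odot>\<^bsub>A\<^esub> t x \<oplus>\<^bsub>A\<^esub> \<psi> x \<odot>\<^bsub>A\<^esub> t x) B"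
      using f g B t summand[OF f] summand[OF g] A.smult_l_distr
      by (intro A.V.finsum_cong') (auto simp: sum free_module_carrierD subset_iff)
    also have "\<dots> = finsum A (\<lambda>x. \<phi> x \<odot>\<^bsub>A\<^esub> t x) B \<oplus>\<^bsub>A\<^esub> finsum A (\<lambda>x. \<psi> x \<odot>\<^bsub>A\<^esub> t x) B"
      using B summand[OF f] summand[OF g] by (intro A.V.finsum_addf) auto
    also have "finsum A (\<lambda>x. \<phi> x \<odot>\<^bsub>A\<^esub> t x) B = free_eval R A t \<phi>"
      using f B t by (intro free_eval_eq[OF assms(1), where Y = Y, symmetric]) (auto simp: B_def)
    also have "finsum A (\<lambda>x. \<psi> x \<odot>\<^bsub>A\<^esub> t x) B = free_eval R A t \<psi>"
      using g B t by (intro free_eval_eq[OF assms(1), where Y = Y, symmetric]) (auto simp: B_def)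
    finally show ?thesis .
  qed
  have smult: "free_eval R A t (a \<odot>\<^bsub>?F\<^esub> \<phi>) = a \<odot>\<^bsub>A\<^esub> free_eval R A t \<phi>"
    if a: "a \<in> carrier R" and f: "\<phi> \<in> carrier ?F" for a \<phi>
  proof -
    define B where "B = {x. \<phi> x \<noteq> \<zero>\<^bsub>R\<^esub>}"
    have B: "finite B" "B \<subseteq> Y" using f by (auto simp: B_def dest: free_module_carrierD(2,3))
    have prod: "a \<odot>\<^bsub>?F\<^esub> \<phi> = (\<lambda>x. \<phi> x \<otimes>\<^bsub>R\<^esub> a)" by (simp add: free_module_def)
    have "{x. (a \<odot>\<^bsub>?F\<^esub> \<phi>) x \<noteq> \<zero>\<^bsub>R\<^esub>} \<subseteq> B" using a by (auto simp: B_def prod)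
    then have "free_eval R A t (a \<odot>\<^bsub>?F\<^esub> \<phi>) = finsum A (\<lambda>x. (a \<odot>\<^bsub>?F\<^esub> \<phi>) x \<odot>\<^bsub>A\<^esub> t x) B"
      using F.smult_closed[OF a f] B t by (intro free_eval_eq[OF assms(1), where Y = Y]) auto
    also have "\<dots> = finsum A (\<lambda>x. a \<odot>\<^bsub>A\<^esub> (\<phi> x \<odot>\<^bsub>A\<^esub> t x)) B"
      using a f B t summand[OF f] A.smult_assoc_right A.smult_closed
      by (intro A.V.finsum_cong') (auto simp: prod free_module_carrierD subset_iff)
    also have "\<dots> = a \<odot>\<^bsub>A\<^esub> free_eval R A t \<phi>"
      unfolding free_eval_def B_def[symmetric]
      using a B summand[OF f] A.smult_closed A.smult_r_distr
      by (intro additive_finsum[OF A.V.abelian_group_axioms A.V.abelian_group_axioms, symmetric])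
        auto
    finally show ?thesis .
  qed
  show ?thesis using closed add smult by (auto simp: mod_hom_def)
qed

text \<open>
  A projective module is a direct summand of the free module on its carrier.  The lifting property
  therefore holds for modules of every type: lift the generators of the free module.
\<close>

lemma projective_lift:
  assumes proj: "projective_module R P" and A: "right_module R A" and B: "right_module R B"
    and g: "g \<in> mod_hom R A B" and surj: "g ` carrier A = carrier B" and h: "h \<in> mod_hom R P B"
  shows "\<exists>k\<in>mod_hom R P A. \<forall>x\<in>carrier P. g (k x) = h x"
proof -
  have P: "right_module R P" using proj by (simp add: projective_module_def)
  interpret A: right_module R A by fact
  interpret B: right_module R B by fact
  interpret P: right_module R P by fact
  let ?F = "free_module R (carrier P)"
  have F: "right_module R ?F" by (rule right_module_free_module[OF A.R.ring_axioms])
  define e where "e = free_eval R P (\<lambda>x. x)"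
  have e: "e \<in> mod_hom R ?F P" unfolding e_def by (rule free_eval_hom[OF P])
  have "e ` carrier ?F = carrier P"
  proof
    show "e ` carrier ?F \<subseteq> carrier P" using mod_hom_closed[OF e] by auto
    show "carrier P \<subseteq> e ` carrier ?F"
    proof
      fix x assume x: "x \<in> carrier P"
      define \<phi> where "\<phi> = (\<lambda>y. if y = x then \<one>\<^bsub>R\<^esub> else \<zero>\<^bsub>R\<^esub>)"
      have f: "\<phi> \<in> carrier ?F"
        using x by (intro free_module_carrierI[where B = "{x}"]) (auto simp: \<phi>_def)
      have "e \<phi> = finsum P (\<lambda>y. \<phi> y \<odot>\<^bsub>P\<^esub> y) {x}"
        unfolding e_def using x by (intro free_eval_eq[OF P f]) (auto simp: \<phi>_def)
      also have "\<dots> = x" using x P.smult_one by (simp add: \<phi>_def)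
      finally show "x \<in> e ` carrier ?F" using f by force
    qed
  qed
  moreover have "(\<lambda>x. x) \<in> mod_hom R P P" by (simp add: mod_hom_def)
  ultimately obtain k where k: "k \<in> mod_hom R P ?F" "\<forall>x\<in>carrier P. e (k x) = x"
    using proj F P e unfolding projective_module_def by metis
  define t where "t x = (SOME a. a \<in> carrier A \<and> g a = h x)" for x
  have t: "t x \<in> carrier A \<and> g (t x) = h x" if "x \<in> carrier P" for x
  proof -
    have "h x \<in> g ` carrier A" using mod_hom_closed[OF h that] surj by simp
    then have "\<exists>a. a \<in> carrier A \<and> g a = h x" by auto
    then show ?thesis unfolding t_def by (rule someI_ex)
  qed
  define l where "l = free_eval R A t"
  have l: "l \<in> mod_hom R ?F A" unfolding l_def using t by (intro free_eval_hom[OF A]) simp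
  have "g (l \<phi>) = h (e \<phi>)" if f: "\<phi> \<in> carrier ?F" for \<phi>
  proof -
    define D where "D = {x. \<phi> x \<noteq> \<zero>\<^bsub>R\<^esub>}"
    have D: "finite D" "D \<subseteq> carrier P" "\<And>x. \<phi> x \<in> carrier R"
      using f by (auto simp: D_def free_module_def)
    have "g (l \<phi>) = finsum B (\<lambda>x. g (\<phi> x \<odot>\<^bsub>A\<^esub> t x)) D"
      unfolding l_def free_eval_def D_def[symmetric]
      using D t A.smult_closed by (intro mod_hom_finsum[OF A B g]) auto
    also have "\<dots> = finsum B (\<lambda>x. h (\<phi> x \<odot>\<^bsub>P\<^esub> x)) D"
      using D t mod_hom_smult[OF g] mod_hom_smult[OF h] mod_hom_closed[OF h] P.smult_closed B.smult_closed
      by (intro B.V.finsum_cong') (auto simp: subset_iff)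
    also have "\<dots> = h (e \<phi>)"
      unfolding e_def free_eval_def D_def[symmetric]
      using D P.smult_closed by (intro mod_hom_finsum[OF P B h, symmetric]) auto
    finally show ?thesis .
  qed
  then have "\<forall>x\<in>carrier P. g (l (k x)) = h x"
    using k mod_hom_closed[OF k(1)] by simp
  then show ?thesis using mod_hom_comp[OF k(1) l] by (intro bexI[of _ "\<lambda>x. l (k x)"])
qed

section \<open>Projective covers of quotients of local modules\<close>

text \<open>
  For modules of finite length this means that there is at most one maximal submodule.  The form
  chosen here passes to preimages under a cover without any reference to maximal submodules.
\<close>

definition local_module ::
  "('r, 'x) ring_scheme \<Rightarrow> ('r, 'v, 'y) module_scheme \<Rightarrow> bool" where
  "local_module R V \<longleftrightarrow> right_module R V \<and>
     (\<forall>A B. submodule A R V \<and> submodule B R V \<and> A <+>\<^bsub>V\<^esub> B = carrier V \<longrightarrow>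
        A = carrier V \<or> B = carrier V)"

lemma local_moduleD:
  assumes "local_module R V" "submodule A R V" "submodule B R V" "A <+>\<^bsub>V\<^esub> B = carrier V"
  shows "A = carrier V \<or> B = carrier V"
  using assms unfolding local_module_def by blast

lemma local_module_indecomposable:
  assumes loc: "local_module R V" and nz: "carrier V \<noteq> {\<zero>\<^bsub>V\<^esub>}"
  shows "indecomposable_module R V"
proof -
  have V: "right_module R V" using loc by (simp add: local_module_def)
  interpret V: right_module R V by fact
  show ?thesis
    unfolding indecomposable_module_def
  proof (intro conjI allI impI V nz)
    fix A B
    assume AB: "submodule A R V \<and> submodule B R V \<and>
      A <+>\<^bsub>V\<^esub> B = carrier V \<and> A \<inter> B = {\<zero>\<^bsub>V\<^esub>}"
    then have "A \<subseteq> carrier V" "B \<subseteq> carrier V" using V.submodule_carrier by auto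
    moreover have "A = carrier V \<or> B = carrier V" using local_moduleD[OF loc, of A B] AB by simp
    ultimately show "A = {\<zero>\<^bsub>V\<^esub>} \<or> B = {\<zero>\<^bsub>V\<^esub>}" using AB by auto
  qed
qed

lemma set_add_mem_iff: "x \<in> A <+>\<^bsub>V\<^esub> B \<longleftrightarrow> (\<exists>a\<in>A. \<exists>b\<in>B. x = a \<oplus>\<^bsub>V\<^esub> b)"
  by (auto simp: set_add_def')

text \<open>
  A lift \<open>P \<rightarrow> V\<close> of the cover is surjective, because its image and \<open>N\<close> span \<open>V\<close>.  If \<open>P = A + B\<close>,
  then the image of one summand, say \<open>A\<close>, is all of \<open>V\<close>.  So \<open>A\<close> maps onto the quotient, and
  \<open>A = P\<close> because the kernel of the cover is superfluous.
\<close>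

lemma projective_cover_of_local_quotient:
  assumes loc: "local_module R V" and N: "submodule N R V" and N_ne: "N \<noteq> carrier V"
    and cover: "projective_cover R P (quotient_module V N)"
  shows "indecomposable_module R P \<and> is_quotient_of R V P"
proof -
  let ?Q = "quotient_module V N"
  have V: "right_module R V" using loc by (simp add: local_module_def)
  interpret V: right_module R V by fact
  have Q: "right_module R ?Q" by (rule V.right_module_quotient[OF N])
  have proj: "projective_module R P" using cover by (simp add: projective_cover_def)
  then have P: "right_module R P" by (simp add: projective_module_def)
  interpret P: right_module R P by fact
  interpret Q: right_module R ?Q by fact
  obtain p where p: "p \<in> mod_hom R P ?Q" "p ` carrier P = carrier ?Q"
      and sup: "superfluous R P {x \<in> carrier P. p x = \<zero>\<^bsub>?Q\<^esub>}"
    using cover by (auto simp: projective_cover_def)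
  let ?q = "\<lambda>x. N +>\<^bsub>V\<^esub> x"
  have "?q ` carrier V = carrier ?Q" by (simp add: V.quotient_carrier)
  from projective_lift[OF proj V Q V.coset_map_hom[OF N] this p(1)] obtain k
    where k: "k \<in> mod_hom R P V" "\<forall>x\<in>carrier P. N +>\<^bsub>V\<^esub> k x = p x" by blast
  have image: "submodule (k ` A) R V" if "submodule A R P" for A
    by (rule submodule_image[OF P V k(1) that])
  have P_sub: "submodule (carrier P) R P" by (rule P.submoduleI) (auto simp: P.smult_closed)
  have surj: "k ` carrier P = carrier V"
  proof -
    have "k ` carrier P <+>\<^bsub>V\<^esub> N = carrier V"
    proof
      show "k ` carrier P <+>\<^bsub>V\<^esub> N \<subseteq> carrier V"
        using V.submodule_carrier[OF N] mod_hom_closed[OF k(1)] by (auto simp: set_add_mem_iff)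
      show "carrier V \<subseteq> k ` carrier P <+>\<^bsub>V\<^esub> N"
      proof
        fix v assume v: "v \<in> carrier V"
        then have "N +>\<^bsub>V\<^esub> v \<in> p ` carrier P" unfolding p(2) by (auto simp: V.quotient_carrier)
        then obtain x where x: "x \<in> carrier P" "N +>\<^bsub>V\<^esub> v = N +>\<^bsub>V\<^esub> k x" using k(2) by auto
        have kx: "k x \<in> carrier V" using mod_hom_closed[OF k(1)] x by simp
        have "v \<oplus>\<^bsub>V\<^esub> \<ominus>\<^bsub>V\<^esub> k x \<in> N" using V.coset_eq_iff[OF N v kx] x by simp
        moreover have "v = k x \<oplus>\<^bsub>V\<^esub> (v \<oplus>\<^bsub>V\<^esub> \<ominus>\<^bsub>V\<^esub> k x)"
          using v kx by (simp add: V.V.a_lcomm V.V.r_neg)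
        ultimately show "v \<in> k ` carrier P <+>\<^bsub>V\<^esub> N" using x(1) unfolding set_add_mem_iff by blast
      qed
    qed
    from local_moduleD[OF loc image[OF P_sub] N this] N_ne show ?thesis by simp
  qed
  have whole: "A = carrier P" if A: "submodule A R P" and kA: "k ` A = carrier V" for A
  proof -
    let ?K = "{x \<in> carrier P. p x = \<zero>\<^bsub>?Q\<^esub>}"
    have "?K <+>\<^bsub>P\<^esub> A = carrier P"
    proof
      show "?K <+>\<^bsub>P\<^esub> A \<subseteq> carrier P"
        using P.submodule_carrier[OF A] by (auto simp: set_add_mem_iff)
      show "carrier P \<subseteq> ?K <+>\<^bsub>P\<^esub> A"
      proof
        fix x assume x: "x \<in> carrier P"
        have "k x \<in> k ` A" unfolding kA using mod_hom_closed[OF k(1) x] .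
        then obtain a where a: "a \<in> A" "k x = k a" by auto
        have ac: "a \<in> carrier P" by (rule P.submodule_carrier[OF A a(1)])
        have "p x = p a" using k(2) x ac a(2) by metis
        then have "p (x \<oplus>\<^bsub>P\<^esub> \<ominus>\<^bsub>P\<^esub> a) = \<zero>\<^bsub>?Q\<^esub>"
          using x ac mod_hom_add[OF p(1)] mod_hom_minus[OF P Q p(1)] mod_hom_closed[OF p(1)]
          by (simp add: Q.V.r_neg)
        then have "x \<oplus>\<^bsub>P\<^esub> \<ominus>\<^bsub>P\<^esub> a \<in> ?K" using x ac by simp
        moreover have "x = (x \<oplus>\<^bsub>P\<^esub> \<ominus>\<^bsub>P\<^esub> a) \<oplus>\<^bsub>P\<^esub> a"
          using x ac by (simp add: P.V.a_assoc P.V.l_neg)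
        ultimately show "x \<in> ?K <+>\<^bsub>P\<^esub> A" using a(1) unfolding set_add_mem_iff by blast
      qed
    qed
    then show ?thesis using sup A by (auto simp: superfluous_def)
  qed
  have "local_module R P"
    unfolding local_module_def
  proof (intro conjI allI impI P)
    fix A B assume AB: "submodule A R P \<and> submodule B R P \<and> A <+>\<^bsub>P\<^esub> B = carrier P"
    then have c: "A \<subseteq> carrier P" "B \<subseteq> carrier P" using P.submodule_carrier by auto
    have "k ` A <+>\<^bsub>V\<^esub> k ` B = k ` (A <+>\<^bsub>P\<^esub> B)"
    proof (intro equalityI subsetI)
      fix v assume "v \<in> k ` A <+>\<^bsub>V\<^esub> k ` B"
      then obtain a b where "a \<in> A" "b \<in> B" "v = k a \<oplus>\<^bsub>V\<^esub> k b" by (auto simp: set_add_mem_iff)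
      then show "v \<in> k ` (A <+>\<^bsub>P\<^esub> B)"
        using mod_hom_add[OF k(1)] c by (intro image_eqI[of _ _ "a \<oplus>\<^bsub>P\<^esub> b"]) (auto simp: set_add_mem_iff subset_iff)
    next
      fix v assume "v \<in> k ` (A <+>\<^bsub>P\<^esub> B)"
      then obtain a b where "a \<in> A" "b \<in> B" "v = k (a \<oplus>\<^bsub>P\<^esub> b)" by (auto simp: set_add_mem_iff)
      then show "v \<in> k ` A <+>\<^bsub>V\<^esub> k ` B"
        using mod_hom_add[OF k(1)] c by (auto simp: set_add_mem_iff subset_iff)
    qed
    then have "k ` A <+>\<^bsub>V\<^esub> k ` B = carrier V" using AB surj by simp
    then have "k ` A = carrier V \<or> k ` B = carrier V"
      using local_moduleD[OF loc image image] AB by simp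
    then show "A = carrier P \<or> B = carrier P" using whole AB by blast
  qed
  moreover have "carrier P \<noteq> {\<zero>\<^bsub>P\<^esub>}"
  proof
    assume eq: "carrier P = {\<zero>\<^bsub>P\<^esub>}"
    have "carrier V = k ` {\<zero>\<^bsub>P\<^esub>}" by (simp only: surj[symmetric] eq)
    then have trivial: "carrier V = {\<zero>\<^bsub>V\<^esub>}" using mod_hom_zero[OF P V k(1)] by simp
    have "N \<subseteq> carrier V" using V.submodule_carrier[OF N] by blast
    then show False using N_ne V.submodule_zero[OF N] unfolding trivial by blast
  qed
  ultimately have "indecomposable_module R P" by (rule local_module_indecomposable)
  then show ?thesis using is_quotient_of_surjective[OF P V k(1) surj] by simp
qed

section \<open>Existence of the translation module\<close>

context coxeter_system
begin

lemma finite_monoid_biHecke: "finite_monoid hecke"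
  using monoid_biHecke finite_M_set
  by (auto simp: finite_monoid_def finite_monoid_axioms_def biHecke_def)

text \<open>
  An operator \<open>f\<close> acts on the basis vector \<open>u\<close> by \<open>f u\<close> if it moves \<open>y u\<close> to \<open>y f u\<close>, where
  \<open>y = longest \<otimes> inv w\<close>.  Otherwise the left factor gets shorter and never recovers, so that
  the basis vector may be sent to zero.
\<close>

definition translation_matrix :: "'a \<Rightarrow> ('a \<Rightarrow> 'a) \<Rightarrow> 'a \<Rightarrow> 'a \<Rightarrow> 'k::field" where
  "translation_matrix w f u z =
     (if f (longest \<otimes> inv w \<otimes> u) = longest \<otimes> inv w \<otimes> f u \<and> z = f u then 1 else 0)"

lemma translation_matrix_stays_below:
  assumes w: "w \<in> carrier W" and u: "u \<in> below w" and f: "f \<in> M_set"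
    and e: "f (longest \<otimes> inv w \<otimes> u) = longest \<otimes> inv w \<otimes> f u"
  shows "f u \<in> below w"
proof -
  define y where "y = longest \<otimes> inv w"
  have y: "y \<in> carrier W" using w by (simp add: y_def)
  have uc: "u \<in> carrier W" by (rule below_carrier[OF u])
  have fu: "f u \<in> carrier W" by (rule M_set_apply[OF f uc])
  have "\<ell> (y \<otimes> u) = \<ell> y + \<ell> u" using below_iff_longest[OF w uc] u by (simp add: y_def)
  from M_set_preserves_product[OF f y uc this] obtain x
    where x: "x \<in> carrier W" "f (y \<otimes> u) = x \<otimes> f u" "\<ell> (x \<otimes> f u) = \<ell> x + \<ell> (f u)" by blast
  have "y \<otimes> f u = x \<otimes> f u" using e x(2) by (simp add: y_def)
  then have "y = x" using r_cancel[OF _ y x(1), of "f u"] fu by blast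
  then show ?thesis using below_iff_longest[OF w fu] x(3) by (simp add: y_def)
qed

lemma translation_matrix_mult:
  assumes w: "w \<in> carrier W" and u: "u \<in> below w" and f: "f \<in> M_set" and g: "g \<in> M_set"
  shows "translation_matrix w (compose (carrier W) g f) u z =
    (\<Sum>t\<in>below w. translation_matrix w f u t * (translation_matrix w g t z :: 'k::field))"
proof -
  define y where "y = longest \<otimes> inv w"
  have y: "y \<in> carrier W" using w by (simp add: y_def)
  have uc: "u \<in> carrier W" by (rule below_carrier[OF u])
  have fu: "f u \<in> carrier W" by (rule M_set_apply[OF f uc])
  have gfu: "g (f u) \<in> carrier W" by (rule M_set_apply[OF g fu])
  have comp: "compose (carrier W) g f (y \<otimes> u) = g (f (y \<otimes> u))"
      "compose (carrier W) g f u = g (f u)" using uc y by (simp_all add: compose_eq)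
  show ?thesis
  proof (cases "f (y \<otimes> u) = y \<otimes> f u")
    case True
    then have b: "f u \<in> below w"
      using translation_matrix_stays_below[OF w u f] by (simp add: y_def)
    have "(\<Sum>t\<in>below w. translation_matrix w f u t * (translation_matrix w g t z :: 'k)) =
        (\<Sum>t\<in>below w. if t = f u then translation_matrix w g (f u) z else 0)"
      using True by (intro sum.cong) (auto simp: translation_matrix_def y_def)
    also have "\<dots> = translation_matrix w g (f u) z" using b finite_below by simp
    also have "\<dots> = translation_matrix w (compose (carrier W) g f) u z"
      using True comp by (simp add: translation_matrix_def y_def)
    finally show ?thesis by simp
  next
    case False
    have "\<ell> (y \<otimes> u) = \<ell> y + \<ell> u" using below_iff_longest[OF w uc] u by (simp add: y_def)
    from M_set_preserves_product[OF f y uc this] obtain x where x: "x \<in> carrier W"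
        "f (y \<otimes> u) = x \<otimes> f u" "\<ell> (x \<otimes> f u) = \<ell> x + \<ell> (f u)" "x = y \<or> \<ell> x < \<ell> y" by blast
    from M_set_preserves_product[OF g x(1) fu x(3)] obtain x' where x': "x' \<in> carrier W"
        "g (x \<otimes> f u) = x' \<otimes> g (f u)" "x' = x \<or> \<ell> x' < \<ell> x" by blast
    have "\<ell> x < \<ell> y" using False x by auto
    then have "\<ell> x' < \<ell> y" using x'(3) by auto
    moreover have "x' = y" if "x' \<otimes> g (f u) = y \<otimes> g (f u)"
      using r_cancel[OF that x'(1) y gfu] .
    ultimately have "g (f (y \<otimes> u)) \<noteq> y \<otimes> g (f u)" using x(2) x'(2) by auto
    then show ?thesis using False comp by (simp add: translation_matrix_def y_def)
  qed
qed

lemma descents_longest_mult: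
  assumes w: "w \<in> carrier W" and u: "u \<in> below w" and i: "i \<in> I"
  shows "i \<in> descents (longest \<otimes> inv w \<otimes> u) \<longleftrightarrow> i \<in> descents u \<or> u \<otimes> s i \<notin> below w"
proof -
  define y where "y = longest \<otimes> inv w"
  have y: "y \<in> carrier W" using w by (simp add: y_def)
  have uc: "u \<in> carrier W" by (rule below_carrier[OF u])
  have l: "\<ell> (y \<otimes> u) = \<ell> y + \<ell> u" using below_iff_longest[OF w uc] u by (simp add: y_def)
  have ls: "u \<otimes> s i \<in> below w \<longleftrightarrow> \<ell> (y \<otimes> u \<otimes> s i) = \<ell> y + \<ell> (u \<otimes> s i)"
    using below_iff_longest[OF w, of "u \<otimes> s i"] uc i y by (simp add: y_def m_assoc w)
  have "i \<in> descents (y \<otimes> u) \<longleftrightarrow> i \<in> descents u \<or> u \<otimes> s i \<notin> below w"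
  proof (cases "i \<in> descents u")
    case True
    then have "\<ell> (y \<otimes> u \<otimes> s i) < \<ell> (y \<otimes> u)"
      using len_mult_le[of y "u \<otimes> s i"] descent_len[OF uc True] l y uc i by (simp add: m_assoc)
    then show ?thesis using True i by (simp add: descents_iff)
  next
    case False
    have "\<ell> (u \<otimes> s i) = \<ell> u + 1" by (rule ascent_len[OF uc i False])
    then show ?thesis using False ls l len_mult_s[of "y \<otimes> u" i] y uc i by (auto simp: descents_iff)
  qed
  then show ?thesis by (simp add: y_def)
qed

lemma generator_translation_condition:
  assumes w: "w \<in> carrier W" and u: "u \<in> below w" and i: "i \<in> I" and f: "f = up i \<or> f = down i"
  shows "f (longest \<otimes> inv w \<otimes> u) = longest \<otimes> inv w \<otimes> f u \<longleftrightarrow>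
    i \<in> descents u \<or> u \<otimes> s i \<in> below w"
proof -
  define y where "y = longest \<otimes> inv w"
  have y: "y \<in> carrier W" using w by (simp add: y_def)
  have uc: "u \<in> carrier W" by (rule below_carrier[OF u])
  have ne: "y \<otimes> u \<otimes> s i \<noteq> y \<otimes> u" using len_mult_s[of "y \<otimes> u" i] y uc i by auto
  have assoc: "y \<otimes> (u \<otimes> s i) = y \<otimes> u \<otimes> s i" using y uc i by (simp add: m_assoc)
  have "f (y \<otimes> u) = y \<otimes> f u \<longleftrightarrow> (i \<in> descents (y \<otimes> u) \<longleftrightarrow> i \<in> descents u)"
    using f uc y assoc ne ne[symmetric]
    by (elim disjE) (simp_all only: up_apply down_apply m_closed split: if_split, simp_all)
  then show ?thesis using descents_longest_mult[OF w u i] unfolding y_def by blast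
qed

lemma translation_module_exists:
  assumes w: "w \<in> carrier W"
  shows "\<exists>T :: (('a \<Rightarrow> 'a) \<Rightarrow> 'k::field, 'a \<Rightarrow> 'k) module. translation_module W I s w T"
proof -
  interpret H: finite_monoid hecke by (rule finite_monoid_biHecke)
  define T where "T = H.matrix_module (below w)
    (translation_matrix w :: ('a \<Rightarrow> 'a) \<Rightarrow> 'a \<Rightarrow> 'a \<Rightarrow> 'k)"
  have M: "carrier hecke = M_set" by (simp add: biHecke_def)
  have one: "\<one>\<^bsub>hecke\<^esub> \<in> M_set" using H.one_closed by (simp only: M)
  have matrix_one: "translation_matrix w \<one>\<^bsub>hecke\<^esub> u z = (if u = z then 1 else 0)"
    if "u \<in> below w" for u z
  proof -
    have "u \<in> carrier W" by (rule below_carrier[OF that])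
    then show ?thesis using w by (auto simp: translation_matrix_def biHecke_def)
  qed
  have module: "right_module (monoid_algebra hecke) T"
    unfolding T_def
  proof (rule H.right_module_matrix_module[OF finite_below])
    fix f g u z
    assume "f \<in> carrier hecke" "g \<in> carrier hecke" "u \<in> below w"
    then show "translation_matrix w (f \<otimes>\<^bsub>hecke\<^esub> g) u z =
        (\<Sum>t\<in>below w. translation_matrix w f u t * (translation_matrix w g t z :: 'k))"
      using translation_matrix_mult[OF w, of u f g z] by (simp add: biHecke_def)
  qed (rule matrix_one)
  have single_act: "(single f c \<odot>\<^bsub>T\<^esub> v) z =
      (if z \<in> below w then \<Sum>u\<in>below w. v u * (c * translation_matrix w f u z) else 0)"
    if "f \<in> M_set" for f c v z
  proof -
    have "(\<Sum>g\<in>M_set. single f c g * translation_matrix w g u z) = c * translation_matrix w f u z" for u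
    proof -
      have "(\<Sum>g\<in>M_set. single f c g * translation_matrix w g u z) =
          (\<Sum>g\<in>M_set. if g = f then c * translation_matrix w f u z else 0)"
        by (intro sum.cong) (auto simp: single_def)
      then show ?thesis using that finite_M_set by simp
    qed
    then show ?thesis by (simp add: T_def H.matrix_module_def M)
  qed
  have basis_act: "single f 1 \<odot>\<^bsub>T\<^esub> single u 1 =
      (if f (longest \<otimes> inv w \<otimes> u) = longest \<otimes> inv w \<otimes> f u then single (f u) 1 else (\<lambda>_. 0))"
    if f: "f \<in> M_set" and u: "u \<in> below w" for f u
  proof
    fix z
    have "(single f 1 \<odot>\<^bsub>T\<^esub> single u 1) z = (if z \<in> below w then
        \<Sum>t\<in>below w. if t = u then translation_matrix w f u z else 0 else 0)"
      unfolding single_act[OF f] by (intro if_cong sum.cong HOL.refl) (auto simp: single_def)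
    also have "\<dots> = (if z \<in> below w then translation_matrix w f u z else 0)"
      using u finite_below by simp
    finally show "(single f 1 \<odot>\<^bsub>T\<^esub> single u 1) z = (if f (longest \<otimes> inv w \<otimes> u) =
        longest \<otimes> inv w \<otimes> f u then single (f u) 1 else (\<lambda>_. 0)) z"
      using translation_matrix_stays_below[OF w u f]
      by (auto simp: translation_matrix_def single_def)
  qed
  have "translation_module W I s w T"
    unfolding translation_module_def
  proof (intro conjI ballI allI)
    show "carrier T = translation_space W I s w"
      by (simp add: T_def H.matrix_module_def translation_space_def)
    show "v \<oplus>\<^bsub>T\<^esub> v' = (\<lambda>u. v u + v' u)" for v v'
      by (simp add: T_def H.matrix_module_def)
  next
    fix c and v :: "'a \<Rightarrow> 'k" assume v: "v \<in> carrier T"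
    show "single \<one>\<^bsub>hecke\<^esub> c \<odot>\<^bsub>T\<^esub> v = (\<lambda>u. c * v u)"
    proof
      fix z
      have "(\<Sum>u\<in>below w. v u * (c * translation_matrix w \<one>\<^bsub>hecke\<^esub> u z)) =
          (\<Sum>u\<in>below w. if u = z then c * v z else 0)"
        by (intro sum.cong HOL.refl) (simp add: matrix_one)
      then show "(single \<one>\<^bsub>hecke\<^esub> c \<odot>\<^bsub>T\<^esub> v) z = c * v z"
        using v finite_below unfolding single_act[OF one]
        by (simp add: T_def H.matrix_module_def)
    qed
  next
    fix i u assume i: "i \<in> I" and u: "u \<in> below w"
    have uc: "u \<in> carrier W" by (rule below_carrier[OF u])
    show "single (up i) 1 \<odot>\<^bsub>T\<^esub> single u 1 = (if i \<in> descents u then single u 1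
        else if u \<otimes> s i \<in> below w then single (u \<otimes> s i) 1 else (\<lambda>_. 0))"
      using basis_act[OF up_in_M_set[OF i] u] generator_translation_condition[OF w u i, of "up i"] uc
      by (simp add: up_apply)
    show "single (down i) 1 \<odot>\<^bsub>T\<^esub> single u 1 =
        (if i \<in> descents u \<and> u \<otimes> s i \<in> below w then single (u \<otimes> s i) 1
         else if i \<notin> descents u \<and> u \<otimes> s i \<in> below w then single u 1 else (\<lambda>_. 0))"
      using basis_act[OF down_in_M_set[OF i] u] generator_translation_condition[OF w u i, of "down i"]
        uc below_mult_descent[OF w u, of i]
      by (simp add: down_apply)
  qed (rule module)
  then show ?thesis by blast
qed

end

section \<open>Translation modules are local\<close>

locale translation_rep = coxeter_system W I s
  for W :: "('a, 'b) monoid_scheme" (structure) and I :: "'i set" and s :: "'i \<Rightarrow> 'a" +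
  fixes w :: 'a and T :: "(('a \<Rightarrow> 'a) \<Rightarrow> 'k::field, 'a \<Rightarrow> 'k) module"
  assumes w: "w \<in> carrier W" and translation: "translation_module W I s w T"
begin

abbreviation algebra :: "(('a \<Rightarrow> 'a) \<Rightarrow> 'k) ring" where
  "algebra \<equiv> monoid_algebra hecke"

sublocale T: right_module algebra T
  using translation by (simp add: translation_module_def)

lemma carrier_T: "carrier T = {v. \<forall>u. u \<notin> below w \<longrightarrow> v u = 0}"
  using translation by (simp add: translation_module_def translation_space_def)

lemma add_T: "v \<in> carrier T \<Longrightarrow> v' \<in> carrier T \<Longrightarrow> v \<oplus>\<^bsub>T\<^esub> v' = (\<lambda>u. v u + v' u)"
  using translation by (simp add: translation_module_def)

lemma scalar_T: "v \<in> carrier T \<Longrightarrow> single \<one>\<^bsub>hecke\<^esub> c \<odot>\<^bsub>T\<^esub> v = (\<lambda>u. c * v u)"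
  using translation by (simp add: translation_module_def)

lemma single_in_T: "u \<in> below w \<Longrightarrow> single u c \<in> carrier T"
  by (auto simp: carrier_T single_def)

lemma algebra_single: "f \<in> M_set \<Longrightarrow> single f c \<in> carrier algebra"
  using finite_monoid.single_in_monoid_algebra[OF finite_monoid_biHecke, of f c]
  by (simp add: biHecke_def)

lemma one_in_M_set: "\<one>\<^bsub>hecke\<^esub> \<in> M_set"
  using monoid.one_closed[OF monoid_biHecke] by (simp add: biHecke_def)

lemma zero_T: "\<zero>\<^bsub>T\<^esub> = (\<lambda>_. 0)"
  using scalar_T[of "\<zero>\<^bsub>T\<^esub>" 0] T.smult_zero[OF algebra_single[OF one_in_M_set, of 0]] by simp

lemma smult_single_compose:
  assumes "f \<in> M_set" "g \<in> M_set" "v \<in> carrier T"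
  shows "single (compose (carrier W) g f) (c * d) \<odot>\<^bsub>T\<^esub> v = single g d \<odot>\<^bsub>T\<^esub> (single f c \<odot>\<^bsub>T\<^esub> v)"
proof -
  have e: "single f c \<otimes>\<^bsub>algebra\<^esub> single g d = single (compose (carrier W) g f) (c * d)"
    using finite_monoid.single_mult_single[OF finite_monoid_biHecke, of f g c d] assms
    by (simp add: biHecke_def)
  show ?thesis
    using T.smult_assoc_right[OF algebra_single[OF assms(1), of c] algebra_single[OF assms(2), of d] assms(3)]
    by (simp only: e)
qed

lemma smult_single_split:
  assumes f: "f \<in> M_set" and v: "v \<in> carrier T"
  shows "single f c \<odot>\<^bsub>T\<^esub> v = single \<one>\<^bsub>hecke\<^esub> c \<odot>\<^bsub>T\<^esub> (single f 1 \<odot>\<^bsub>T\<^esub> v)"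
    and "single f c \<odot>\<^bsub>T\<^esub> v = single f 1 \<odot>\<^bsub>T\<^esub> (single \<one>\<^bsub>hecke\<^esub> c \<odot>\<^bsub>T\<^esub> v)"
proof -
  have fc: "f \<in> carrier hecke" using f by (simp add: biHecke_def)
  have "compose (carrier W) \<one>\<^bsub>hecke\<^esub> f = f" "compose (carrier W) f \<one>\<^bsub>hecke\<^esub> = f"
    using monoid.r_one[OF monoid_biHecke fc] monoid.l_one[OF monoid_biHecke fc]
    by (simp_all add: biHecke_def)
  then show "single f c \<odot>\<^bsub>T\<^esub> v = single \<one>\<^bsub>hecke\<^esub> c \<odot>\<^bsub>T\<^esub> (single f 1 \<odot>\<^bsub>T\<^esub> v)"
    "single f c \<odot>\<^bsub>T\<^esub> v = single f 1 \<odot>\<^bsub>T\<^esub> (single \<one>\<^bsub>hecke\<^esub> c \<odot>\<^bsub>T\<^esub> v)"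
    using smult_single_compose[OF f one_in_M_set v, of 1 c]
      smult_single_compose[OF one_in_M_set f v, of c 1] by simp_all
qed

text \<open>
  The coordinate at \<open>z\<close> collects the coordinates at the preimages of \<open>z\<close>, which are \<open>z\<close> itself and
  \<open>z s\<^sub>k\<close> or none.
\<close>

definition up_vec :: "'i \<Rightarrow> ('a \<Rightarrow> 'k) \<Rightarrow> 'a \<Rightarrow> 'k" where
  "up_vec k v z = (if z \<in> below w \<and> k \<in> descents z then v z + v (z \<otimes> s k) else 0)"

definition down_vec :: "'i \<Rightarrow> ('a \<Rightarrow> 'k) \<Rightarrow> 'a \<Rightarrow> 'k" where
  "down_vec k v z =
     (if z \<in> below w \<and> k \<notin> descents z \<and> z \<otimes> s k \<in> below w then v z + v (z \<otimes> s k) else 0)"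

lemma carrier_T_induct [consumes 1, case_names zero add_basis]:
  assumes v: "v \<in> carrier T" and zero: "P (\<lambda>_. 0)"
    and step: "\<And>v c u. v \<in> carrier T \<Longrightarrow> P v \<Longrightarrow> u \<in> below w \<Longrightarrow> P (\<lambda>z. v z + c * single u 1 z)"
  shows "P v"
proof -
  have "\<forall>v\<in>carrier T. (\<forall>u. u \<notin> B \<longrightarrow> v u = 0) \<longrightarrow> P v" if "finite B" "B \<subseteq> below w" for B
    using that
  proof (induction B)
    case empty
    have "P v" if "\<forall>u. v u = 0" for v
    proof -
      have "v = (\<lambda>_. 0)" using that by auto
      then show ?thesis using zero by simp
    qed
    then show ?case by simp
  next
    case (insert x B)
    show ?case
    proof (intro ballI impI)
      fix v assume v: "v \<in> carrier T" "\<forall>u. u \<notin> insert x B \<longrightarrow> v u = 0"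
      define v' where "v' = v(x := 0)"
      have v': "v' \<in> carrier T" using v(1) by (auto simp: v'_def carrier_T)
      have "P v'" using insert v v' by (auto simp: v'_def)
      then have "P (\<lambda>z. v' z + v x * single x 1 z)" using step v' insert.prems by simp
      moreover have "(\<lambda>z. v' z + v x * single x 1 z) = v" by (auto simp: v'_def single_def)
      ultimately show "P v" by (simp only:)
    qed
  qed
  from this[OF finite_below] v show ?thesis by (auto simp: carrier_T)
qed

text \<open>Scalars are central in the algebra, so both sides are linear in \<open>v\<close>.\<close>

lemma smult_eq_operator:
  assumes f: "f \<in> M_set" and v: "v \<in> carrier T"
    and lin: "\<And>v v' c. F (\<lambda>z. v z + c * v' z) = (\<lambda>z. F v z + c * F v' z)"
    and basis: "\<And>u. u \<in> below w \<Longrightarrow> single f 1 \<odot>\<^bsub>T\<^esub> single u 1 = F (single u 1)"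
  shows "single f 1 \<odot>\<^bsub>T\<^esub> v = F v"
  using v
proof (induction rule: carrier_T_induct)
  case zero
  have "F (\<lambda>_. 0) = (\<lambda>_. 0)" using lin[of "\<lambda>_. 0" "-1" "\<lambda>_. 0"] by (simp add: fun_eq_iff)
  then show ?case using T.smult_zero[OF algebra_single[OF f]] by (simp add: zero_T)
next
  case (add_basis v c u)
  have u: "single u 1 \<in> carrier T" by (rule single_in_T[OF add_basis.hyps(2)])
  have cu: "(\<lambda>z. c * single u 1 z) \<in> carrier T" using u by (simp add: carrier_T)
  have fu: "F (single u 1) \<in> carrier T" using T.smult_closed[OF algebra_single[OF f, of 1] u] basis[OF add_basis.hyps(2)] by simp
  have Fv: "F v \<in> carrier T" using T.smult_closed[OF algebra_single[OF f, of 1] add_basis.hyps(1)] add_basis.IH by simp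
  have "(\<lambda>z. v z + c * single u 1 z) = v \<oplus>\<^bsub>T\<^esub> (\<lambda>z. c * single u 1 z)"
    using add_T[OF add_basis.hyps(1) cu] by simp
  then have "single f 1 \<odot>\<^bsub>T\<^esub> (\<lambda>z. v z + c * single u 1 z) =
      single f 1 \<odot>\<^bsub>T\<^esub> v \<oplus>\<^bsub>T\<^esub> single f 1 \<odot>\<^bsub>T\<^esub> (\<lambda>z. c * single u 1 z)"
    using T.smult_r_distr[OF algebra_single[OF f] add_basis.hyps(1) cu] by simp
  also have "single f 1 \<odot>\<^bsub>T\<^esub> (\<lambda>z. c * single u 1 z) = (\<lambda>z. c * F (single u 1) z)"
    using smult_single_split[OF f u, of c] scalar_T[OF u] scalar_T[OF fu] basis[OF add_basis.hyps(2)]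
    by simp
  also have "single f 1 \<odot>\<^bsub>T\<^esub> v \<oplus>\<^bsub>T\<^esub> (\<lambda>z. c * F (single u 1) z) =
      (\<lambda>z. F v z + c * F (single u 1) z)"
    unfolding add_basis.IH using Fv fu by (intro add_T) (auto simp: carrier_T)
  finally show ?case unfolding lin .
qed

lemma up_vec_linear: "up_vec k (\<lambda>z. v z + c * v' z) = (\<lambda>z. up_vec k v z + c * up_vec k v' z)"
  and down_vec_linear: "down_vec k (\<lambda>z. v z + c * v' z) = (\<lambda>z. down_vec k v z + c * down_vec k v' z)"
  by (auto simp: up_vec_def down_vec_def algebra_simps)

lemma mult_s_eq_iff: "z \<in> carrier W \<Longrightarrow> u \<in> carrier W \<Longrightarrow> k \<in> I \<Longrightarrow> z \<otimes> s k = u \<longleftrightarrow> z = u \<otimes> s k"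
  by auto

lemma up_vec_single:
  assumes u: "u \<in> below w" and k: "k \<in> I"
  shows "up_vec k (single u 1) = (if k \<in> descents u then single u 1
    else if u \<otimes> s k \<in> below w then single (u \<otimes> s k) 1 else (\<lambda>_. 0))"
proof
  fix z
  have uc: "u \<in> carrier W" by (rule below_carrier[OF u])
  have zc: "z \<in> below w \<Longrightarrow> z \<in> carrier W" by (rule below_carrier)
  show "up_vec k (single u 1) z = (if k \<in> descents u then single u 1
      else if u \<otimes> s k \<in> below w then single (u \<otimes> s k) 1 else (\<lambda>_. 0)) z"
    using descents_mult_s[OF uc k] mult_s_eq_iff[OF _ uc k, of z] zc u
    by (auto simp: up_vec_def single_def)
qed

lemma down_vec_single:
  assumes u: "u \<in> below w" and k: "k \<in> I"
  shows "down_vec k (single u 1) =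
    (if k \<in> descents u \<and> u \<otimes> s k \<in> below w then single (u \<otimes> s k) 1
     else if k \<notin> descents u \<and> u \<otimes> s k \<in> below w then single u 1 else (\<lambda>_. 0))"
proof
  fix z
  have uc: "u \<in> carrier W" by (rule below_carrier[OF u])
  have zc: "z \<in> below w \<Longrightarrow> z \<in> carrier W" by (rule below_carrier)
  show "down_vec k (single u 1) z =
      (if k \<in> descents u \<and> u \<otimes> s k \<in> below w then single (u \<otimes> s k) 1
       else if k \<notin> descents u \<and> u \<otimes> s k \<in> below w then single u 1 else (\<lambda>_. 0)) z"
    using descents_mult_s[OF uc k] mult_s_eq_iff[OF _ uc k, of z] zc u uc k
    by (auto simp: down_vec_def single_def)
qed

lemma smult_up:
  assumes v: "v \<in> carrier T" and k: "k \<in> I" shows "single (up k) 1 \<odot>\<^bsub>T\<^esub> v = up_vec k v"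
proof (rule smult_eq_operator[OF up_in_M_set[OF k] v up_vec_linear])
  fix u assume u: "u \<in> below w"
  then show "single (up k) 1 \<odot>\<^bsub>T\<^esub> single u 1 = up_vec k (single u 1)"
    using translation k unfolding translation_module_def up_vec_single[OF u k] by blast
qed

lemma smult_down:
  assumes v: "v \<in> carrier T" and k: "k \<in> I" shows "single (down k) 1 \<odot>\<^bsub>T\<^esub> v = down_vec k v"
proof (rule smult_eq_operator[OF down_in_M_set[OF k] v down_vec_linear])
  fix u assume u: "u \<in> below w"
  then show "single (down k) 1 \<odot>\<^bsub>T\<^esub> single u 1 = down_vec k (single u 1)"
    using translation k unfolding translation_module_def down_vec_single[OF u k] by blast
qed

text \<open>
  The operators generate the monoid, and the monoid spans the algebra.
\<close>

lemma translation_submoduleI: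
  assumes sub: "N \<subseteq> carrier T" and zero: "(\<lambda>_. 0) \<in> N"
    and lin: "\<And>v v' c. v \<in> N \<Longrightarrow> v' \<in> N \<Longrightarrow> (\<lambda>u. v u + c * v' u) \<in> N"
    and up: "\<And>k v. k \<in> I \<Longrightarrow> v \<in> N \<Longrightarrow> up_vec k v \<in> N"
    and down: "\<And>k v. k \<in> I \<Longrightarrow> v \<in> N \<Longrightarrow> down_vec k v \<in> N"
  shows "submodule N algebra T"
proof (rule T.submoduleI[OF sub])
  have smult1: "single f 1 \<odot>\<^bsub>T\<^esub> v \<in> N" if f: "f \<in> M_set" and v: "v \<in> N" for f v
    using f
  proof (induction rule: M_set_induct)
    case one
    have "\<one>\<^bsub>hecke\<^esub> = (\<lambda>w\<in>carrier W. w)" by (simp add: biHecke_def)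
    then show ?case using scalar_T[of v 1] v sub by (auto simp del: restrict_apply)
  next
    case (generator f g i)
    have g: "g \<in> M_set" using generator.hyps(2,3) up_in_M_set down_in_M_set by blast
    have c: "single f 1 \<odot>\<^bsub>T\<^esub> v \<in> carrier T" using generator.IH sub by auto
    have "single (compose (carrier W) g f) 1 \<odot>\<^bsub>T\<^esub> v = single g 1 \<odot>\<^bsub>T\<^esub> (single f 1 \<odot>\<^bsub>T\<^esub> v)"
      using smult_single_compose[OF generator.hyps(1) g, of v 1 1] v sub by auto
    then show ?case
      using smult_up[OF c generator.hyps(2)] smult_down[OF c generator.hyps(2)] generator.hyps(3)
        up[OF generator.hyps(2) generator.IH] down[OF generator.hyps(2) generator.IH] by auto
  qed
  have scal: "(\<lambda>u. c * v u) \<in> N" if "v \<in> N" for c v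
    using lin[OF zero that, of c] by simp
  have smult_single: "single f c \<odot>\<^bsub>T\<^esub> v \<in> N" if f: "f \<in> M_set" and v: "v \<in> N" for f c v
  proof -
    have vc: "v \<in> carrier T" using v sub by auto
    have N: "single f 1 \<odot>\<^bsub>T\<^esub> v \<in> N" by (rule smult1[OF f v])
    then have "single f 1 \<odot>\<^bsub>T\<^esub> v \<in> carrier T" using sub by auto
    then show ?thesis using smult_single_split(1)[OF f vc, of c] scalar_T scal[OF N, of c] by simp
  qed
  show add: "x \<oplus>\<^bsub>T\<^esub> y \<in> N" if "x \<in> N" "y \<in> N" for x y
    using lin[OF that, of 1] add_T[of x y] that sub by (simp add: subset_iff)
  show "\<zero>\<^bsub>T\<^esub> \<in> N" using zero by (simp add: zero_T)
  have M: "carrier hecke = M_set" by (simp add: biHecke_def)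
  fix a v assume a: "a \<in> carrier algebra" and v: "v \<in> N"
  have vc: "v \<in> carrier T" using v sub by auto
  note alg = finite_monoid.monoid_algebra_carrier[OF finite_monoid_biHecke]
  have "\<forall>a\<in>carrier algebra. (\<forall>f. f \<notin> B \<longrightarrow> a f = 0) \<longrightarrow> a \<odot>\<^bsub>T\<^esub> v \<in> N"
    if "finite B" "B \<subseteq> M_set" for B
    using that
  proof (induction B)
    case empty
    have "a \<odot>\<^bsub>T\<^esub> v \<in> N" if "\<forall>f. a f = 0" for a
    proof -
      have "a = \<zero>\<^bsub>algebra\<^esub>"
        unfolding finite_monoid.monoid_algebra_zero[OF finite_monoid_biHecke] using that by blast
      then show ?thesis using T.zero_smult[OF vc] zero by (simp add: zero_T)
    qed
    then show ?case by simp
  next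
    case (insert f B)
    show ?case
    proof (intro ballI impI)
      fix a assume a: "a \<in> carrier algebra" "\<forall>g. g \<notin> insert f B \<longrightarrow> a g = 0"
      define a' where "a' = a(f := 0)"
      have a': "a' \<in> carrier algebra" using a(1) by (auto simp: a'_def alg)
      have f: "f \<in> M_set" using insert by simp
      have "a' \<oplus>\<^bsub>algebra\<^esub> single f (a f) = a"
        unfolding finite_monoid.monoid_algebra_add[OF finite_monoid_biHecke]
        by (auto simp: a'_def single_def)
      then have "a \<odot>\<^bsub>T\<^esub> v = a' \<odot>\<^bsub>T\<^esub> v \<oplus>\<^bsub>T\<^esub> single f (a f) \<odot>\<^bsub>T\<^esub> v"
        using T.smult_l_distr[OF a' algebra_single[OF f, of "a f"] vc] by (simp only:)
      moreover have "a' \<odot>\<^bsub>T\<^esub> v \<in> N" using insert a a' by (auto simp: a'_def)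
      ultimately show "a \<odot>\<^bsub>T\<^esub> v \<in> N" using add smult_single[OF f v] by simp
    qed
  qed
  note all = this[OF finite_M_set subset_refl]
  have "\<forall>f. f \<notin> M_set \<longrightarrow> a f = 0" using iffD1[OF alg a] unfolding M .
  then show "a \<odot>\<^bsub>T\<^esub> v \<in> N" using all a by (simp only: Ball_def simp_thms)
qed

lemma submodule_up: "submodule N algebra T \<Longrightarrow> v \<in> N \<Longrightarrow> k \<in> I \<Longrightarrow> up_vec k v \<in> N"
  using T.submodule_smult[OF _ algebra_single[OF up_in_M_set], of N k v 1] T.submodule_carrier[of N v]
  by (simp add: smult_up)

lemma submodule_down: "submodule N algebra T \<Longrightarrow> v \<in> N \<Longrightarrow> k \<in> I \<Longrightarrow> down_vec k v \<in> N"
  using T.submodule_smult[OF _ algebra_single[OF down_in_M_set], of N k v 1] T.submodule_carrier[of N v]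
  by (simp add: smult_down)

lemma submodule_scalar: "submodule N algebra T \<Longrightarrow> v \<in> N \<Longrightarrow> (\<lambda>u. c * v u) \<in> N"
  using T.submodule_smult[OF _ algebra_single[OF one_in_M_set], of N v c] T.submodule_carrier[of N v]
  by (simp add: scalar_T)

lemma submodule_add_pointwise:
  "submodule N algebra T \<Longrightarrow> v \<in> N \<Longrightarrow> v' \<in> N \<Longrightarrow> (\<lambda>u. v u + v' u) \<in> N"
  using T.submodule_add[of N v v'] add_T[of v v'] T.submodule_carrier[of N] by simp

lemma up_word_single:
  assumes "a \<in> lists I" "\<ell> (word a) = length a" "word a \<in> below w"
  shows "fold up_vec a (single \<one> 1) = single (word a) 1"
  using assms
proof (induction a rule: rev_induct)
  case (snoc k a)
  have a: "a \<in> lists I" and k: "k \<in> I" using snoc by auto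
  have ac: "word a \<in> carrier W" using a by simp
  have wk: "word (a @ [k]) = word a \<otimes> s k" using a k by simp
  have la: "\<ell> (word a) = length a"
    using len_le[OF a] len_mult_s[OF ac k] snoc(3) wk by auto
  have asc: "k \<notin> descents (word a)" using la snoc(3) wk by (simp add: descents_iff)
  have "k \<in> descents (word a \<otimes> s k)" using descents_mult_s[OF ac k] asc by simp
  then have b: "word a \<in> below w"
    using below_mult_descent[OF w, of "word a \<otimes> s k" k] snoc(4) wk ac k by simp
  show ?case using snoc.IH[OF a la b] up_vec_single[OF b k] asc snoc(4) wk by simp
qed simp

lemma submodule_fold_up:
  "submodule N algebra T \<Longrightarrow> v \<in> N \<Longrightarrow> a \<in> lists I \<Longrightarrow> fold up_vec a v \<in> N"
proof (induction a arbitrary: v rule: list.induct)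
  case (Cons k a)
  then show ?case using submodule_up[of N v k] by simp
qed simp

lemma submodule_one_of_basis:
  assumes N: "submodule N algebra T"
  shows "u \<in> below w \<Longrightarrow> single u 1 \<in> N \<Longrightarrow> single \<one> 1 \<in> N"
proof (induction "\<ell> u" arbitrary: u rule: less_induct)
  case less
  have uc: "u \<in> carrier W" by (rule below_carrier[OF less(2)])
  show ?case
  proof (cases "u = \<one>")
    case False
    then obtain k where k: "k \<in> descents u" using exists_descent[OF uc] by blast
    have kI: "k \<in> I" using k by (simp add: descents_iff)
    have b: "u \<otimes> s k \<in> below w" by (rule below_mult_descent[OF w less(2) k])
    have "down_vec k (single u 1) = single (u \<otimes> s k) 1"
      using down_vec_single[OF less(2) kI] k b by simp
    then have "single (u \<otimes> s k) 1 \<in> N" using submodule_down[OF N less(3) kI] by simp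
    then show ?thesis using less(1)[OF _ b] descent_len[OF uc k] by simp
  qed (use less in simp)
qed

text \<open>
  The operators \<open>down\<close> lead from \<open>u\<close> to the identity element of the group, and from there the
  operators \<open>up\<close> lead to all elements of the interval.
\<close>

lemma submodule_eq_carrier_of_basis:
  assumes N: "submodule N algebra T" and u: "u \<in> below w" "single u 1 \<in> N"
  shows "N = carrier T"
proof
  show "N \<subseteq> carrier T" using T.submodule_carrier[OF N] by blast
  have one: "single \<one> 1 \<in> N" by (rule submodule_one_of_basis[OF N u])
  have basis: "single z 1 \<in> N" if z: "z \<in> below w" for z
  proof -
    obtain a where a: "a \<in> lists I" "word a = z" "length a = \<ell> z"
      using reduced_word_exists[OF below_carrier[OF z]] .
    then show ?thesis using submodule_fold_up[OF N one a(1)] up_word_single[of a] z by simp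
  qed
  show "carrier T \<subseteq> N"
  proof
    fix v assume "v \<in> carrier T"
    then show "v \<in> N"
    proof (induction rule: carrier_T_induct)
      case zero
      then show ?case using T.submodule_zero[OF N] by (simp add: zero_T)
    next
      case (add_basis v c u)
      then show ?case
        using submodule_add_pointwise[OF N add_basis.IH submodule_scalar[OF N basis[OF add_basis.hyps(2)], of c]]
        by simp
    qed
  qed
qed

text \<open>
  Going up from \<open>1\<close> along the word \<open>a\<close> leads to \<open>word a\<close>.  Every \<open>t\<close> is the product of \<open>t\<close> and \<open>1\<close>, and
  the operators preserve products without loss of length, so going up from \<open>t\<close> leads to a
  product of some element and \<open>word a\<close>.
\<close>

lemma support_fold_up:
  assumes v: "v \<in> carrier T" and "a \<in> lists I" "\<ell> (word a) = length a" "fold up_vec a v z \<noteq> 0"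
  shows "z \<in> below w \<and> \<ell> (z \<otimes> inv (word a)) + \<ell> (word a) = \<ell> z"
  using assms(2-4)
proof (induction a arbitrary: z rule: rev_induct)
  case Nil
  then have "z \<in> below w" using v by (auto simp: carrier_T)
  then show ?case using below_carrier by simp
next
  case (snoc k a)
  have a: "a \<in> lists I" and k: "k \<in> I" using snoc by auto
  define x where "x = word a"
  have x: "x \<in> carrier W" using a by (simp add: x_def)
  have wk: "word (a @ [k]) = x \<otimes> s k" using a k by (simp add: x_def)
  have lx: "\<ell> x = length a"
    using len_le[OF a] len_mult_s[OF x k] snoc(3) wk by (auto simp: x_def)
  have asc: "k \<notin> descents x" using lx snoc(3) wk by (simp add: descents_iff)
  define v' where "v' = fold up_vec a v"
  have nz: "up_vec k v' z \<noteq> 0" using snoc(4) by (simp add: v'_def)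
  then have z: "z \<in> below w" "k \<in> descents z" by (auto simp: up_vec_def split: if_splits)
  have zc: "z \<in> carrier W" by (rule below_carrier[OF z(1)])
  have "v' z \<noteq> 0 \<or> v' (z \<otimes> s k) \<noteq> 0" using nz z by (auto simp: up_vec_def)
  then obtain t where t: "v' t \<noteq> 0" "t = z \<or> t = z \<otimes> s k" by blast
  have tb: "t \<in> below w" "\<ell> (t \<otimes> inv x) + \<ell> x = \<ell> t"
    using snoc.IH[OF a _ t(1)[unfolded v'_def]] lx by (simp_all add: x_def)
  have tc: "t \<in> carrier W" by (rule below_carrier[OF tb(1)])
  have up: "up k t = z" using t(2) z zc descents_mult_s[OF zc k] k by (auto simp: up_apply)
  define y where "y = t \<otimes> inv x"
  have y: "y \<in> carrier W" "y \<otimes> x = t" using tc x by (simp_all add: y_def m_assoc)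
  have "\<ell> (y \<otimes> x) = \<ell> y + \<ell> x" using tb(2) y by (simp add: y_def)
  from generator_preserves_product[OF y(1) x k this, of "up k"] obtain y'
    where y': "y' \<in> carrier W" "up k (y \<otimes> x) = y' \<otimes> up k x"
      "\<ell> (y' \<otimes> up k x) = \<ell> y' + \<ell> (up k x)" by blast
  have "up k x = x \<otimes> s k" using asc x by (simp add: up_apply)
  then have "z = y' \<otimes> (x \<otimes> s k)" "\<ell> z = \<ell> y' + \<ell> (x \<otimes> s k)" using y' up y by simp_all
  moreover have "y' \<otimes> (x \<otimes> s k) \<otimes> inv (x \<otimes> s k) = y'" using y' x k by (simp add: m_assoc)
  ultimately show ?case using z(1) unfolding wk by simp
qed

definition top_word :: "'i list" where
  "top_word = (SOME a. a \<in> lists I \<and> word a = w \<and> length a = \<ell> w)"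

lemma top_word: "top_word \<in> lists I" "word top_word = w" "length top_word = \<ell> w"
proof -
  have "\<exists>a. a \<in> lists I \<and> word a = w \<and> length a = \<ell> w" using reduced_word_exists[OF w] by metis
  from someI_ex[OF this]
  show "top_word \<in> lists I" "word top_word = w" "length top_word = \<ell> w"
    by (simp_all add: top_word_def)
qed

text \<open>The coordinate at \<open>w\<close> after going up along a reduced word of \<open>w\<close>.\<close>

definition top_functional :: "('a \<Rightarrow> 'k) \<Rightarrow> 'k" where
  "top_functional v = fold up_vec top_word v w"

lemma fold_up_linear:
  "fold up_vec a (\<lambda>z. v z + c * v' z) = (\<lambda>z. fold up_vec a v z + c * fold up_vec a v' z)"
  by (induction a arbitrary: v v') (simp_all add: up_vec_linear)

lemma top_functional_linear:
  "top_functional (\<lambda>z. v z + c * v' z) = top_functional v + c * top_functional v'"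
  by (simp add: top_functional_def fold_up_linear)

lemma top_functional_one: "top_functional (single \<one> 1) = 1"
  using up_word_single[of top_word] top_word self_below[OF w]
  by (simp add: top_functional_def single_def)

text \<open>
  A product of some element and \<open>w\<close> without loss of length that is also below \<open>w\<close> must be \<open>w\<close>.
  So going up along a reduced word of \<open>w\<close> has rank one.
\<close>

lemma fold_up_top_word:
  assumes "v \<in> carrier T"
  shows "fold up_vec top_word v = (\<lambda>z. top_functional v * single w 1 z)"
proof
  fix z
  have "z = w" if nz: "fold up_vec top_word v z \<noteq> 0"
  proof -
    have z: "z \<in> below w" "\<ell> (z \<otimes> inv w) + \<ell> w = \<ell> z"
      using support_fold_up[OF assms top_word(1) _ nz] top_word by simp_all
    have zc: "z \<in> carrier W" by (rule below_carrier[OF z(1)])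
    have "\<ell> (inv z \<otimes> w) = 0" using z w by (simp add: below_iff)
    then have "inv z \<otimes> w = \<one>" using len_eq_0[of "inv z \<otimes> w"] zc w by simp
    then have "z \<otimes> (inv z \<otimes> w) = z" using zc by simp
    then show ?thesis using zc w by simp
  qed
  then show "fold up_vec top_word v z = top_functional v * single w 1 z"
    by (auto simp: top_functional_def single_def)
qed

lemma submodule_eq_carrier:
  assumes N: "submodule N algebra T" and v: "v \<in> N" "top_functional v \<noteq> 0"
  shows "N = carrier T"
proof -
  have "fold up_vec top_word v \<in> N" by (rule submodule_fold_up[OF N v(1) top_word(1)])
  then have "(\<lambda>z. top_functional v * single w 1 z) \<in> N"
    using fold_up_top_word[OF T.submodule_carrier[OF N v(1)]] by simp
  from submodule_scalar[OF N this, of "inverse (top_functional v)"]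
  have "(\<lambda>z. single w 1 z) \<in> N" using v(2) by (simp add: mult.assoc[symmetric])
  then show ?thesis using submodule_eq_carrier_of_basis[OF N self_below[OF w]] by simp
qed

lemma local_T: "local_module algebra T"
  unfolding local_module_def
proof (intro conjI allI impI T.right_module_axioms)
  fix A B assume AB: "submodule A algebra T \<and> submodule B algebra T \<and> A <+>\<^bsub>T\<^esub> B = carrier T"
  have "single \<one> 1 \<in> A <+>\<^bsub>T\<^esub> B" using AB single_in_T[OF one_below[OF w]] by simp
  then obtain a b where ab: "a \<in> A" "b \<in> B" "single \<one> 1 = a \<oplus>\<^bsub>T\<^esub> b"
    by (auto simp: set_add_mem_iff)
  have "a \<in> carrier T" "b \<in> carrier T" using ab AB T.submodule_carrier by auto
  then have "single \<one> 1 = (\<lambda>z. a z + 1 * b z)" using ab(3) add_T by simp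
  then have "top_functional a + 1 * top_functional b = 1"
    using top_functional_linear[of a 1 b] top_functional_one by simp
  then have "top_functional a \<noteq> 0 \<or> top_functional b \<noteq> 0" by auto
  then show "A = carrier T \<or> B = carrier T" using submodule_eq_carrier ab AB by blast
qed

lemma T_nonzero: "carrier T \<noteq> {\<zero>\<^bsub>T\<^esub>}"
proof -
  have "single \<one> 1 \<in> carrier T" by (rule single_in_T[OF one_below[OF w]])
  moreover have "single \<one> (1::'k) \<noteq> (\<lambda>_. 0)" by (simp add: single_def fun_eq_iff)
  ultimately show ?thesis by (auto simp: zero_T)
qed

section \<open>Antisymmetric vectors of a left block\<close>

text \<open>
  The involution \<open>x m \<mapsto> x s\<^sub>i m\<close> of a coset of \<open>W\<^sub>J\<close> with minimal element \<open>m\<close>.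
\<close>

definition twist :: "'i set \<Rightarrow> 'i \<Rightarrow> 'a \<Rightarrow> 'a" where
  "twist J i u = u \<otimes> inv (min_rep W I s J u) \<otimes> s i \<otimes> min_rep W I s J u"

lemma twist_eq:
  assumes J: "J \<subseteq> I" and m: "coset_minimal J m" and x: "x \<in> par J" and i: "i \<in> J"
  shows "twist J i (x \<otimes> m) = x \<otimes> s i \<otimes> m"
proof -
  have "x \<in> carrier W" "m \<in> carrier W" "s i \<in> carrier W"
    using x m i J parabolic_carrier coset_minimal_carrier by auto
  then show ?thesis by (simp add: twist_def min_rep_eq[OF J m x] m_assoc)
qed

lemma twist_twist:
  assumes J: "J \<subseteq> I" and i: "i \<in> J" and u: "u \<in> carrier W"
  shows "twist J i (twist J i u) = u" and "twist J i u \<in> carrier W"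
proof -
  obtain x m where x: "x \<in> par J" and m: "coset_minimal J m" and e: "u = x \<otimes> m"
    using coset_minimal_exists[OF J u] .
  have c: "x \<in> carrier W" "m \<in> carrier W" "i \<in> I"
    using x m i J parabolic_carrier coset_minimal_carrier by auto
  have xi: "x \<otimes> s i \<in> par J" by (rule parabolic_mult[OF J x parabolic_s[OF i]])
  show "twist J i (twist J i u) = u" "twist J i u \<in> carrier W"
    using twist_eq[OF J m x i] twist_eq[OF J m xi i] e c by simp_all
qed

end

context translation_rep
begin

text \<open>
  In the coordinate at \<open>y\<close>, the left operator reads off the coordinate at the image of \<open>y\<close> under the
  involution, if this image is in the interval.  Otherwise it is minus the identity, and
  antisymmetry imposes no condition there.
\<close>

lemma P_sub_eq:
  assumes J: "J \<subseteq> I"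
  shows "P_sub W I s w J = {v \<in> carrier T.
    \<forall>i\<in>J. \<forall>u\<in>below w. twist J i u \<in> below w \<longrightarrow> v (twist J i u) = - (v u :: 'k)}"
proof -
  have op: "left_refl W I s w J i v y = (if y \<in> below w then
      (if twist J i y \<in> below w then v (twist J i y) else - v y) else 0)"
    if i: "i \<in> J" for i y and v :: "'a \<Rightarrow> 'k"
  proof -
    have basis: "left_refl_basis W I s w J i u =
        (if twist J i u \<in> below w then single (twist J i u) 1 else single u (- 1 :: 'k))" for u
      by (simp add: left_refl_basis_def twist_def Let_def)
    define t where "t = (if twist J i y \<in> below w then twist J i y else y)"
    have "v u * left_refl_basis W I s w J i u y =
        (if u = t then if y \<in> below w then (if twist J i y \<in> below w then v t else - v t) else 0 else 0)"
      if u: "u \<in> below w" for u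
    proof -
      have uc: "u \<in> carrier W" by (rule below_carrier[OF u])
      have tt: "twist J i (twist J i u) = u" by (rule twist_twist(1)[OF J i uc])
      show ?thesis
      proof (cases "y \<in> below w")
        case True
        then have yc: "y \<in> carrier W" by (rule below_carrier)
        have ty: "twist J i (twist J i y) = y" by (rule twist_twist(1)[OF J i yc])
        have *: "y = twist J i u \<longleftrightarrow> u = twist J i y" using tt ty by auto
        show ?thesis using True u ty tt * by (auto simp: basis t_def single_def)
      next
        case False
        then show ?thesis using u by (auto simp: basis single_def)
      qed
    qed
    then have "left_refl W I s w J i v y = (\<Sum>u\<in>below w. if u = t then
        if y \<in> below w then (if twist J i y \<in> below w then v t else - v t) else 0 else 0)"
      unfolding left_refl_def by (intro sum.cong) auto
    also have "\<dots> = (if t \<in> below w then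
        if y \<in> below w then (if twist J i y \<in> below w then v t else - v t) else 0 else 0)"
      using finite_below by simp
    finally show ?thesis by (auto simp: t_def)
  qed
  have "left_refl W I s w J i v = (\<lambda>u. - v u) \<longleftrightarrow>
      (\<forall>u\<in>below w. twist J i u \<in> below w \<longrightarrow> v (twist J i u) = - v u)"
    if "i \<in> J" "v \<in> carrier T" for i v
    using that(2) unfolding fun_eq_iff op[OF that(1)] by (auto simp: carrier_T)
  moreover have "translation_space W I s w = carrier T"
    by (simp add: carrier_T translation_space_def)
  ultimately show ?thesis unfolding P_sub_def by auto
qed

text \<open>
  Let \<open>x u\<close> be in the interval, with \<open>x\<close> in \<open>W\<^sub>J\<close> and \<open>u\<close> minimal in its coset.  If \<open>u s\<^sub>k\<close> is
  minimal, then right multiplication by \<open>s\<^sub>k\<close> commutes with the involutions and it does not depend on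
  \<open>x\<close> whether it leads out of the interval or is a descent.  Otherwise \<open>u s\<^sub>k = s\<^sub>j u\<close> with \<open>j\<close> in \<open>J\<close>,
  and an operator yields the sum of the coordinates at \<open>x u\<close> and \<open>x s\<^sub>j u\<close>, which is zero.
\<close>

lemma submodule_P_sub:
  assumes block: "left_block W I s w J"
  shows "submodule (P_sub W I s w J) algebra T"
proof -
  have J: "J \<subseteq> I" using block by (simp add: left_block_def)
  obtain x0 m K where x0: "x0 \<in> par J" and wx: "w = x0 \<otimes> m" and int: "intertwines J K m"
    using left_block_intertwines[OF w block] .
  have below: "x \<otimes> u \<in> below w \<longleftrightarrow> x \<in> below x0 \<and> u \<in> below m"
    if "x \<in> par J" "coset_minimal J u" for x u
    unfolding wx by (rule intertwines_below_iff[OF int x0 that])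
  let ?P = "P_sub W I s w J :: ('a \<Rightarrow> 'k) set"
  have anti: "v (twist J i u) = - v u"
    if "v \<in> ?P" "i \<in> J" "u \<in> below w" "twist J i u \<in> below w" for v i u
    using that unfolding P_sub_eq[OF J] by blast
  have memI: "v \<in> ?P" if "v \<in> carrier T"
    "\<And>i u. i \<in> J \<Longrightarrow> u \<in> below w \<Longrightarrow> twist J i u \<in> below w \<Longrightarrow> v (twist J i u) = - v u" for v
    unfolding P_sub_eq[OF J] using that by blast
  have PT: "v \<in> carrier T" if "v \<in> ?P" for v using that unfolding P_sub_eq[OF J] by blast
  have ops: "up_vec k v (twist J i z) = - up_vec k v z \<and> down_vec k v (twist J i z) = - down_vec k v z"
    if k: "k \<in> I" and v: "v \<in> ?P" and i: "i \<in> J" and z: "z \<in> below w" "twist J i z \<in> below w" for k v i z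
  proof -
    have zc: "z \<in> carrier W" by (rule below_carrier[OF z(1)])
    have iI: "i \<in> I" using i J by auto
    obtain x u where x: "x \<in> par J" and u: "coset_minimal J u" and e: "z = x \<otimes> u"
      using coset_minimal_exists[OF J zc] .
    have xc: "x \<in> carrier W" and uc: "u \<in> carrier W"
      using x u J parabolic_carrier coset_minimal_carrier by auto
    define x' where "x' = x \<otimes> s i"
    have x': "x' \<in> par J" unfolding x'_def by (rule parabolic_mult[OF J x parabolic_s[OF i]])
    have x'c: "x' \<in> carrier W" using x' J parabolic_carrier by simp
    have t: "twist J i z = x' \<otimes> u" unfolding e x'_def by (rule twist_eq[OF J u x i])
    have b: "x \<otimes> u \<in> below w" "x' \<otimes> u \<in> below w" using z e t by simp_all
    consider "coset_minimal J (u \<otimes> s k)" | j where "j \<in> J" "u \<otimes> s k = s j \<otimes> u"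
      using coset_minimal_mult_s[OF J u k] by blast
    then show ?thesis
    proof cases
      case 1
      have desc: "k \<in> descents (y \<otimes> u) \<longleftrightarrow> k \<in> descents u" if "y \<in> par J" for y
        using coset_minimal_len[OF J u that] coset_minimal_len[OF J 1 that] k uc
          parabolic_carrier[OF J that] by (simp add: descents_iff m_assoc)
      have mult: "y \<otimes> u \<otimes> s k = y \<otimes> (u \<otimes> s k)" if "y \<in> par J" for y
        using parabolic_carrier[OF J that] uc k by (simp add: m_assoc)
      have same: "x \<otimes> (u \<otimes> s k) \<in> below w \<longleftrightarrow> x' \<otimes> (u \<otimes> s k) \<in> below w"
        using below[OF x u] below[OF x' u] below[OF x 1] below[OF x' 1] b by blast
      have v1: "v (x' \<otimes> u) = - v (x \<otimes> u)" using anti[OF v i z] t e by simp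
      have v2: "v (x' \<otimes> (u \<otimes> s k)) = - v (x \<otimes> (u \<otimes> s k))" if "x \<otimes> (u \<otimes> s k) \<in> below w"
        using anti[OF v i that] twist_eq[OF J 1 x i] same that by (simp add: x'_def)
      have up_in: "x \<otimes> (u \<otimes> s k) \<in> below w" if "k \<in> descents u"
        using below_mult_descent[OF w b(1), of k] desc[OF x] mult[OF x] that by simp
      show ?thesis
        unfolding t unfolding e up_vec_def down_vec_def desc[OF x] desc[OF x'] mult[OF x] mult[OF x'] same[symmetric]
        using b v1 v2 up_in by auto
    next
      case 2
      have zero: "v (y \<otimes> u) + v (y \<otimes> u \<otimes> s k) = 0"
        if y: "y \<in> par J" and yb: "y \<otimes> u \<in> below w" "y \<otimes> u \<otimes> s k \<in> below w" for y
      proof -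
        have jI: "j \<in> I" using 2 J by auto
        have "y \<otimes> u \<otimes> s k = y \<otimes> (u \<otimes> s k)"
          using parabolic_carrier[OF J y] uc k by (simp add: m_assoc)
        also have "\<dots> = twist J j (y \<otimes> u)"
          unfolding twist_eq[OF J u y 2(1)] 2(2) using parabolic_carrier[OF J y] uc jI by (simp add: m_assoc)
        finally show ?thesis using anti[OF v 2(1) yb(1)] yb(2) by simp
      qed
      have "up_vec k v (y \<otimes> u) = 0 \<and> down_vec k v (y \<otimes> u) = 0"
        if y: "y \<in> par J" and yb: "y \<otimes> u \<in> below w" for y
        using zero[OF y yb] below_mult_descent[OF w yb, of k] by (auto simp: up_vec_def down_vec_def)
      then show ?thesis using x x' b unfolding t unfolding e by simp
    qed
  qed
  show ?thesis
  proof (rule translation_submoduleI)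
    show "?P \<subseteq> carrier T" using PT by blast
    show "(\<lambda>_. 0) \<in> ?P" by (rule memI) (simp_all add: carrier_T)
  next
    fix v v' c assume v: "v \<in> ?P" "v' \<in> ?P"
    show "(\<lambda>u. v u + c * v' u) \<in> ?P"
    proof (rule memI)
      show "(\<lambda>u. v u + c * v' u) \<in> carrier T" using v[THEN PT] by (simp add: carrier_T)
    next
      fix i u assume "i \<in> J" "u \<in> below w" "twist J i u \<in> below w"
      then show "v (twist J i u) + c * v' (twist J i u) = - (v u + c * v' u)"
        using anti[OF v(1)] anti[OF v(2)] by simp
    qed
  next
    fix k v assume "k \<in> I" "v \<in> ?P"
    then show "up_vec k v \<in> ?P" "down_vec k v \<in> ?P"
      using ops by (intro memI; simp add: carrier_T up_vec_def[of _ _ "z" for z] down_vec_def[of _ _ "z" for z]; blast)+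
  qed
qed

text \<open>
  For a nonempty reduced left block, \<open>w = x m\<close> with \<open>x \<noteq> 1\<close>.  Then the interval contains \<open>s\<^sub>i\<close> for the
  first letter \<open>i\<close> of \<open>x\<close>, and the basis vector of the identity is not antisymmetric.
\<close>

lemma P_sub_proper:
  assumes red: "reduced_left_block W I s w J" and ne: "J \<noteq> {}"
  shows "P_sub W I s w J \<noteq> carrier T"
proof
  assume eq: "P_sub W I s w J = carrier T"
  have block: "left_block W I s w J" using red by (simp add: reduced_left_block_def)
  have J: "J \<subseteq> I" using block by (simp add: left_block_def)
  obtain x m where x: "x \<in> par J" and m: "coset_minimal J m" and e: "w = x \<otimes> m"
    using coset_minimal_exists[OF J w] .
  have c: "x \<in> carrier W" "m \<in> carrier W" using x m J parabolic_carrier coset_minimal_carrier by auto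
  have "min_rep W I s J w = m" unfolding e by (rule min_rep_eq[OF J m x])
  moreover have "min_rep W I s {} w = w"
  proof -
    have "coset_minimal {} w"
      using w by (simp add: coset_minimal_def parabolic_words)
    then show ?thesis using min_rep_eq[of "{}" w \<one>] w parabolic_one by simp
  qed
  moreover have "min_rep W I s {} w \<noteq> min_rep W I s J w"
    using red ne unfolding reduced_left_block_def by blast
  ultimately have "x \<noteq> \<one>" using e c by auto
  obtain a where a: "a \<in> lists J" "word a = x" "length a = \<ell> x"
    using parabolic_reduced_word[OF J x] .
  then obtain i b where ib: "a = i # b" using \<open>x \<noteq> \<one>\<close> by (cases a) auto
  have i: "i \<in> J" "i \<in> I" and b: "b \<in> lists J" "b \<in> lists I" using a ib J by auto
  have bP: "word b \<in> par J" using b parabolic_words[OF J] by blast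
  have "x = s i \<otimes> word b" using a ib by simp
  then have wi: "inv (s i) \<otimes> w = word b \<otimes> m" using e b i c word_closed[OF b(2)] by (simp add: m_assoc)
  have "\<ell> (inv (s i) \<otimes> w) = \<ell> (word b) + \<ell> m"
    unfolding wi by (rule coset_minimal_len[OF J m bP])
  then have "\<ell> (inv (s i) \<otimes> w) \<le> length b + \<ell> m" using len_le[OF b(2)] by simp
  moreover have "\<ell> w = \<ell> x + \<ell> m" unfolding e by (rule coset_minimal_len[OF J m x])
  ultimately have si: "s i \<in> below w" using w i a ib by (intro belowI_le) simp_all
  have "twist J i \<one> = s i"
    using twist_eq[OF J coset_minimal_one parabolic_one i(1)] i by simp
  moreover have "single \<one> (1::'k) \<in> P_sub W I s w J"
    unfolding eq by (rule single_in_T[OF one_below[OF w]])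
  ultimately have "single \<one> (1::'k) (s i) = - single \<one> 1 \<one>"
    using i(1) si one_below[OF w] unfolding P_sub_eq[OF J] by force
  then show False using s_neq_one[OF i(2)] by (simp add: single_def)
qed

text \<open>
  The top functional vanishes on every proper submodule, and so on a sum of proper submodules.
\<close>

lemma submodule_P_sum: "submodule (P_sum W I s w) algebra T"
  and P_sum_proper: "P_sum W I s w \<noteq> carrier T"
proof -
  define B where "B = {J. J \<noteq> {} \<and> reduced_left_block W I s w J}"
  have B: "finite B"
    by (rule finite_subset[of _ "Pow I"])
      (auto simp: B_def reduced_left_block_def left_block_def finite_I)
  have sub: "submodule (P_sub W I s w J) algebra T" if "J \<in> B" for J
    using submodule_P_sub that by (simp add: B_def reduced_left_block_def)
  let ?N = "P_sum W I s w :: ('a \<Rightarrow> 'k) set"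
  have N: "v \<in> ?N \<longleftrightarrow> (\<exists>p. (\<forall>J\<in>B. p J \<in> P_sub W I s w J) \<and> v = (\<lambda>u. \<Sum>J\<in>B. p J u))" for v
    by (simp add: P_sum_def B_def Let_def)
  have PT: "p \<in> carrier T" if "p \<in> P_sub W I s w J" "J \<in> B" for p J
    using T.submodule_carrier[OF sub[OF that(2)] that(1)] .
  have op: "F v \<in> ?N" if v: "v \<in> ?N"
    and sum: "\<And>p. F (\<lambda>u. \<Sum>J\<in>B. p J u) = (\<lambda>u. \<Sum>J\<in>B. F (p J) u)"
    and closed: "\<And>J p. J \<in> B \<Longrightarrow> p \<in> P_sub W I s w J \<Longrightarrow> F p \<in> P_sub W I s w J"
    for v and F :: "('a \<Rightarrow> 'k) \<Rightarrow> 'a \<Rightarrow> 'k"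
  proof -
    obtain p where p: "\<forall>J\<in>B. p J \<in> P_sub W I s w J" "v = (\<lambda>u. \<Sum>J\<in>B. p J u)"
      using v unfolding N by blast
    show ?thesis unfolding N p(2) sum using p(1) closed by (intro exI[of _ "\<lambda>J. F (p J)"]) simp
  qed
  show "submodule ?N algebra T"
  proof (rule translation_submoduleI)
    show "?N \<subseteq> carrier T"
    proof
      fix v assume "v \<in> ?N"
      then obtain p where p: "\<forall>J\<in>B. p J \<in> P_sub W I s w J" "v = (\<lambda>u. \<Sum>J\<in>B. p J u)"
        unfolding N by blast
      then show "v \<in> carrier T" using PT by (auto simp: carrier_T intro!: sum.neutral)
    qed
    show "(\<lambda>_. 0) \<in> ?N"
      unfolding N using T.submodule_zero[OF sub] by (intro exI[of _ "\<lambda>_ _. 0"]) (simp add: zero_T)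
  next
    fix v v' c assume "v \<in> ?N" "v' \<in> ?N"
    then obtain p p' where p: "\<forall>J\<in>B. p J \<in> P_sub W I s w J" "v = (\<lambda>u. \<Sum>J\<in>B. p J u)"
        "\<forall>J\<in>B. p' J \<in> P_sub W I s w J" "v' = (\<lambda>u. \<Sum>J\<in>B. p' J u)"
      unfolding N by blast
    have "(\<lambda>u. p J u + c * p' J u) \<in> P_sub W I s w J" if "J \<in> B" for J
      using submodule_add_pointwise[OF sub[OF that] _ submodule_scalar[OF sub[OF that], of "p' J" c]]
        p that by simp
    then show "(\<lambda>u. v u + c * v' u) \<in> ?N"
      unfolding N p by (intro exI[of _ "\<lambda>J u. p J u + c * p' J u"]) (simp add: sum.distrib sum_distrib_left)
  next
    fix k v assume k: "k \<in> I" and v: "v \<in> ?N"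
    show "up_vec k v \<in> ?N"
    proof (rule op[OF v])
      show "up_vec k (\<lambda>u. \<Sum>J\<in>B. p J u) = (\<lambda>u. \<Sum>J\<in>B. up_vec k (p J) u)" for p
        by (rule ext) (auto simp: up_vec_def sum.distrib intro!: sum.neutral)
    qed (rule submodule_up[OF sub _ k])
    show "down_vec k v \<in> ?N"
    proof (rule op[OF v])
      show "down_vec k (\<lambda>u. \<Sum>J\<in>B. p J u) = (\<lambda>u. \<Sum>J\<in>B. down_vec k (p J) u)" for p
        by (rule ext) (auto simp: down_vec_def sum.distrib intro!: sum.neutral)
    qed (rule submodule_down[OF sub _ k])
  qed
  show "?N \<noteq> carrier T"
  proof
    assume "?N = carrier T"
    then have "single \<one> 1 \<in> ?N" using single_in_T[OF one_below[OF w]] by simp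
    then obtain p where p: "\<forall>J\<in>B. p J \<in> P_sub W I s w J" "single \<one> (1::'k) = (\<lambda>u. \<Sum>J\<in>B. p J u)"
      unfolding N by blast
    have zero: "top_functional (p J) = 0" if "J \<in> B" for J
      using submodule_eq_carrier[OF sub[OF that], of "p J"] P_sub_proper[of J] p(1) that
      by (auto simp: B_def)
    have "top_functional (\<lambda>u. \<Sum>J\<in>C. p J u) = 0" if "finite C" "C \<subseteq> B" for C
      using that
    proof (induction C)
      case empty
      show ?case using top_functional_linear[of "\<lambda>_. 0" "-1" "\<lambda>_. 0"] by simp
    next
      case (insert J C)
      then show ?case
        using top_functional_linear[of "p J" 1 "\<lambda>u. \<Sum>J\<in>C. p J u"] zero[of J] by simp
    qed
    from this[OF B] have "top_functional (single \<one> 1) = 0" using p(2) by simp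
    then show False using top_functional_one by simp
  qed
qed

end

theorem corollary6p2:
  fixes W :: "('a, 'b) monoid_scheme" and I :: "'i set" and s :: "'i \<Rightarrow> 'a" and w :: 'a
  assumes "finite_coxeter_system W I s" and "w \<in> carrier W"
  shows "(\<exists>T :: (('a \<Rightarrow> 'a) \<Rightarrow> 'k::field, 'a \<Rightarrow> 'k) module. translation_module W I s w T) \<and>
    (\<forall>T :: (('a \<Rightarrow> 'a) \<Rightarrow> 'k, 'a \<Rightarrow> 'k) module. translation_module W I s w T \<longrightarrow>
       indecomposable_module (monoid_algebra (biHecke W I s)) T \<and>
       (\<forall>P :: (('a \<Rightarrow> 'a) \<Rightarrow> 'k, 'v) module.
          projective_cover (monoid_algebra (biHecke W I s)) P (simple_quotient W I s w T) \<longrightarrow>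
            indecomposable_module (monoid_algebra (biHecke W I s)) P \<and>
            is_quotient_of (monoid_algebra (biHecke W I s)) T P))"
proof (intro conjI allI impI)
  have "group W" using assms(1) by (simp add: finite_coxeter_system_def)
  then have cox: "coxeter_system W I s"
    using assms(1) by (simp add: coxeter_system_def coxeter_system_axioms_def)
  show "\<exists>T :: (('a \<Rightarrow> 'a) \<Rightarrow> 'k::field, 'a \<Rightarrow> 'k) module. translation_module W I s w T"
    by (rule coxeter_system.translation_module_exists[OF cox assms(2)])
  fix T :: "(('a \<Rightarrow> 'a) \<Rightarrow> 'k, 'a \<Rightarrow> 'k) module"
  assume T: "translation_module W I s w T"
  interpret translation_rep W I s w T
    using cox assms(2) T by (simp add: translation_rep_def translation_rep_axioms_def)
  show "indecomposable_module (monoid_algebra (biHecke W I s)) T"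
    by (rule local_module_indecomposable[OF local_T T_nonzero])
  fix P :: "(('a \<Rightarrow> 'a) \<Rightarrow> 'k, 'v) module"
  assume "projective_cover (monoid_algebra (biHecke W I s)) P (simple_quotient W I s w T)"
  then have "projective_cover (monoid_algebra (biHecke W I s)) P (quotient_module T (P_sum W I s w))"
    by (simp add: simple_quotient_def)
  from projective_cover_of_local_quotient[OF local_T submodule_P_sum P_sum_proper this]
  show "indecomposable_module (monoid_algebra (biHecke W I s)) P"
    "is_quotient_of (monoid_algebra (biHecke W I s)) T P" by simp_all
qed

end
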